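(* Let $\mathbb{F}$ be a field. The alternating trilinear form equivalence problem over $\mathbb{F}$ is polynomial-time equivalent to the symmetric trilinear form equivalence problem over $\mathbb{F}$.
   Context: A trilinear form $\phi:\mathbb{F}^n\times\mathbb{F}^n\times\mathbb{F}^n\to\mathbb{F}$ is symmetric if $\phi(u_1,u_2,u_3)=\phi(u_{\sigma(1)},u_{\sigma(2)},u_{\sigma(3)})$ for all $\sigma\in S_3$ and all $u_i$, and alternating if $\phi$ evaluates to zero whenever two of its arguments are equal. A trilinear form is represented as the 3-way array $(\phi(e_i,e_j,e_k))_{i,j,k\in[n]}$, where $e_i$ are the standard basis vectors. $A\in\mathrm{GL}(n,\mathbb{F})$ acts by $(\phi\circ A)(u,v,w)=\phi(A^{-1}u,A^{-1}v,A^{-1}w)$. The (symmetric, resp. alternating) trilinear form equivalence problem asks: given two (symmetric, resp. alternating) trilinear forms $\phi,\psi$ on $\mathbb{F}^n$, decide whether there exists $A\in\mathrm{GL}(n,\mathbb{F})$ with $\phi=\psi\circ A$. *)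

theory Defs
  imports
    "Jordan_Normal_Form.Matrix"
    "HOL-Combinatorics.Permutations"
    "HOL-Computational_Algebra.Polynomial"
begin

section \<open>Trilinear forms on F^n\<close>

text \<open>
  A form on F^n is a HOL function on all vectors; only its values on \<open>carrier_vec n\<close> matter, and
  everything below is relativised to that carrier.
\<close>

type_synonym 'a form3 = "'a vec \<Rightarrow> 'a vec \<Rightarrow> 'a vec \<Rightarrow> 'a"

definition linear_form :: "nat \<Rightarrow> ('a::field vec \<Rightarrow> 'a) \<Rightarrow> bool" where
  "linear_form n f \<longleftrightarrow>
     (\<forall>u\<in>carrier_vec n. \<forall>v\<in>carrier_vec n. f (u + v) = f u + f v) \<and>
     (\<forall>a. \<forall>u\<in>carrier_vec n. f (a \<cdot>\<^sub>v u) = a * f u)"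

definition trilinear_form :: "nat \<Rightarrow> 'a::field form3 \<Rightarrow> bool" where
  "trilinear_form n \<phi> \<longleftrightarrow>
     (\<forall>v\<in>carrier_vec n. \<forall>w\<in>carrier_vec n.
        linear_form n (\<lambda>u. \<phi> u v w) \<and> linear_form n (\<lambda>u. \<phi> v u w) \<and> linear_form n (\<lambda>u. \<phi> v w u))"

definition symmetric_form :: "nat \<Rightarrow> 'a::field form3 \<Rightarrow> bool" where
  "symmetric_form n \<phi> \<longleftrightarrow>
     (\<forall>u :: nat \<Rightarrow> 'a vec. \<forall>\<sigma>. u ` {1..3} \<subseteq> carrier_vec n \<longrightarrow> \<sigma> permutes {1..3} \<longrightarrow>
        \<phi> (u 1) (u 2) (u 3) = \<phi> (u (\<sigma> 1)) (u (\<sigma> 2)) (u (\<sigma> 3)))"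

definition alternating_form :: "nat \<Rightarrow> 'a::field form3 \<Rightarrow> bool" where
  "alternating_form n \<phi> \<longleftrightarrow>
     (\<forall>u\<in>carrier_vec n. \<forall>v\<in>carrier_vec n. \<phi> u u v = 0 \<and> \<phi> u v u = 0 \<and> \<phi> v u u = 0)"

abbreviation GL :: "nat \<Rightarrow> 'a::field mat set" where
  "GL n \<equiv> Units (ring_mat TYPE('a) n ())"

definition form_act :: "nat \<Rightarrow> 'a::field form3 \<Rightarrow> 'a mat \<Rightarrow> 'a form3" where
  "form_act n \<phi> A = (\<lambda>u v w.
     let B = inv\<^bsub>ring_mat TYPE('a) n ()\<^esub> A in \<phi> (B *\<^sub>v u) (B *\<^sub>v v) (B *\<^sub>v w))"

definition equivalent_forms :: "nat \<Rightarrow> 'a::field form3 \<Rightarrow> 'a form3 \<Rightarrow> bool" where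
  "equivalent_forms n \<phi> \<psi> \<longleftrightarrow>
     (\<exists>A\<in>GL n. \<forall>u\<in>carrier_vec n. \<forall>v\<in>carrier_vec n. \<forall>w\<in>carrier_vec n.
        \<phi> u v w = form_act n \<psi> A u v w)"


section \<open>The equivalence problems as decision problems over F\<close>

text \<open>
  A problem is a set of valid inputs (words over F) together with the set of yes-inputs.
  An instance is the pair of 3-way arrays of the two forms, each listed in lexicographic order of
  the index triples; the word has length \<open>2 * n ^ 3\<close>, so it determines \<open>n\<close> and, since the forms
  are trilinear, both forms on \<open>carrier_vec n\<close>.
\<close>

type_synonym 'a problem = "'a list set \<times> 'a list set"

definition form_array :: "nat \<Rightarrow> 'a::field form3 \<Rightarrow> 'a list" where
  "form_array n \<phi> =
     [\<phi> (unit_vec n i) (unit_vec n j) (unit_vec n k). i \<leftarrow> [0..<n], j \<leftarrow> [0..<n], k \<leftarrow> [0..<n]]"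

definition form_equivalence_problem :: "(nat \<Rightarrow> 'a::field form3 \<Rightarrow> bool) \<Rightarrow> 'a problem" where
  "form_equivalence_problem P =
     ({form_array n \<phi> @ form_array n \<psi> | n \<phi> \<psi>.
         trilinear_form n \<phi> \<and> trilinear_form n \<psi> \<and> P n \<phi> \<and> P n \<psi>},
      {form_array n \<phi> @ form_array n \<psi> | n \<phi> \<psi>.
         trilinear_form n \<phi> \<and> trilinear_form n \<psi> \<and> P n \<phi> \<and> P n \<psi> \<and> equivalent_forms n \<phi> \<psi>})"

definition symmetric_form_equivalence :: "'a::field problem" where
  "symmetric_form_equivalence = form_equivalence_problem symmetric_form"

definition alternating_form_equivalence :: "'a::field problem" where
  "alternating_form_equivalence = form_equivalence_problem alternating_form"


section \<open>Random access machines over F\<close>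

text \<open>
  The machine has index registers holding natural numbers and a memory of field elements.
  Field memory is addressed indirectly: an operand \<open>r\<close> of a field instruction denotes the memory
  cell whose address is the content of index register \<open>r\<close>. Index registers admit addition and
  truncated subtraction but no multiplication, so that an index computed in \<open>t\<close> steps has
  \<open>O(t)\<close> bits beyond the bit length of the input length. Finitely many constants of F may occur in a
  program.
\<close>

datatype field_op = FPlus | FMinus | FTimes | FDivide

fun eval_op :: "field_op \<Rightarrow> 'a::field \<Rightarrow> 'a \<Rightarrow> 'a" where
  "eval_op FPlus x y = x + y"
| "eval_op FMinus x y = x - y"
| "eval_op FTimes x y = x * y"
| "eval_op FDivide x y = x / y"

datatype test = IndexLess nat nat | FieldZero nat

datatype 'a com =
    Skip
  | IndexConst nat nat
  | IndexAdd nat nat nat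
  | IndexSub nat nat nat
  | FieldConst nat 'a
  | FieldCopy nat nat
  | FieldOp field_op nat nat nat
  | Seq "'a com" "'a com"
  | Cond test "'a com" "'a com"
  | While test "'a com"

type_synonym 'a state = "(nat \<Rightarrow> nat) \<times> (nat \<Rightarrow> 'a)"

fun test_holds :: "test \<Rightarrow> 'a::field state \<Rightarrow> bool" where
  "test_holds (IndexLess r s) (I, M) \<longleftrightarrow> I r < I s"
| "test_holds (FieldZero r) (I, M) \<longleftrightarrow> M (I r) = 0"

text \<open>
  Costs are relative to a size \<open>sz\<close> of field elements: an instruction costs one plus the sizes of
  the field elements it reads and writes. With \<open>sz = (\<lambda>_. 0)\<close> this is the unit-cost
  (Blum--Shub--Smale) model over F; for F the rationals and \<open>sz\<close> the bit length of
  numerator and denominator it is the logarithmic-cost model, which is polynomially equivalent to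
  Turing machines.
\<close>

fun test_cost :: "('a::field \<Rightarrow> nat) \<Rightarrow> test \<Rightarrow> 'a state \<Rightarrow> nat" where
  "test_cost sz (IndexLess r s) (I, M) = 1"
| "test_cost sz (FieldZero r) (I, M) = 1 + sz (M (I r))"

inductive exec :: "('a::field \<Rightarrow> nat) \<Rightarrow> 'a com \<Rightarrow> 'a state \<Rightarrow> nat \<Rightarrow> 'a state \<Rightarrow> bool"
  for sz :: "'a::field \<Rightarrow> nat" where
  Skip: "exec sz Skip s 1 s"
| IndexConst: "exec sz (IndexConst r k) (I, M) 1 (I(r := k), M)"
| IndexAdd: "exec sz (IndexAdd r p q) (I, M) 1 (I(r := I p + I q), M)"
| IndexSub: "exec sz (IndexSub r p q) (I, M) 1 (I(r := I p - I q), M)"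
| FieldConst: "exec sz (FieldConst r a) (I, M) (1 + sz a) (I, M(I r := a))"
| FieldCopy: "exec sz (FieldCopy r p) (I, M) (1 + sz (M (I p))) (I, M(I r := M (I p)))"
| FieldOp: "x = M (I p) \<Longrightarrow> y = M (I q) \<Longrightarrow> z = eval_op f x y \<Longrightarrow>
    exec sz (FieldOp f r p q) (I, M) (1 + sz x + sz y + sz z) (I, M(I r := z))"
| Seq: "exec sz c1 s t1 s' \<Longrightarrow> exec sz c2 s' t2 s'' \<Longrightarrow> exec sz (Seq c1 c2) s (t1 + t2) s''"
| CondTrue: "test_holds b s \<Longrightarrow> exec sz c1 s t s' \<Longrightarrow>
    exec sz (Cond b c1 c2) s (test_cost sz b s + t) s'"
| CondFalse: "\<not> test_holds b s \<Longrightarrow> exec sz c2 s t s' \<Longrightarrow>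
    exec sz (Cond b c1 c2) s (test_cost sz b s + t) s'"
| WhileFalse: "\<not> test_holds b s \<Longrightarrow> exec sz (While b c) s (test_cost sz b s) s"
| WhileTrue: "test_holds b s \<Longrightarrow> exec sz c s t1 s' \<Longrightarrow> exec sz (While b c) s' t2 s'' \<Longrightarrow>
    exec sz (While b c) s (test_cost sz b s + t1 + t2) s''"

inductive_cases exec_elims:
  "exec sz Skip s t s'"
  "exec sz (IndexConst r k) s t s'"
  "exec sz (IndexAdd r p q) s t s'"
  "exec sz (IndexSub r p q) s t s'"
  "exec sz (FieldConst r a) s t s'"
  "exec sz (FieldCopy r p) s t s'"
  "exec sz (FieldOp f r p q) s t s'"
  "exec sz (Seq c1 c2) s t s'"
  "exec sz (Cond b c1 c2) s t s'"
inductive_cases exec_WhileE: "exec sz (While b c) s t s'"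

lemma exec_deterministic:
  "exec sz c s t s' \<Longrightarrow> exec sz c s u s'' \<Longrightarrow> u = t \<and> s'' = s'"
proof (induction arbitrary: u s'' rule: exec.induct)
  case (WhileFalse b s c)
  from WhileFalse.prems WhileFalse.hyps show ?case by (auto elim: exec_WhileE)
next
  case (WhileTrue b s c t1 s1 t2 s2)
  from WhileTrue.prems WhileTrue.hyps(1) obtain v1 r v2
    where r: "exec sz c s v1 r" "exec sz (While b c) r v2 s''" "u = test_cost sz b s + v1 + v2"
    by (auto elim: exec_WhileE)
  from WhileTrue.IH(1)[OF r(1)] WhileTrue.IH(2) r(2,3) show ?case by auto
next
  case (Seq c1 s t1 s1 c2 t2 s2)
  from Seq.prems obtain v1 r v2
    where r: "exec sz c1 s v1 r" "exec sz c2 r v2 s''" "u = v1 + v2"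
    by (auto elim: exec_elims)
  from Seq.IH(1)[OF r(1)] Seq.IH(2) r(2,3) show ?case by auto
qed (erule exec_elims; fastforce)+

text \<open>
  The input length is in index register 0 and the input word in the memory cells
  0, 1, 2, ...; the output is read off in the same way.
\<close>

definition input_state :: "'a::field list \<Rightarrow> 'a state" where
  "input_state w = ((\<lambda>_. 0)(0 := length w), \<lambda>i. if i < length w then w ! i else 0)"

definition output_word :: "'a state \<Rightarrow> 'a list" where
  "output_word s = map (snd s) [0..<fst s 0]"

definition word_size :: "('a \<Rightarrow> nat) \<Rightarrow> 'a list \<Rightarrow> nat" where
  "word_size sz w = (\<Sum>x\<leftarrow>w. 1 + sz x)"

text \<open>Field operations increase sizes at most polynomially, as for bit lengths and heights.\<close>

definition admissible_size :: "('a::field \<Rightarrow> nat) \<Rightarrow> bool" where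
  "admissible_size sz \<longleftrightarrow>
     (\<exists>p :: nat poly. \<forall>f x y. sz (eval_op f x y) \<le> poly p (sz x + sz y))"

lemma admissible_size_unit_cost: "admissible_size (\<lambda>_. 0)"
  by (simp add: admissible_size_def)


section \<open>Polynomial-time equivalence\<close>

text \<open>
  Polynomial-time many-one reducibility. Index addition could make the output exponentially
  longer than the running time, hence the size of the output is charged as well.
\<close>

definition poly_time_reducible ::
    "('a::field \<Rightarrow> nat) \<Rightarrow> 'a problem \<Rightarrow> 'a problem \<Rightarrow> bool" where
  "poly_time_reducible sz P Q \<longleftrightarrow>
     (\<exists>c :: 'a com. \<exists>p :: nat poly. \<forall>w\<in>fst P. \<exists>t s.
        exec sz c (input_state w) t s \<and>
        t + word_size sz (output_word s) \<le> poly p (word_size sz w) \<and>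
        output_word s \<in> fst Q \<and>
        (w \<in> snd P \<longleftrightarrow> output_word s \<in> snd Q))"

definition poly_time_equivalent ::
    "('a::field \<Rightarrow> nat) \<Rightarrow> 'a problem \<Rightarrow> 'a problem \<Rightarrow> bool" where
  "poly_time_equivalent sz P Q \<longleftrightarrow> poly_time_reducible sz P Q \<and> poly_time_reducible sz Q P"

end

theory Submission
  imports Defs "Jordan_Normal_Form.Determinant"
begin

text \<open>
  One construction serves both directions. To a trilinear form \<open>\<phi>\<close> on \<open>U = F^n\<close> attach three copies
  \<open>U\<^sub>0, U\<^sub>1, U\<^sub>2\<close> of \<open>U\<close>, one copy \<open>X\<close> of its dual, three scalars \<open>z\<^sub>0, z\<^sub>1, z\<^sub>2\<close>, and the trilinear form
  \<open>\<phi>(u\<^sub>0, u\<^sub>1, u\<^sub>2) + \<Sum>\<^sub>i \<langle>u\<^sub>i, x\<rangle> z\<^sub>i + z\<^sub>0 z\<^sub>1 z\<^sub>2\<close>, and (skew-)symmetrise it over the six permutations of the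
  arguments; the sign \<open>\<epsilon> = 1\<close> or \<open>\<epsilon> = -1\<close> of the odd ones decides whether the result is symmetric or
  alternating. If an isomorphism acts on the seven summands separately, by \<open>A\<^sub>i\<close> on \<open>U\<^sub>i\<close>, \<open>C\<close> on
  \<open>X\<close> and \<open>\<zeta>\<^sub>i\<close> on the scalars, then the middle terms give \<open>\<zeta>\<^sub>i A\<^sub>i = C\<^sup>-\<^sup>T\<close> for all \<open>i\<close> and the last one
  \<open>\<zeta>\<^sub>0 \<zeta>\<^sub>1 \<zeta>\<^sub>2 = 1\<close>, so \<open>C\<^sup>-\<^sup>T\<close> is an isomorphism of the original forms.

  Isomorphisms are forced to respect the summands, modulo a harmless subspace, by a labelling gadget:
  the \<open>i\<close>-th summand \<open>E\<^sub>i\<close> is paired with new spaces \<open>P\<^sub>i\<close> and \<open>Q\<^sub>i = (E\<^sub>i \<otimes> P\<^sub>i)\<^sup>*\<close>, where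
  \<open>dim P\<^sub>i = M + i\<close> with \<open>M\<close> larger than the sum of the dimensions of the \<open>E\<^sub>i\<close>. The vectors
  \<open>v\<close> for which the bilinear form \<open>\<Phi>(v, _, _)\<close> has small rank form the sum \<open>D\<close> of all \<open>P\<^sub>i\<close> and
  \<open>Q\<^sub>i\<close>, and on \<open>D\<close> the rank of \<open>\<Phi>(v, _, _)\<close> is twice the sum of \<open>M + i\<close> over the summands in which
  \<open>v\<close> has a component; as \<open>M + i < 2 M\<close>, this rank determines the summand of a vector lying in one of
  them.
\<close>

section \<open>Bilinear forms of bounded rank\<close>

definition rank_le :: "nat \<Rightarrow> 'b set \<Rightarrow> ('b \<Rightarrow> 'b \<Rightarrow> 'a::field) \<Rightarrow> bool" where
  "rank_le k D b \<longleftrightarrow> (\<exists>A B. \<forall>v\<in>D. \<forall>w\<in>D. b v w = (\<Sum>l<k. A l v * B l w))"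

lemma rank_leI: "(\<And>v w. v \<in> D \<Longrightarrow> w \<in> D \<Longrightarrow> b v w = (\<Sum>l<k. A l v * B l w)) \<Longrightarrow> rank_le k D b"
  unfolding rank_le_def by blast

lemma rank_le_pullback:
  assumes "rank_le k D b"
    and h: "\<And>v. v \<in> D' \<Longrightarrow> h v \<in> D"
    and b': "\<And>v w. v \<in> D' \<Longrightarrow> w \<in> D' \<Longrightarrow> b' v w = b (h v) (h w)"
  shows "rank_le k D' b'"
proof -
  obtain A B where "\<And>v w. v \<in> D \<Longrightarrow> w \<in> D \<Longrightarrow> b v w = (\<Sum>l<k. A l v * B l w)"
    using assms(1) unfolding rank_le_def by blast
  then show ?thesis
    by (intro rank_leI[where A = "\<lambda>l v. A l (h v)" and B = "\<lambda>l w. B l (h w)"]) (simp add: h b')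
qed

lemma rank_le_add:
  assumes "rank_le k D b" "rank_le k' D b'"
  shows "rank_le (k + k') D (\<lambda>v w. b v w + b' v w)"
proof -
  obtain A B A' B' where b: "\<And>v w. v \<in> D \<Longrightarrow> w \<in> D \<Longrightarrow> b v w = (\<Sum>l<k. A l v * B l w)"
    and b': "\<And>v w. v \<in> D \<Longrightarrow> w \<in> D \<Longrightarrow> b' v w = (\<Sum>l<k'. A' l v * B' l w)"
    using assms unfolding rank_le_def by blast
  let ?A = "\<lambda>l. if l < k then A l else A' (l - k)"
  let ?B = "\<lambda>l. if l < k then B l else B' (l - k)"
  show ?thesis
  proof (rule rank_leI)
    fix v w assume "v \<in> D" "w \<in> D"
    have "(\<Sum>l<k + k'. ?A l v * ?B l w) = (\<Sum>l<k. ?A l v * ?B l w) + (\<Sum>l=k..<k + k'. ?A l v * ?B l w)"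
      by (simp only: lessThan_atLeast0 sum.atLeastLessThan_concat[symmetric, of 0 k "k + k'"] le_add1 zero_le)
    also have "(\<Sum>l=k..<k + k'. ?A l v * ?B l w) = (\<Sum>l<k'. A' l v * B' l w)"
      by (rule sum.reindex_bij_witness[of _ "\<lambda>l. l + k" "\<lambda>l. l - k"]) auto
    finally show "b v w + b' v w = (\<Sum>l<k + k'. ?A l v * ?B l w)"
      using b b' \<open>v \<in> D\<close> \<open>w \<in> D\<close> by simp
  qed
qed

lemma det_mult_narrow:
  fixes A B :: "nat \<Rightarrow> nat \<Rightarrow> 'a::field"
  assumes "k < m"
  shows "det (mat m m (\<lambda>(i, j). \<Sum>l<k. A i l * B l j)) = 0"
proof -
  let ?A = "mat m m (\<lambda>(i, l). if l < k then A i l else 0)" and ?B = "mat m m (\<lambda>(l, j). B l j)"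
  have "(\<Sum>l<k. A i l * B l j) = (\<Sum>l = 0..<m. (if l < k then A i l else 0) * B l j)" for i j
    using assms by (intro sum.mono_neutral_cong_left) auto
  then have "mat m m (\<lambda>(i, j). \<Sum>l<k. A i l * B l j) = ?A * ?B"
    by (intro eq_matI) (auto simp: scalar_prod_def)
  then have "det (mat m m (\<lambda>(i, j). \<Sum>l<k. A i l * B l j)) = det ?A * det ?B"
    by (simp add: det_mult[of _ m])
  also have "det ?A = 0"
    using assms by (subst laplace_expansion_column[of _ m k]) (auto intro: sum.neutral)
  finally show ?thesis by simp
qed

lemma rank_le_card_diagonal:
  fixes b :: "'b \<Rightarrow> 'b \<Rightarrow> 'a::field"
  assumes "rank_le k D b" "finite S"
    and xy: "\<And>s. s \<in> S \<Longrightarrow> x s \<in> D \<and> y s \<in> D"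
    and diag: "\<And>s. s \<in> S \<Longrightarrow> b (x s) (y s) \<noteq> 0"
    and off_diag: "\<And>s t. s \<in> S \<Longrightarrow> t \<in> S \<Longrightarrow> s \<noteq> t \<Longrightarrow> b (x s) (y t) = 0"
  shows "card S \<le> k"
proof (rule ccontr)
  let ?m = "card S"
  assume "\<not> ?m \<le> k"
  obtain h where h: "bij_betw h {0..<?m} S" using ex_bij_betw_nat_finite[OF assms(2)] by blast
  then have hS: "h i \<in> S" if "i < ?m" for i using that by (auto simp: bij_betw_def)
  have h_eq: "h i = h j \<longleftrightarrow> i = j" if "i < ?m" "j < ?m" for i j
    using h that by (auto simp: bij_betw_def inj_on_def)
  obtain A B where b: "\<And>v w. v \<in> D \<Longrightarrow> w \<in> D \<Longrightarrow> b v w = (\<Sum>l<k. A l v * B l w)"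
    using assms(1) unfolding rank_le_def by blast
  define G where "G = mat ?m ?m (\<lambda>(i, j). b (x (h i)) (y (h j)))"
  have "G = mat ?m ?m (\<lambda>(i, j). \<Sum>l<k. A l (x (h i)) * B l (y (h j)))"
    unfolding G_def by (intro eq_matI) (auto simp: b hS xy)
  then have "det G = 0" using \<open>\<not> ?m \<le> k\<close> by (simp add: det_mult_narrow)
  moreover have "upper_triangular G" using hS h_eq off_diag by (auto simp: G_def)
  then have "det G = (\<Prod>i = 0..<?m. b (x (h i)) (y (h i)))"
    using det_upper_triangular[of G ?m] by (simp add: G_def prod_list_diag_prod)
  ultimately show False using diag hS by auto
qed

section \<open>Linear maps and trilinear forms\<close>

lemma linear_form_add:
  "linear_form n f \<Longrightarrow> u \<in> carrier_vec n \<Longrightarrow> v \<in> carrier_vec n \<Longrightarrow> f (u + v) = f u + f v"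
  and linear_form_smult: "linear_form n f \<Longrightarrow> u \<in> carrier_vec n \<Longrightarrow> f (a \<cdot>\<^sub>v u) = a * f u"
  by (auto simp: linear_form_def)

lemma smult_zero_vec: "v \<in> carrier_vec n \<Longrightarrow> 0 \<cdot>\<^sub>v v = (0\<^sub>v n :: 'a::field vec)"
  by auto

lemma linear_form_zero: "linear_form n f \<Longrightarrow> f (0\<^sub>v n) = 0"
  using linear_form_smult[of n f "0\<^sub>v n" 0] by (simp add: smult_zero_vec[of _ n])

lemma linear_form_expand:
  assumes f: "linear_form n f" and v: "v \<in> carrier_vec n"
  shows "f v = (\<Sum>i<n. v $ i * f (unit_vec n i))"
proof -
  let ?trunc = "\<lambda>k. vec n (\<lambda>i. if i < k then v $ i else 0)"
  have "f (?trunc k) = (\<Sum>i<k. v $ i * f (unit_vec n i))" if "k \<le> n" for k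
    using that
  proof (induction k)
    case 0
    have "?trunc 0 = 0\<^sub>v n" by auto
    then show ?case by (simp add: linear_form_zero[OF f])
  next
    case (Suc k)
    have "?trunc (Suc k) = ?trunc k + v $ k \<cdot>\<^sub>v unit_vec n k"
      using Suc.prems by (intro eq_vecI) (auto simp: less_Suc_eq)
    then show ?case using Suc by (simp add: linear_form_add[OF f] linear_form_smult[OF f])
  qed
  moreover have "?trunc n = v" using v by auto
  ultimately show ?thesis by (metis order_refl)
qed

definition linear_map :: "nat \<Rightarrow> nat \<Rightarrow> ('a::field vec \<Rightarrow> 'a vec) \<Rightarrow> bool" where
  "linear_map n m f \<longleftrightarrow>
     (\<forall>u\<in>carrier_vec n. f u \<in> carrier_vec m) \<and>
     (\<forall>u\<in>carrier_vec n. \<forall>v\<in>carrier_vec n. f (u + v) = f u + f v) \<and>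
     (\<forall>a. \<forall>u\<in>carrier_vec n. f (a \<cdot>\<^sub>v u) = a \<cdot>\<^sub>v f u)"

lemma linear_map_carrier: "linear_map n m f \<Longrightarrow> u \<in> carrier_vec n \<Longrightarrow> f u \<in> carrier_vec m"
  and linear_map_add: "linear_map n m f \<Longrightarrow> u \<in> carrier_vec n \<Longrightarrow> v \<in> carrier_vec n \<Longrightarrow> f (u + v) = f u + f v"
  and linear_map_smult: "linear_map n m f \<Longrightarrow> u \<in> carrier_vec n \<Longrightarrow> f (a \<cdot>\<^sub>v u) = a \<cdot>\<^sub>v f u"
  by (auto simp: linear_map_def)

lemma linear_map_zero:
  fixes f :: "'a::field vec \<Rightarrow> 'a vec"
  assumes "linear_map n m f"
  shows "f (0\<^sub>v n) = 0\<^sub>v m"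
  using linear_map_smult[OF assms, of "0\<^sub>v n" 0] linear_map_carrier[OF assms, of "0\<^sub>v n"]
  by (simp add: smult_zero_vec[of _ n] smult_zero_vec[of _ m])

lemma linear_map_scale:
  assumes "linear_map n m f"
  shows "linear_map n m (\<lambda>u. c \<cdot>\<^sub>v f u)"
  using assms unfolding linear_map_def
  by (simp add: smult_add_distrib_vec[of _ m] smult_smult_assoc mult.commute)

lemma linear_map_comp: "linear_map n m f \<Longrightarrow> linear_map m l g \<Longrightarrow> linear_map n l (\<lambda>v. g (f v))"
  by (simp add: linear_map_def)

lemma linear_map_mult_mat_vec: "A \<in> carrier_mat m n \<Longrightarrow> linear_map n m ((*\<^sub>v) A)"
  by (auto simp: linear_map_def mult_add_distrib_mat_vec mult_mat_vec)

lemma linear_map_index: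
  assumes f: "linear_map n m f" and i: "i < m"
  shows "linear_form n (\<lambda>v. f v $ i)"
  using f i linear_map_carrier[OF f, THEN carrier_vecD] by (auto simp: linear_map_def linear_form_def)

lemma linear_map_matrix:
  assumes f: "linear_map n m f"
  obtains A where "A \<in> carrier_mat m n" "\<And>v. v \<in> carrier_vec n \<Longrightarrow> f v = A *\<^sub>v v"
proof
  let ?A = "mat m n (\<lambda>(i, j). f (unit_vec n j) $ i)"
  show "?A \<in> carrier_mat m n" by simp
  fix v :: "'a vec" assume v: "v \<in> carrier_vec n"
  show "f v = ?A *\<^sub>v v"
  proof (rule eq_vecI)
    fix i assume "i < dim_vec (?A *\<^sub>v v)"
    then show "f v $ i = (?A *\<^sub>v v) $ i"
      using v linear_form_expand[OF linear_map_index[OF f] v, of i]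
      by (simp add: scalar_prod_def mult.commute lessThan_atLeast0)
  qed (use linear_map_carrier[OF f v] in auto)
qed

lemma trilinear_form_linear:
  assumes "trilinear_form n \<phi>" "v \<in> carrier_vec n" "w \<in> carrier_vec n"
  shows "linear_form n (\<lambda>u. \<phi> u v w)" "linear_form n (\<lambda>u. \<phi> v u w)" "linear_form n (\<lambda>u. \<phi> v w u)"
  using assms by (auto simp: trilinear_form_def)

lemma trilinear_form_zero:
  assumes "trilinear_form n \<phi>" "v \<in> carrier_vec n" "w \<in> carrier_vec n"
  shows "\<phi> (0\<^sub>v n) v w = 0" "\<phi> v (0\<^sub>v n) w = 0" "\<phi> v w (0\<^sub>v n) = 0"
  using trilinear_form_linear[OF assms, THEN linear_form_zero] .

lemma trilinear_form_smult:
  assumes "trilinear_form n \<phi>" "u \<in> carrier_vec n" "v \<in> carrier_vec n" "w \<in> carrier_vec n"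
  shows "\<phi> (a \<cdot>\<^sub>v u) (b \<cdot>\<^sub>v v) (c \<cdot>\<^sub>v w) = a * b * c * \<phi> u v w"
  using assms unfolding trilinear_form_def linear_form_def by simp

lemma trilinear_form_expand:
  assumes \<phi>: "trilinear_form n \<phi>"
    and u: "u \<in> carrier_vec n" and v: "v \<in> carrier_vec n" and w: "w \<in> carrier_vec n"
  shows "\<phi> u v w = (\<Sum>a<n. \<Sum>b<n. \<Sum>c<n.
    u $ a * (v $ b * (w $ c * \<phi> (unit_vec n a) (unit_vec n b) (unit_vec n c))))"
proof -
  have "\<phi> u v w = (\<Sum>a<n. u $ a * \<phi> (unit_vec n a) v w)"
    by (rule linear_form_expand[OF trilinear_form_linear(1)[OF \<phi> v w] u])
  also have "\<dots> = (\<Sum>a<n. u $ a * (\<Sum>b<n. v $ b * \<phi> (unit_vec n a) (unit_vec n b) w))"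
    by (simp add: linear_form_expand[OF trilinear_form_linear(2)[OF \<phi> _ w] v])
  also have "\<dots> = (\<Sum>a<n. u $ a * (\<Sum>b<n. v $ b *
      (\<Sum>c<n. w $ c * \<phi> (unit_vec n a) (unit_vec n b) (unit_vec n c))))"
    by (simp add: linear_form_expand[OF trilinear_form_linear(3)[OF \<phi>] w])
  finally show ?thesis by (simp add: sum_distrib_left)
qed

lemma trilinear_form_eqI:
  assumes "trilinear_form n \<phi>" "trilinear_form n \<psi>"
    and "\<And>a b c. a < n \<Longrightarrow> b < n \<Longrightarrow> c < n \<Longrightarrow>
      \<phi> (unit_vec n a) (unit_vec n b) (unit_vec n c) = \<psi> (unit_vec n a) (unit_vec n b) (unit_vec n c)"
    and "u \<in> carrier_vec n" "v \<in> carrier_vec n" "w \<in> carrier_vec n"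
  shows "\<phi> u v w = \<psi> u v w"
  using assms by (simp add: trilinear_form_expand[of n _ u v w])

lemma trilinear_form_add:
  "trilinear_form n S \<Longrightarrow> trilinear_form n T \<Longrightarrow> trilinear_form n (\<lambda>u v w. S u v w + T u v w)"
  by (auto simp: trilinear_form_def linear_form_def algebra_simps)

lemma trilinear_form_sum:
  "(\<And>i. i \<in> I \<Longrightarrow> trilinear_form n (T i)) \<Longrightarrow> trilinear_form n (\<lambda>u v w. \<Sum>i\<in>I. T i u v w)"
  by (auto simp: trilinear_form_def linear_form_def sum.distrib sum_distrib_left)

lemma trilinear_form_mult:
  "linear_form n f \<Longrightarrow> linear_form n g \<Longrightarrow> linear_form n h \<Longrightarrow> trilinear_form n (\<lambda>u v w. f u * g v * h w)"
  by (auto simp: trilinear_form_def linear_form_def algebra_simps)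

lemma trilinear_form_scalar_prod:
  assumes "linear_map n m f" "linear_map n m g" "linear_form n h"
  shows "trilinear_form n (\<lambda>u v w. (f u \<bullet> g v) * h w)"
  using assms unfolding trilinear_form_def linear_form_def linear_map_def
  by (simp add: add_scalar_prod_distrib[of _ m] scalar_prod_add_distrib[of _ m]
      smult_scalar_prod_distrib[of _ m] scalar_prod_smult_distrib[of _ m] distrib_left distrib_right
      mult.assoc mult.left_commute)

lemma trilinear_form_pullback:
  assumes "trilinear_form m \<phi>" "linear_map n m f" "linear_map n m g" "linear_map n m h"
  shows "trilinear_form n (\<lambda>u v w. \<phi> (f u) (g v) (h w))"
  using assms unfolding trilinear_form_def linear_form_def linear_map_def by simp

section \<open>Equivalence of trilinear forms\<close>

definition linear_iso :: "nat \<Rightarrow> ('a::field vec \<Rightarrow> 'a vec) \<Rightarrow> ('a vec \<Rightarrow> 'a vec) \<Rightarrow> bool" where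
  "linear_iso n f g \<longleftrightarrow> linear_map n n f \<and> linear_map n n g \<and>
     (\<forall>v\<in>carrier_vec n. g (f v) = v \<and> f (g v) = v)"

lemma linear_iso_sym: "linear_iso n f g \<Longrightarrow> linear_iso n g f"
  by (auto simp: linear_iso_def)

lemma linear_isoD:
  assumes "linear_iso n f g"
  shows "linear_map n n f" "v \<in> carrier_vec n \<Longrightarrow> f v \<in> carrier_vec n"
    "v \<in> carrier_vec n \<Longrightarrow> g (f v) = v"
  using assms by (auto simp: linear_iso_def linear_map_carrier)

lemma mat_eq_oneI:
  fixes A :: "'a::field mat"
  assumes A: "A \<in> carrier_mat n n" and id: "\<And>v. v \<in> carrier_vec n \<Longrightarrow> A *\<^sub>v v = v"
  shows "A = 1\<^sub>m n"
proof (rule eq_matI)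
  fix i j assume "i < dim_row (1\<^sub>m n :: 'a mat)" "j < dim_col (1\<^sub>m n :: 'a mat)"
  then have "A $$ (i, j) = (A *\<^sub>v unit_vec n j) $ i" using A by auto
  also have "A *\<^sub>v unit_vec n j = unit_vec n j" by (rule id) simp
  finally show "A $$ (i, j) = 1\<^sub>m n $$ (i, j)" using \<open>i < _\<close> \<open>j < _\<close> by (simp add: unit_vec_def)
qed (use A in auto)

lemma linear_iso_mult_mat_vec:
  assumes "A \<in> carrier_mat n n" "B \<in> carrier_mat n n" "A * B = 1\<^sub>m n" "B * A = 1\<^sub>m n"
  shows "linear_iso n ((*\<^sub>v) A) ((*\<^sub>v) B)"
  using assms assoc_mult_mat_vec[of A n n B n, symmetric] assoc_mult_mat_vec[of B n n A n, symmetric]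
  by (auto simp: linear_iso_def linear_map_mult_mat_vec)

lemma linear_iso_matrices:
  assumes fg: "linear_iso n f g"
  obtains A B where "A \<in> carrier_mat n n" "B \<in> carrier_mat n n" "A * B = 1\<^sub>m n" "B * A = 1\<^sub>m n"
    "\<forall>v\<in>carrier_vec n. f v = A *\<^sub>v v" "\<forall>v\<in>carrier_vec n. g v = B *\<^sub>v v"
proof -
  note gf = linear_iso_sym[OF fg]
  obtain A where A: "A \<in> carrier_mat n n" "\<And>v. v \<in> carrier_vec n \<Longrightarrow> f v = A *\<^sub>v v"
    using linear_map_matrix[OF linear_isoD(1)[OF fg]] by blast
  obtain B where B: "B \<in> carrier_mat n n" "\<And>v. v \<in> carrier_vec n \<Longrightarrow> g v = B *\<^sub>v v"
    using linear_map_matrix[OF linear_isoD(1)[OF gf]] by blast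
  have "A * B = 1\<^sub>m n"
    using A B linear_isoD[OF gf]
    by (intro mat_eq_oneI) (auto simp: assoc_mult_mat_vec[OF A(1) B(1)])
  moreover have "B * A = 1\<^sub>m n"
    using A B linear_isoD[OF fg]
    by (intro mat_eq_oneI) (auto simp: assoc_mult_mat_vec[OF B(1) A(1)])
  ultimately show ?thesis using that A B by blast
qed

lemma transpose_mult_eq_one:
  fixes A B :: "'a::field mat"
  assumes "A \<in> carrier_mat n n" "B \<in> carrier_mat n n" "A * B = 1\<^sub>m n"
  shows "transpose_mat B * transpose_mat A = 1\<^sub>m n"
  using transpose_mult[symmetric, OF assms(1,2)] by (simp add: assms(3))

lemma scalar_prod_transpose_inverse:
  fixes A B :: "'a::field mat"
  assumes A: "A \<in> carrier_mat n n" and B: "B \<in> carrier_mat n n" and BA: "B * A = 1\<^sub>m n"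
    and u: "u \<in> carrier_vec n" and v: "v \<in> carrier_vec n"
  shows "(A *\<^sub>v u) \<bullet> (transpose_mat B *\<^sub>v v) = u \<bullet> v"
proof -
  have Au: "A *\<^sub>v u \<in> carrier_vec n" using A u by simp
  have "(A *\<^sub>v u) \<bullet> (transpose_mat B *\<^sub>v v) = (transpose_mat B *\<^sub>v v) \<bullet> (A *\<^sub>v u)"
    using Au B v by (intro comm_scalar_prod[of _ n]) simp_all
  also have "\<dots> = v \<bullet> (B *\<^sub>v (A *\<^sub>v u))" by (rule transpose_vec_mult_scalar[OF B Au v])
  also have "B *\<^sub>v (A *\<^sub>v u) = u" using assoc_mult_mat_vec[OF B A u] BA u by simp
  also have "v \<bullet> u = u \<bullet> v" by (rule comm_scalar_prod[OF v u])
  finally show ?thesis .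
qed

lemma transpose_mult_vec_eqI:
  fixes C :: "'a::field mat"
  assumes C: "C \<in> carrier_mat n n" and u: "u \<in> carrier_vec n" and w: "w \<in> carrier_vec n"
    and dual: "\<And>v. v \<in> carrier_vec n \<Longrightarrow> w \<bullet> (C *\<^sub>v v) = u \<bullet> v"
  shows "transpose_mat C *\<^sub>v w = u"
proof (rule eq_vecI)
  fix a assume "a < dim_vec u"
  then have a: "a < n" using u by simp
  have "(transpose_mat C *\<^sub>v w) $ a = (transpose_mat C *\<^sub>v w) \<bullet> unit_vec n a" using a C by simp
  also have "\<dots> = w \<bullet> (C *\<^sub>v unit_vec n a)" by (rule transpose_vec_mult_scalar[OF C _ w]) simp
  also have "\<dots> = u $ a" using dual[of "unit_vec n a"] a by simp
  finally show "(transpose_mat C *\<^sub>v w) $ a = u $ a" .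
qed (use C u in simp)

text \<open>A linear map has at most one left dual with respect to the scalar product, its inverse transpose.\<close>

lemma dual_linear_map:
  fixes f h :: "'a::field vec \<Rightarrow> 'a vec"
  assumes f: "linear_map n n f" and h: "linear_map n n h"
    and dual: "\<And>u v. u \<in> carrier_vec n \<Longrightarrow> v \<in> carrier_vec n \<Longrightarrow> f u \<bullet> h v = u \<bullet> v"
  shows "\<exists>g. linear_iso n f g"
    and "linear_map n n f' \<Longrightarrow> (\<And>u v. u \<in> carrier_vec n \<Longrightarrow> v \<in> carrier_vec n \<Longrightarrow> f' u \<bullet> h v = u \<bullet> v) \<Longrightarrow>
      u \<in> carrier_vec n \<Longrightarrow> f' u = f u"
proof -
  obtain C where C: "C \<in> carrier_mat n n" "\<And>v. v \<in> carrier_vec n \<Longrightarrow> h v = C *\<^sub>v v"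
    using linear_map_matrix[OF h] by blast
  have transpose_left_inverse: "transpose_mat C *\<^sub>v k u = u"
    if "linear_map n n k" "\<And>u v. u \<in> carrier_vec n \<Longrightarrow> v \<in> carrier_vec n \<Longrightarrow> k u \<bullet> h v = u \<bullet> v"
      and "u \<in> carrier_vec n" for k u
    using that C by (intro transpose_mult_vec_eqI) (auto simp: linear_map_carrier)
  obtain A where A: "A \<in> carrier_mat n n" "\<And>v. v \<in> carrier_vec n \<Longrightarrow> f v = A *\<^sub>v v"
    using linear_map_matrix[OF f] by blast
  have "transpose_mat C * A = 1\<^sub>m n"
    using transpose_left_inverse[OF f dual] A C(1)
    by (intro mat_eq_oneI) (auto simp: assoc_mult_mat_vec[of _ n n _ n])
  then have "A * transpose_mat C = 1\<^sub>m n"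
    using A(1) C(1) by (intro mat_mult_left_right_inverse[of "transpose_mat C"]) simp_all
  then have f_transpose: "f (transpose_mat C *\<^sub>v v) = v" if "v \<in> carrier_vec n" for v
    using that A C(1) by (simp add: assoc_mult_mat_vec[of A n n _ n, symmetric])
  have "linear_map n n ((*\<^sub>v) (transpose_mat C))" using C(1) by (intro linear_map_mult_mat_vec) simp
  then show "\<exists>g. linear_iso n f g"
    unfolding linear_iso_def using f f_transpose transpose_left_inverse[OF f dual] by blast
  show "f' u = f u"
    if f': "linear_map n n f'" and "\<And>u v. u \<in> carrier_vec n \<Longrightarrow> v \<in> carrier_vec n \<Longrightarrow> f' u \<bullet> h v = u \<bullet> v"
      and u: "u \<in> carrier_vec n"
    using f_transpose[OF linear_map_carrier[OF f' u]] transpose_left_inverse[OF that] by simp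
qed

lemma GL_iff:
  fixes A :: "'a::field mat"
  shows "A \<in> GL n \<longleftrightarrow> A \<in> carrier_mat n n \<and> (\<exists>B\<in>carrier_mat n n. A * B = 1\<^sub>m n \<and> B * A = 1\<^sub>m n)"
  by (auto simp: Units_def ring_mat_simps)

lemma inv_ring_mat_eqI:
  fixes A B :: "'a::field mat"
  assumes "A \<in> carrier_mat n n" "B \<in> carrier_mat n n" "A * B = 1\<^sub>m n" "B * A = 1\<^sub>m n"
  shows "inv\<^bsub>ring_mat TYPE('a) n ()\<^esub> A = B"
proof -
  interpret ring "ring_mat TYPE('a) n ()" by (rule ring_mat)
  show ?thesis using assms inv_unique'[of A B] by (simp add: ring_mat_simps)
qed

lemma equivalent_forms_iff:
  "equivalent_forms n \<phi> \<psi> \<longleftrightarrow> (\<exists>f g. linear_iso n f g \<and>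
    (\<forall>u\<in>carrier_vec n. \<forall>v\<in>carrier_vec n. \<forall>w\<in>carrier_vec n. \<phi> u v w = \<psi> (f u) (f v) (f w)))"
  (is "_ \<longleftrightarrow> (\<exists>f g. _ \<and> ?pulls_back f)")
proof
  assume "equivalent_forms n \<phi> \<psi>"
  then obtain A where "A \<in> GL n"
    and act: "\<forall>u\<in>carrier_vec n. \<forall>v\<in>carrier_vec n. \<forall>w\<in>carrier_vec n. \<phi> u v w = form_act n \<psi> A u v w"
    unfolding equivalent_forms_def by blast
  then obtain B where AB: "A \<in> carrier_mat n n" "B \<in> carrier_mat n n" "A * B = 1\<^sub>m n" "B * A = 1\<^sub>m n"
    unfolding GL_iff by blast
  have "linear_iso n ((*\<^sub>v) B) ((*\<^sub>v) A)" using AB by (intro linear_iso_mult_mat_vec)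
  moreover have "?pulls_back ((*\<^sub>v) B)" using act by (simp add: form_act_def inv_ring_mat_eqI[OF AB])
  ultimately show "\<exists>f g. linear_iso n f g \<and> ?pulls_back f" by blast
next
  assume "\<exists>f g. linear_iso n f g \<and> ?pulls_back f"
  then obtain f g where fg: "linear_iso n f g" "?pulls_back f" by blast
  obtain B A where AB: "B \<in> carrier_mat n n" "A \<in> carrier_mat n n" "B * A = 1\<^sub>m n" "A * B = 1\<^sub>m n"
    and f: "\<forall>v\<in>carrier_vec n. f v = B *\<^sub>v v"
    by (rule linear_iso_matrices[OF fg(1)])
  have "A \<in> GL n" using AB unfolding GL_iff by blast
  moreover have "\<phi> u v w = form_act n \<psi> A u v w"
    if "u \<in> carrier_vec n" "v \<in> carrier_vec n" "w \<in> carrier_vec n" for u v w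
    using that fg(2) by (simp add: form_act_def inv_ring_mat_eqI[OF AB(2,1,4,3)] f)
  ultimately show "equivalent_forms n \<phi> \<psi>" unfolding equivalent_forms_def by blast
qed

section \<open>Symmetrisation\<close>

definition sym3 :: "'a::field \<Rightarrow> 'a form3 \<Rightarrow> 'a form3" where
  "sym3 \<epsilon> T u v w = T u v w + T v w u + T w u v + \<epsilon> * (T v u w + T u w v + T w v u)"

lemma trilinear_form_sym3: "trilinear_form n T \<Longrightarrow> trilinear_form n (sym3 \<epsilon> T)"
  by (auto simp: trilinear_form_def linear_form_def sym3_def algebra_simps)

lemma alternating_form_sym3: "alternating_form n (sym3 (-1) T)"
  by (auto simp: alternating_form_def sym3_def)

lemma symmetric_formI:
  assumes "\<And>u v w. \<phi> u v w = \<phi> v u w" "\<And>u v w. \<phi> u v w = \<phi> u w v"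
  shows "symmetric_form n \<phi>"
  unfolding symmetric_form_def
proof (intro allI impI)
  fix u :: "nat \<Rightarrow> 'a vec" and \<sigma> :: "nat \<Rightarrow> nat"
  assume \<sigma>: "\<sigma> permutes {1..3}"
  have range: "\<sigma> 1 \<in> {1, 2, 3}" "\<sigma> 2 \<in> {1, 2, 3}" "\<sigma> 3 \<in> {1, 2, 3}"
    using permutes_in_image[OF \<sigma>, of 1] permutes_in_image[OF \<sigma>, of 2] permutes_in_image[OF \<sigma>, of 3]
    by auto
  have distinct: "\<sigma> 1 \<noteq> \<sigma> 2" "\<sigma> 1 \<noteq> \<sigma> 3" "\<sigma> 2 \<noteq> \<sigma> 3"
    using permutes_inj[OF \<sigma>] by (simp_all add: inj_eq)
  consider "\<sigma> 1 = 1" "\<sigma> 2 = 2" "\<sigma> 3 = 3" | "\<sigma> 1 = 1" "\<sigma> 2 = 3" "\<sigma> 3 = 2"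
    | "\<sigma> 1 = 2" "\<sigma> 2 = 1" "\<sigma> 3 = 3" | "\<sigma> 1 = 2" "\<sigma> 2 = 3" "\<sigma> 3 = 1"
    | "\<sigma> 1 = 3" "\<sigma> 2 = 1" "\<sigma> 3 = 2" | "\<sigma> 1 = 3" "\<sigma> 2 = 2" "\<sigma> 3 = 1"
    using range distinct by auto
  then show "\<phi> (u 1) (u 2) (u 3) = \<phi> (u (\<sigma> 1)) (u (\<sigma> 2)) (u (\<sigma> 3))"
    by cases (metis assms)+
qed

lemma symmetric_form_sym3: "symmetric_form n (sym3 1 T)"
  by (rule symmetric_formI) (simp_all add: sym3_def)

section \<open>The labelling gadget\<close>

lemma mult_add_less:
  assumes "(a::nat) < c" "b < d"
  shows "a * d + b < c * d"
proof -
  have "a * d + b < Suc a * d" using assms(2) by simp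
  also have "\<dots> \<le> c * d" using assms(1) by (intro mult_le_mono1) simp
  finally show ?thesis .
qed

lemma mult_add_eq_iff:
  assumes "(r::nat) < d" "s < d"
  shows "a * d + r = b * d + s \<longleftrightarrow> a = b \<and> r = s"
  using assms by (metis add_left_imp_eq div_mult_self3 div_less add.right_neutral gr_implies_not0)

lemma nonzero_vec_index:
  assumes "v \<in> carrier_vec n" "v \<noteq> 0\<^sub>v n"
  obtains x where "x < n" "v $ x \<noteq> 0"
  using assms eq_vecI[of v "0\<^sub>v n"] by auto

text \<open>
  The coordinates \<open>p_index i r\<close> span \<open>P\<^sub>i\<close>, the coordinates \<open>q_index x r\<close> with \<open>label x = i\<close> span \<open>Q\<^sub>i\<close>;
  only the \<open>r < weight i\<close> occur in the gadget. Indices with \<open>weight i \<le> r < stride\<close> are unused; they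
  make the index arithmetic uniform.
\<close>

locale labelling =
  fixes K L :: nat and label :: "nat \<Rightarrow> nat"
  assumes label_less: "x < K \<Longrightarrow> label x < L" and labels_le: "L \<le> Suc K"
begin

definition weight :: "nat \<Rightarrow> nat" where "weight i = K + 1 + i"
definition stride :: nat where "stride = K + 1 + L"
definition total_dim :: nat where "total_dim = K + L * stride + K * stride"
definition p_index :: "nat \<Rightarrow> nat \<Rightarrow> nat" where "p_index i r = K + i * stride + r"
definition q_index :: "nat \<Rightarrow> nat \<Rightarrow> nat" where "q_index x r = K + L * stride + x * stride + r"

lemma weight_less: "i < L \<Longrightarrow> r < weight i \<Longrightarrow> r < stride"
  by (simp add: weight_def stride_def)

lemma K_le_dim: "K \<le> total_dim"
  by (simp add: total_dim_def)

lemma p_index_less: "i < L \<Longrightarrow> r < stride \<Longrightarrow> p_index i r < K + L * stride"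
  using mult_add_less[of i L r stride] by (simp add: p_index_def)

lemma p_index_less_dim: "i < L \<Longrightarrow> r < stride \<Longrightarrow> p_index i r < total_dim"
  using p_index_less[of i r] by (simp add: total_dim_def)

lemma q_index_less_dim: "x < K \<Longrightarrow> r < stride \<Longrightarrow> q_index x r < total_dim"
  using mult_add_less[of x K r stride] by (simp add: q_index_def total_dim_def)

lemma p_index_eq_iff: "r < stride \<Longrightarrow> s < stride \<Longrightarrow> p_index i r = p_index j s \<longleftrightarrow> i = j \<and> r = s"
  using mult_add_eq_iff[of r stride s i j] by (simp add: p_index_def)

lemma q_index_eq_iff: "r < stride \<Longrightarrow> s < stride \<Longrightarrow> q_index x r = q_index y s \<longleftrightarrow> x = y \<and> r = s"
  using mult_add_eq_iff[of r stride s x y] by (simp add: q_index_def)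

lemma p_index_neq_q_index: "i < L \<Longrightarrow> r < stride \<Longrightarrow> p_index i r \<noteq> q_index x s"
  using p_index_less[of i r] by (simp add: q_index_def)

lemma index_cases:
  assumes "z < total_dim"
  obtains "z < K" | i r where "i < L" "r < stride" "z = p_index i r"
  | x r where "x < K" "r < stride" "z = q_index x r"
proof -
  have mod_less: "m mod stride < stride" for m by (simp add: stride_def)
  consider "z < K" | "K \<le> z" "z < K + L * stride" | "K + L * stride \<le> z" by linarith
  then show ?thesis
  proof cases
    case 2
    then have "(z - K) div stride < L" by (intro less_mult_imp_div_less) linarith
    moreover have "z = p_index ((z - K) div stride) ((z - K) mod stride)"
      unfolding p_index_def using 2 div_mult_mod_eq[of "z - K" stride] by linarith
    ultimately show ?thesis using that(2) mod_less by blast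
  next
    case 3
    let ?y = "z - (K + L * stride)"
    have "?y div stride < K" using assms 3 by (intro less_mult_imp_div_less) (simp add: total_dim_def)
    moreover have "z = q_index (?y div stride) (?y mod stride)"
      unfolding q_index_def using 3 div_mult_mod_eq[of ?y stride] by linarith
    ultimately show ?thesis using that(3) mod_less by blast
  qed (rule that(1))
qed

abbreviation top_part :: "'a::field vec \<Rightarrow> 'a vec" where
  "top_part v \<equiv> vec_first v K"

definition q_slice :: "nat \<Rightarrow> 'a::field vec \<Rightarrow> 'a vec" where
  "q_slice r v = vec K (\<lambda>x. v $ q_index x r)"

definition assemble :: "'a::field vec \<Rightarrow> (nat \<Rightarrow> nat \<Rightarrow> 'a) \<Rightarrow> (nat \<Rightarrow> 'a vec) \<Rightarrow> 'a vec" where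
  "assemble u P Q = vec total_dim (\<lambda>z. if z < K then u $ z
     else if z < K + L * stride then P ((z - K) div stride) ((z - K) mod stride)
     else Q ((z - (K + L * stride)) mod stride) $ ((z - (K + L * stride)) div stride))"

lemma top_part_index: "x < K \<Longrightarrow> top_part v $ x = v $ x"
  by (simp add: vec_first_def)

lemma q_slice_index: "x < K \<Longrightarrow> q_slice r v $ x = v $ q_index x r"
  by (simp add: q_slice_def)

lemma q_slice_carrier[simp]: "q_slice r v \<in> carrier_vec K"
  by (simp add: q_slice_def)

lemma assemble_carrier[simp]: "assemble u P Q \<in> carrier_vec total_dim"
  and dim_assemble[simp]: "dim_vec (assemble u P Q) = total_dim"
  by (simp_all add: assemble_def)

lemma top_part_assemble[simp]: "u \<in> carrier_vec K \<Longrightarrow> top_part (assemble u P Q) = u"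
  using K_le_dim by (intro eq_vecI) (auto simp: vec_first_def assemble_def)

lemma assemble_p_index[simp]: "i < L \<Longrightarrow> r < stride \<Longrightarrow> assemble u P Q $ p_index i r = P i r"
  using p_index_less[of i r] p_index_less_dim[of i r] by (simp add: assemble_def) (simp add: p_index_def)

lemma q_slice_assemble[simp]:
  assumes "r < stride" "Q r \<in> carrier_vec K"
  shows "q_slice r (assemble u P Q) = Q r"
proof (rule eq_vecI)
  fix x assume "x < dim_vec (Q r)"
  then have "x < K" using assms by simp
  then show "q_slice r (assemble u P Q) $ x = Q r $ x"
    using assms(1) q_index_less_dim[of x r] by (simp add: q_slice_index assemble_def) (simp add: q_index_def)
qed (use assms in simp)

lemma vec_eqI_parts:
  assumes "u \<in> carrier_vec total_dim" "v \<in> carrier_vec total_dim"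
    and top: "top_part u = top_part v"
    and p: "\<And>i r. i < L \<Longrightarrow> r < stride \<Longrightarrow> u $ p_index i r = v $ p_index i r"
    and q: "\<And>r. r < stride \<Longrightarrow> q_slice r u = q_slice r v"
  shows "u = v"
proof (rule eq_vecI)
  fix z assume "z < dim_vec v"
  then have "z < total_dim" using assms(2) by simp
  then show "u $ z = v $ z"
  proof (cases z rule: index_cases)
    case 1
    then show ?thesis using top by (metis top_part_index)
  next
    case (3 x r)
    then show ?thesis using q by (metis q_slice_index)
  qed (simp add: p)
qed (use assms in simp)

lemma linear_map_top_part: "linear_map total_dim K (top_part :: 'a::field vec \<Rightarrow> 'a vec)"
  using K_le_dim by (auto simp: linear_map_def vec_first_def)

lemma linear_map_q_slice: "r < stride \<Longrightarrow> linear_map total_dim K (q_slice r :: 'a::field vec \<Rightarrow> 'a vec)"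
  using q_index_less_dim by (auto simp: linear_map_def q_slice_def)

lemma linear_form_p_index:
  "i < L \<Longrightarrow> r < stride \<Longrightarrow> linear_form total_dim (\<lambda>v :: 'a::field vec. v $ p_index i r)"
  using p_index_less_dim by (auto simp: linear_form_def)

definition component :: "nat \<Rightarrow> 'a::field vec \<Rightarrow> 'a vec" where
  "component i u = vec K (\<lambda>x. if label x = i then u $ x else 0)"

definition homogeneous :: "nat \<Rightarrow> 'a::field vec set" where
  "homogeneous i = {u \<in> carrier_vec K. \<forall>x<K. label x \<noteq> i \<longrightarrow> u $ x = 0}"

lemma component_carrier[simp]: "component i u \<in> carrier_vec K"
  by (simp add: component_def)

lemma homogeneous_carrier: "u \<in> homogeneous i \<Longrightarrow> u \<in> carrier_vec K"
  by (simp add: homogeneous_def)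

lemma linear_map_component: "linear_map K K (component i :: 'a::field vec \<Rightarrow> 'a vec)"
  by (auto simp: linear_map_def component_def)

lemma component_homogeneous: "u \<in> homogeneous i \<Longrightarrow> component j u = (if i = j then u else 0\<^sub>v K)"
  by (auto simp: component_def homogeneous_def)

definition gadget :: "'a::field form3" where
  "gadget u v w = (\<Sum>i<L. \<Sum>r<weight i. (component i u \<bullet> q_slice r v) * w $ p_index i r)"

definition labelled_form :: "'a::field \<Rightarrow> 'a form3 \<Rightarrow> 'a form3" where
  "labelled_form \<epsilon> T = sym3 \<epsilon> (\<lambda>u v w. T (top_part u) (top_part v) (top_part w) + gadget (top_part u) v w)"

definition pairing :: "'a::field \<Rightarrow> 'a form3" where
  "pairing \<epsilon> u v w = gadget u v w + \<epsilon> * gadget u w v"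

lemma labelled_form_expand:
  "labelled_form \<epsilon> T u v w = sym3 \<epsilon> T (top_part u) (top_part v) (top_part w)
     + pairing \<epsilon> (top_part u) v w + pairing \<epsilon> (top_part v) w u + pairing \<epsilon> (top_part w) u v"
  by (simp add: labelled_form_def sym3_def pairing_def algebra_simps)

lemma trilinear_form_gadget: "trilinear_form total_dim (\<lambda>u v w. gadget (top_part u) v w)"
  unfolding gadget_def
proof (intro trilinear_form_sum)
  fix i r assume "i \<in> {..<L}" "r \<in> {..<weight i}"
  then have i: "i < L" and r: "r < stride" using weight_less[of i r] by auto
  show "trilinear_form total_dim (\<lambda>u v w. (component i (top_part u) \<bullet> q_slice r v) * w $ p_index i r)"
    by (rule trilinear_form_scalar_prod[OF linear_map_comp[OF linear_map_top_part linear_map_component]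
          linear_map_q_slice[OF r] linear_form_p_index[OF i r]])
qed

lemma trilinear_form_labelled_form:
  assumes "trilinear_form K T"
  shows "trilinear_form total_dim (labelled_form \<epsilon> T)"
  unfolding labelled_form_def
  by (rule trilinear_form_sym3[OF trilinear_form_add[OF trilinear_form_pullback[OF assms
          linear_map_top_part linear_map_top_part linear_map_top_part] trilinear_form_gadget]])

lemma linear_form_gadget: "linear_form K (\<lambda>u :: 'a::field vec. gadget u v w)"
  unfolding linear_form_def gadget_def
  by (simp add: linear_map_add[OF linear_map_component] linear_map_smult[OF linear_map_component]
      add_scalar_prod_distrib[of _ K] smult_scalar_prod_distrib[of _ K] distrib_right mult.assoc
      sum.distrib sum_distrib_left)

lemma linear_form_pairing: "linear_form K (\<lambda>u :: 'a::field vec. pairing \<epsilon> u v w)"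
  using linear_form_gadget[of v w] linear_form_gadget[of w v]
  by (simp add: linear_form_def pairing_def algebra_simps)

lemma gadget_eq_0:
  shows "(\<And>r. r < stride \<Longrightarrow> q_slice r v = 0\<^sub>v K) \<Longrightarrow> gadget u v w = 0"
    and "(\<And>i r. i < L \<Longrightarrow> r < stride \<Longrightarrow> w $ p_index i r = 0) \<Longrightarrow> gadget u v w = 0"
  unfolding gadget_def by (auto intro!: sum.neutral simp: weight_less)

lemma top_part_unit: "z < total_dim \<Longrightarrow> top_part (unit_vec total_dim z) = (if z < K then unit_vec K z else 0\<^sub>v K)"
  using K_le_dim by (intro eq_vecI) (auto simp: top_part_index)

lemma unit_q_index_p_index:
  "x < K \<Longrightarrow> r < stride \<Longrightarrow> i < L \<Longrightarrow> s < stride \<Longrightarrow> unit_vec total_dim (q_index x r) $ p_index i s = 0"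
  using p_index_less_dim[of i s] q_index_less_dim[of x r] p_index_neq_q_index[of i s x r] by simp

lemma unit_p_index_p_index:
  "i < L \<Longrightarrow> r < stride \<Longrightarrow> j < L \<Longrightarrow> s < stride \<Longrightarrow>
    unit_vec total_dim (p_index i r) $ p_index j s = (if i = j \<and> r = s then 1 else 0)"
  using p_index_less_dim[of i r] p_index_less_dim[of j s] by (auto simp: p_index_eq_iff)

lemma q_slice_unit_p_index:
  assumes "i < L" "r < stride" "s < stride"
  shows "q_slice s (unit_vec total_dim (p_index i r)) = 0\<^sub>v K"
  using assms q_index_less_dim p_index_less_dim[of i r] p_index_neq_q_index[of i r, THEN not_sym]
  by (intro eq_vecI) (auto simp: q_slice_index)

lemma q_slice_unit_q_index:
  assumes "x < K" "r < stride" "s < stride"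
  shows "q_slice s (unit_vec total_dim (q_index x r)) = (if r = s then unit_vec K x else 0\<^sub>v K)"
  using assms q_index_less_dim by (intro eq_vecI) (auto simp: q_slice_index q_index_eq_iff)

lemma gadget_unit_p_index:
  assumes "j < L" "s < weight j"
  shows "gadget u v (unit_vec total_dim (p_index j s)) = component j u \<bullet> q_slice s v"
proof -
  have "gadget u v (unit_vec total_dim (p_index j s)) =
      (\<Sum>i<L. \<Sum>r<weight i. if i = j then if r = s then component j u \<bullet> q_slice s v else 0 else 0)"
    unfolding gadget_def
    using assms weight_less by (intro sum.cong refl) (auto simp: unit_p_index_p_index)
  also have "\<dots> = (\<Sum>i<L. if i = j then component j u \<bullet> q_slice s v else 0)"
    using assms(2) by (intro sum.cong refl) (simp add: sum.delta)
  finally show ?thesis using assms(1) by (simp add: sum.delta)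
qed

lemma gadget_q_unit_p_unit:
  assumes "i < L" "r < weight i" "x < K" "t < stride"
  shows "gadget u (unit_vec total_dim (q_index x t)) (unit_vec total_dim (p_index i r)) =
    (if label x = i \<and> t = r then u $ x else 0)"
  using assms weight_less[OF assms(1,2)]
  by (auto simp: gadget_unit_p_index q_slice_unit_q_index component_def)

lemma gadget_p_unit_eq_0: "i < L \<Longrightarrow> r < stride \<Longrightarrow> gadget u (unit_vec total_dim (p_index i r)) w = 0"
  by (rule gadget_eq_0(1)) (rule q_slice_unit_p_index)

lemma gadget_q_unit_eq_0: "x < K \<Longrightarrow> t < stride \<Longrightarrow> gadget u v (unit_vec total_dim (q_index x t)) = 0"
  by (rule gadget_eq_0(2)) (rule unit_q_index_p_index)

definition deep :: "'a::field vec set" where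
  "deep = {v \<in> carrier_vec total_dim. top_part v = 0\<^sub>v K}"

lemma deep_carrier: "d \<in> deep \<Longrightarrow> d \<in> carrier_vec total_dim"
  by (simp add: deep_def)

lemma labelled_form_deep:
  assumes T: "trilinear_form K T" and d: "d \<in> deep"
  shows "labelled_form \<epsilon> T u v d = pairing \<epsilon> (top_part u) v d + pairing \<epsilon> (top_part v) d u"
    and "labelled_form \<epsilon> T d u v = pairing \<epsilon> (top_part u) v d + pairing \<epsilon> (top_part v) d u"
  using d linear_form_zero[OF linear_form_pairing]
  by (simp_all add: labelled_form_expand deep_def trilinear_form_zero[OF trilinear_form_sym3[OF T]])

lemma labelled_form_deep_deep:
  assumes "trilinear_form K T" "d \<in> deep" "d' \<in> deep"
  shows "labelled_form \<epsilon> T u d d' = pairing \<epsilon> (top_part u) d d'"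
  using assms linear_form_zero[OF linear_form_pairing] by (simp add: labelled_form_deep) (simp add: deep_def)

lemma rank_labelled_form_deep_le:
  assumes "trilinear_form K T" "d \<in> deep"
  shows "rank_le (K + K) (carrier_vec total_dim) (labelled_form \<epsilon> T d)"
proof -
  have pairing_top_part: "pairing \<epsilon> (top_part v) w c = (\<Sum>x<K. v $ x * pairing \<epsilon> (unit_vec K x) w c)" for v w c
    unfolding linear_form_expand[OF linear_form_pairing, of "top_part v" \<epsilon> w c, OF vec_first_carrier]
    by (simp add: top_part_index)
  have "rank_le K (carrier_vec total_dim) (\<lambda>v w. pairing \<epsilon> (top_part v) w d)"
    by (rule rank_leI[OF pairing_top_part])
  moreover have "rank_le K (carrier_vec total_dim) (\<lambda>v w. pairing \<epsilon> (top_part w) d v)"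
    by (rule rank_leI[where A = "\<lambda>x v. pairing \<epsilon> (unit_vec K x) d v" and B = "\<lambda>x w. w $ x"])
      (simp add: pairing_top_part mult.commute)
  ultimately show ?thesis
    by (rule rank_le_pullback[OF rank_le_add]) (simp_all add: labelled_form_deep assms)
qed

lemma gadget_homogeneous:
  assumes u: "u \<in> homogeneous i" and i: "i < L"
  shows "gadget u v w = (\<Sum>r<weight i. (u \<bullet> q_slice r v) * w $ p_index i r)"
proof -
  have "gadget u v w = (\<Sum>j<L. if j = i then \<Sum>r<weight i. (u \<bullet> q_slice r v) * w $ p_index i r else 0)"
    unfolding gadget_def by (intro sum.cong refl) (simp add: component_homogeneous[OF u])
  then show ?thesis using i by (simp add: sum.delta)
qed

lemma rank_pairing_homogeneous_le:
  assumes "u \<in> homogeneous i" "i < L"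
  shows "rank_le (weight i + weight i) D (pairing \<epsilon> u)"
proof -
  have "rank_le (weight i) D (gadget u)"
    by (rule rank_leI[OF gadget_homogeneous[OF assms]])
  moreover have "rank_le (weight i) D (\<lambda>v w. \<epsilon> * gadget u w v)"
    by (rule rank_leI[where A = "\<lambda>r v. \<epsilon> * v $ p_index i r" and B = "\<lambda>r w. u \<bullet> q_slice r w"])
      (simp add: gadget_homogeneous[OF assms] sum_distrib_left mult_ac)
  ultimately show ?thesis unfolding pairing_def[abs_def] by (rule rank_le_add)
qed

text \<open>On the unit vectors of \<open>P\<^sub>i\<close> and \<open>Q\<^sub>i\<close>, the latter at one coordinate \<open>x\<close> of \<open>u\<close> for each label, the
  pairing is diagonal up to exchanging the two.\<close>

lemma rank_pairing_ge:
  assumes rank: "rank_le k deep (pairing \<epsilon> u)" and eps: "\<epsilon> \<noteq> 0"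
    and X: "X \<subseteq> {..<K}" "inj_on label X" "\<And>x. x \<in> X \<Longrightarrow> u $ x \<noteq> 0"
  shows "(\<Sum>x\<in>X. 2 * weight (label x)) \<le> k"
proof -
  define S where "S = Sigma X (\<lambda>x. {..<weight (label x)} \<times> (UNIV :: bool set))"
  define a where "a = (\<lambda>(x, r, b). unit_vec total_dim (if b then q_index x r else p_index (label x) r) :: 'a vec)"
  define a' where "a' = (\<lambda>(x, r, b). unit_vec total_dim (if b then p_index (label x) r else q_index x r) :: 'a vec)"
  have X_less: "x < K" "label x < L" if "x \<in> X" for x using X(1) that label_less by auto
  have "finite X" using X(1) finite_subset by blast
  have pairing_S: "pairing \<epsilon> u (a s) (a' t) = (if s = t then if snd (snd s) then u $ fst s else \<epsilon> * u $ fst s else 0)"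
    if "s \<in> S" "t \<in> S" for s t
  proof -
    obtain x r b y r' b' where [simp]: "s = (x, r, b)" "t = (y, r', b')" by (metis surj_pair)
    have "x \<in> X" "y \<in> X" "r < weight (label x)" "r' < weight (label y)" using that by (auto simp: S_def)
    moreover note X_less[OF this(1)] X_less[OF this(2)]
    ultimately show ?thesis
      using inj_onD[OF X(2), of x y] weight_less[of "label x" r] weight_less[of "label y" r']
      by (cases b; cases b') (auto simp: pairing_def a_def a'_def gadget_q_unit_p_unit
          gadget_p_unit_eq_0 gadget_q_unit_eq_0)
  qed
  have "card S \<le> k"
  proof (rule rank_le_card_diagonal[OF rank, where x = a and y = a'])
    show "finite S" using \<open>finite X\<close> by (auto simp: S_def)
    fix s assume "s \<in> S"
    then obtain x r b where s: "s = (x, r, b)" "x \<in> X" "r < weight (label x)" by (auto simp: S_def)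
    note X_less[OF s(2)] and weight_less[OF X_less(2)[OF s(2)] s(3)]
    then show "a s \<in> deep \<and> a' s \<in> deep"
      using p_index_less_dim q_index_less_dim
      by (auto simp: s(1) a_def a'_def deep_def top_part_unit) (auto simp: p_index_def q_index_def)
    show "pairing \<epsilon> u (a s) (a' s) \<noteq> 0" using \<open>s \<in> S\<close> X(3)[OF s(2)] eps by (simp add: pairing_S s(1))
  qed (simp add: pairing_S)
  moreover have "card S = (\<Sum>x\<in>X. 2 * weight (label x))"
    unfolding S_def using \<open>finite X\<close> by (simp add: card_cartesian_product mult.commute)
  ultimately show ?thesis by simp
qed

definition restrict_label :: "nat \<Rightarrow> 'a::field vec \<Rightarrow> 'a vec" where
  "restrict_label i d = assemble (0\<^sub>v K) (\<lambda>j r. if j = i then d $ p_index j r else 0)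
     (\<lambda>r. component i (q_slice r d))"

lemma restrict_label_deep: "restrict_label i d \<in> deep"
  by (simp add: restrict_label_def deep_def)

lemma homogeneous_scalar_prod_component:
  assumes "u \<in> homogeneous j" "v \<in> carrier_vec K"
  shows "u \<bullet> component i v = (if i = j then u \<bullet> v else 0)"
  using assms by (auto simp: scalar_prod_def component_def homogeneous_def intro!: sum.cong sum.neutral)

lemma gadget_restrict_label:
  assumes "u \<in> homogeneous j" "j < L"
  shows "gadget u (restrict_label i d) w = (if i = j then gadget u d w else 0)"
    and "gadget u w (restrict_label i d) = (if i = j then gadget u w d else 0)"
  using assms
  by (auto simp: gadget_homogeneous restrict_label_def homogeneous_scalar_prod_component
      weight_less[OF assms(2)] intro!: sum.cong sum.neutral)

lemma pairing_restrict_label: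
  assumes "u \<in> homogeneous j" "j < L"
  shows "pairing \<epsilon> u (restrict_label i d) w = (if i = j then pairing \<epsilon> u d w else 0)"
    and "pairing \<epsilon> u w (restrict_label i d) = (if i = j then pairing \<epsilon> u w d else 0)"
  by (simp_all add: pairing_def gadget_restrict_label[OF assms])

definition inclusion :: "'a::field vec \<Rightarrow> 'a vec" where
  "inclusion u = assemble u (\<lambda>_ _. 0) (\<lambda>_. 0\<^sub>v K)"

lemma inclusion_carrier[simp]: "inclusion u \<in> carrier_vec total_dim"
  by (simp add: inclusion_def)

lemma top_part_inclusion[simp]: "u \<in> carrier_vec K \<Longrightarrow> top_part (inclusion u) = u"
  by (simp add: inclusion_def)

lemma linear_map_inclusion: "linear_map K total_dim (inclusion :: 'a::field vec \<Rightarrow> 'a vec)"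
  unfolding linear_map_def
proof (intro conjI ballI allI)
  fix u :: "'a vec" and c :: 'a assume u: "u \<in> carrier_vec K"
  show "inclusion (c \<cdot>\<^sub>v u) = c \<cdot>\<^sub>v inclusion u"
    by (rule vec_eqI_parts)
      (use u p_index_less_dim in \<open>auto simp: inclusion_def linear_map_smult[OF linear_map_top_part]
        linear_map_smult[OF linear_map_q_slice]\<close>)
  fix v :: "'a vec" assume v: "v \<in> carrier_vec K"
  show "inclusion (u + v) = inclusion u + inclusion v"
    by (rule vec_eqI_parts)
      (use u v p_index_less_dim in \<open>simp_all add: inclusion_def linear_map_add[OF linear_map_top_part]
        linear_map_add[OF linear_map_q_slice]\<close>)
qed simp

lemma pairing_inclusion: "pairing \<epsilon> u (inclusion v) w = 0" "pairing \<epsilon> u w (inclusion v) = 0"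
  by (simp_all add: pairing_def inclusion_def gadget_eq_0)

lemma labelled_form_inclusion:
  "u \<in> carrier_vec K \<Longrightarrow> v \<in> carrier_vec K \<Longrightarrow> w \<in> carrier_vec K \<Longrightarrow>
    labelled_form \<epsilon> T (inclusion u) (inclusion v) (inclusion w) = sym3 \<epsilon> T u v w"
  by (simp add: labelled_form_expand pairing_inclusion)

definition lift :: "'a::field mat \<Rightarrow> 'a mat \<Rightarrow> 'a vec \<Rightarrow> 'a vec" where
  "lift G H v = assemble (G *\<^sub>v top_part v) (\<lambda>i r. v $ p_index i r) (\<lambda>r. H *\<^sub>v q_slice r v)"

lemma lift_parts:
  assumes "G \<in> carrier_mat K K" "H \<in> carrier_mat K K"
  shows "lift G H v \<in> carrier_vec total_dim" "top_part (lift G H v) = G *\<^sub>v top_part v"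
    and "i < L \<Longrightarrow> r < stride \<Longrightarrow> lift G H v $ p_index i r = v $ p_index i r"
    and "r < stride \<Longrightarrow> q_slice r (lift G H v) = H *\<^sub>v q_slice r v"
  using assms by (simp_all add: lift_def mult_mat_vec_carrier[of _ K K])

lemma linear_map_lift:
  fixes G H :: "'a::field mat"
  assumes GH: "G \<in> carrier_mat K K" "H \<in> carrier_mat K K"
  shows "linear_map total_dim total_dim (lift G H)"
  unfolding linear_map_def
proof (intro conjI ballI allI)
  fix u :: "'a vec" and c :: 'a assume u: "u \<in> carrier_vec total_dim"
  show "lift G H u \<in> carrier_vec total_dim" by (rule lift_parts(1)[OF GH])
  show "lift G H (c \<cdot>\<^sub>v u) = c \<cdot>\<^sub>v lift G H u"
    by (rule vec_eqI_parts)
      (use u p_index_less_dim in \<open>simp_all add: lift_parts[OF GH] linear_map_smult[OF linear_map_top_part]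
        linear_map_smult[OF linear_map_q_slice] mult_mat_vec[OF GH(1)] mult_mat_vec[OF GH(2)]
        carrier_vecD[OF lift_parts(1)[OF GH]]\<close>)
  fix v :: "'a vec" assume v: "v \<in> carrier_vec total_dim"
  show "lift G H (u + v) = lift G H u + lift G H v"
    by (rule vec_eqI_parts)
      (use u v p_index_less_dim in \<open>simp_all add: lift_parts[OF GH] linear_map_add[OF linear_map_top_part]
        linear_map_add[OF linear_map_q_slice] mult_add_distrib_mat_vec[OF GH(1)]
        mult_add_distrib_mat_vec[OF GH(2)] carrier_vecD[OF lift_parts(1)[OF GH]]\<close>)
qed

lemma lift_lift:
  fixes G H G' H' :: "'a::field mat"
  assumes GH: "G \<in> carrier_mat K K" "H \<in> carrier_mat K K" and GH': "G' \<in> carrier_mat K K" "H' \<in> carrier_mat K K"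
    and inverse: "G' * G = 1\<^sub>m K" "H' * H = 1\<^sub>m K" and v: "v \<in> carrier_vec total_dim"
  shows "lift G' H' (lift G H v) = v"
  by (rule vec_eqI_parts)
    (use v inverse in \<open>simp_all add: lift_parts[OF GH] lift_parts[OF GH']
      assoc_mult_mat_vec[OF GH'(1) GH(1), symmetric] assoc_mult_mat_vec[OF GH'(2) GH(2), symmetric]\<close>)

lemma linear_iso_lift:
  fixes G H :: "'a::field mat"
  assumes GH: "G \<in> carrier_mat K K" "H \<in> carrier_mat K K" "G * H = 1\<^sub>m K" "H * G = 1\<^sub>m K"
  shows "linear_iso total_dim (lift G (transpose_mat H)) (lift H (transpose_mat G))"
  using GH transpose_mult_eq_one[OF GH(2,1,4)] transpose_mult_eq_one[OF GH(1,2,3)]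
  unfolding linear_iso_def by (auto simp: linear_map_lift lift_lift)

lemma gadget_lift:
  fixes G H :: "'a::field mat"
  assumes GH: "G \<in> carrier_mat K K" "H \<in> carrier_mat K K" and inverse: "H * G = 1\<^sub>m K"
    and component: "\<And>i. component i (G *\<^sub>v u) = G *\<^sub>v component i u"
  shows "gadget (G *\<^sub>v u) (lift G (transpose_mat H) v) (lift G (transpose_mat H) w) = gadget u v w"
  unfolding gadget_def
proof (intro sum.cong refl)
  fix i r assume "i \<in> {..<L}" "r \<in> {..<weight i}"
  then have i: "i < L" and r: "r < stride" using weight_less[of i r] by auto
  show "(component i (G *\<^sub>v u) \<bullet> q_slice r (lift G (transpose_mat H) v)) * lift G (transpose_mat H) w $ p_index i r =
      (component i u \<bullet> q_slice r v) * w $ p_index i r"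
    using GH i r by (simp add: component lift_parts scalar_prod_transpose_inverse[OF GH inverse])
qed

theorem equivalent_labelled_forms:
  fixes T T' :: "'a::field form3"
  assumes iso: "linear_iso K f g"
    and component: "\<And>i u. u \<in> carrier_vec K \<Longrightarrow> component i (f u) = f (component i u)"
    and pulls_back: "\<And>u v w. u \<in> carrier_vec K \<Longrightarrow> v \<in> carrier_vec K \<Longrightarrow> w \<in> carrier_vec K \<Longrightarrow>
      T u v w = T' (f u) (f v) (f w)"
  shows "equivalent_forms total_dim (labelled_form \<epsilon> T) (labelled_form \<epsilon> T')"
proof -
  obtain G H where GH: "G \<in> carrier_mat K K" "H \<in> carrier_mat K K" "G * H = 1\<^sub>m K" "H * G = 1\<^sub>m K"
    and f: "\<forall>v\<in>carrier_vec K. f v = G *\<^sub>v v"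
    by (rule linear_iso_matrices[OF iso])
  let ?lift = "lift G (transpose_mat H)"
  have "gadget (top_part (?lift u)) (?lift v) (?lift w) = gadget (top_part u) v w" for u v w
    using GH f component[OF vec_first_carrier] by (simp add: lift_parts(2) gadget_lift)
  moreover have "T' (top_part (?lift u)) (top_part (?lift v)) (top_part (?lift w)) =
      T (top_part u) (top_part v) (top_part w)" for u v w
    using GH f by (simp add: lift_parts(2) pulls_back)
  ultimately have "labelled_form \<epsilon> T u v w = labelled_form \<epsilon> T' (?lift u) (?lift v) (?lift w)" for u v w
    by (simp add: labelled_form_def sym3_def)
  then show ?thesis unfolding equivalent_forms_iff using linear_iso_lift[OF GH] by blast
qed

end

locale labelled_isomorphism = labelling K L label for K L :: nat and label +
  fixes \<epsilon> :: "'a::field" and T T' :: "'a form3" and f g :: "'a vec \<Rightarrow> 'a vec"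
  assumes eps: "\<epsilon> \<noteq> 0" and T: "trilinear_form K T" and T': "trilinear_form K T'"
    and iso: "linear_iso total_dim f g"
    and pulls_back: "u \<in> carrier_vec total_dim \<Longrightarrow> v \<in> carrier_vec total_dim \<Longrightarrow> w \<in> carrier_vec total_dim \<Longrightarrow>
      labelled_form \<epsilon> T u v w = labelled_form \<epsilon> T' (f u) (f v) (f w)"
begin

lemmas f_carrier[simp] = linear_isoD(2)[OF iso] and g_carrier[simp] = linear_isoD(2)[OF linear_iso_sym[OF iso]]
  and gf[simp] = linear_isoD(3)[OF iso] and fg[simp] = linear_isoD(3)[OF linear_iso_sym[OF iso]]

lemma inverse: "labelled_isomorphism K L label \<epsilon> T' T g f"
  by unfold_locales (simp_all add: eps T T' linear_iso_sym[OF iso] pulls_back)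

lemma f_deep:
  assumes v: "v \<in> deep"
  shows "f v \<in> deep"
proof (rule ccontr)
  have vc: "v \<in> carrier_vec total_dim" by (rule deep_carrier[OF v])
  assume "f v \<notin> deep"
  then have "top_part (f v) \<noteq> 0\<^sub>v K" using vc by (simp add: deep_def)
  then obtain x where x: "x < K" "top_part (f v) $ x \<noteq> 0" by (rule nonzero_vec_index[OF vec_first_carrier])
  have "rank_le (K + K) deep (pairing \<epsilon> (top_part (f v)))"
  proof (rule rank_le_pullback[OF rank_labelled_form_deep_le[OF T v]])
    fix d d' :: "'a vec" assume "d \<in> deep" "d' \<in> deep"
    then show "pairing \<epsilon> (top_part (f v)) d d' = labelled_form \<epsilon> T v (g d) (g d')"
      using vc by (simp add: pulls_back deep_carrier labelled_form_deep_deep[OF T'])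
  qed (simp add: deep_carrier)
  from rank_pairing_ge[OF this eps, of "{x}"] show False using x by (simp add: weight_def)
qed

lemma f_deep_iff: "v \<in> carrier_vec total_dim \<Longrightarrow> f v \<in> deep \<longleftrightarrow> v \<in> deep"
  using f_deep labelled_isomorphism.f_deep[OF inverse, of "f v"] by auto

lemma rank_pairing_image:
  assumes v: "v \<in> carrier_vec total_dim" and rank: "rank_le k deep (pairing \<epsilon> (top_part v))"
  shows "rank_le k deep (pairing \<epsilon> (top_part (f v)))"
proof (rule rank_le_pullback[OF rank])
  show g_deep: "g d \<in> deep" if "d \<in> deep" for d by (rule labelled_isomorphism.f_deep[OF inverse that])
  fix d d' :: "'a vec" assume d: "d \<in> deep" "d' \<in> deep"
  have "pairing \<epsilon> (top_part (f v)) d d' = labelled_form \<epsilon> T' (f v) (f (g d)) (f (g d'))"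
    using d by (simp add: deep_carrier labelled_form_deep_deep[OF T'])
  also have "\<dots> = labelled_form \<epsilon> T v (g d) (g d')" using v d by (simp add: pulls_back deep_carrier)
  also have "\<dots> = pairing \<epsilon> (top_part v) (g d) (g d')" using d g_deep by (simp add: labelled_form_deep_deep[OF T])
  finally show "pairing \<epsilon> (top_part (f v)) d d' = pairing \<epsilon> (top_part v) (g d) (g d')" .
qed

lemma f_homogeneous_label_le:
  assumes v: "v \<in> carrier_vec total_dim" "top_part v \<in> homogeneous i" "v \<notin> deep" and i: "i < L"
  obtains j where "j \<le> i" "top_part (f v) \<in> homogeneous j"
proof -
  let ?u = "top_part (f v)"
  note rank_ge = rank_pairing_ge[OF rank_pairing_image[OF v(1) rank_pairing_homogeneous_le[OF v(2) i]] eps]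
  have "?u \<noteq> 0\<^sub>v K" using v(1,3) f_deep_iff[of v] by (simp add: deep_def)
  then obtain y where y: "y < K" "?u $ y \<noteq> 0" by (rule nonzero_vec_index[OF vec_first_carrier])
  have "label z = label y" if "z < K" "?u $ z \<noteq> 0" for z
  proof (rule ccontr)
    assume ne: "label z \<noteq> label y"
    then have "z \<noteq> y" by auto
    then have "2 * weight (label z) + 2 * weight (label y) \<le> weight i + weight i"
      using rank_ge[of "{z, y}"] y that ne by auto
    then show False using i labels_le by (simp add: weight_def)
  qed
  then have "?u \<in> homogeneous (label y)" by (auto simp: homogeneous_def)
  moreover have "label y \<le> i" using rank_ge[of "{y}"] y by (simp add: weight_def)
  ultimately show ?thesis using that by blast
qed

lemma f_homogeneous:
  assumes v: "v \<in> carrier_vec total_dim" "top_part v \<in> homogeneous i" and i: "i < L"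
  shows "top_part (f v) \<in> homogeneous i"
proof (cases "v \<in> deep")
  case True
  then show ?thesis using f_deep[OF True] by (simp add: deep_def homogeneous_def)
next
  case False
  obtain j where j: "j \<le> i" "top_part (f v) \<in> homogeneous j"
    using f_homogeneous_label_le[OF v False i] .
  obtain k where k: "k \<le> j" "top_part (g (f v)) \<in> homogeneous k"
    using labelled_isomorphism.f_homogeneous_label_le[OF inverse, of "f v" j] v(1) j False i
    by (auto simp: f_deep_iff)
  have "top_part v \<noteq> 0\<^sub>v K" using False v(1) by (simp add: deep_def)
  then obtain x where "x < K" "top_part v $ x \<noteq> 0" by (rule nonzero_vec_index[OF vec_first_carrier])
  then have "i = k" using v k(2) by (auto simp: homogeneous_def)
  then show ?thesis using j k(1) by simp
qed

definition induced :: "'a vec \<Rightarrow> 'a vec" where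
  "induced u = top_part (f (inclusion u))"

lemma linear_map_induced: "linear_map K K induced"
  unfolding induced_def[abs_def]
  by (rule linear_map_comp[OF linear_map_comp[OF linear_map_inclusion linear_isoD(1)[OF iso]] linear_map_top_part])

lemma induced_homogeneous: "u \<in> homogeneous i \<Longrightarrow> i < L \<Longrightarrow> induced u \<in> homogeneous i"
  unfolding induced_def by (rule f_homogeneous) (simp_all add: homogeneous_carrier)

text \<open>Testing the isomorphism on \<open>(u, v, c)\<close> with \<open>c\<close> in the gadget's subspace gives an antisymmetry
  in \<open>u\<close> and \<open>v\<close>; choosing \<open>c\<close> supported on the label of \<open>u\<close>, the side of \<open>v\<close> vanishes.\<close>

lemma pairing_induced_eq_0:
  assumes u: "u \<in> homogeneous i" "i < L" and v: "v \<in> homogeneous j" "j < L" and ij: "i \<noteq> j"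
  shows "pairing \<epsilon> (induced u) (f (inclusion v)) d = 0"
proof -
  have carrier: "u \<in> carrier_vec K" "v \<in> carrier_vec K" using u v by (simp_all add: homogeneous_carrier)
  have antisymmetric: "pairing \<epsilon> (induced u) (f (inclusion v)) c = - pairing \<epsilon> (induced v) c (f (inclusion u))"
    if c: "c \<in> deep" for c
  proof -
    have "g c \<in> deep" by (rule labelled_isomorphism.f_deep[OF inverse c])
    then have "0 = labelled_form \<epsilon> T (inclusion u) (inclusion v) (g c)"
      by (simp add: labelled_form_deep(1)[OF T] pairing_inclusion carrier)
    also have "\<dots> = labelled_form \<epsilon> T' (f (inclusion u)) (f (inclusion v)) c"
      using c by (simp add: pulls_back deep_carrier)
    also have "\<dots> = pairing \<epsilon> (induced u) (f (inclusion v)) c + pairing \<epsilon> (induced v) c (f (inclusion u))"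
      by (simp add: labelled_form_deep(1)[OF T' c] induced_def)
    finally show ?thesis by (simp add: eq_neg_iff_add_eq_0)
  qed
  have "pairing \<epsilon> (induced u) (f (inclusion v)) d = pairing \<epsilon> (induced u) (f (inclusion v)) (restrict_label i d)"
    by (simp add: pairing_restrict_label[OF induced_homogeneous[OF u]] u(2))
  also have "\<dots> = - pairing \<epsilon> (induced v) (restrict_label i d) (f (inclusion u))"
    by (rule antisymmetric[OF restrict_label_deep])
  also have "\<dots> = 0" using ij by (simp add: pairing_restrict_label[OF induced_homogeneous[OF v]] v(2))
  finally show ?thesis .
qed

theorem sym3_induced:
  assumes u: "u \<in> homogeneous i" "i < L" and v: "v \<in> homogeneous j" "j < L" and w: "w \<in> homogeneous k" "k < L"
    and distinct: "i \<noteq> j" "j \<noteq> k" "k \<noteq> i"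
  shows "sym3 \<epsilon> T u v w = sym3 \<epsilon> T' (induced u) (induced v) (induced w)"
proof -
  have "sym3 \<epsilon> T u v w = labelled_form \<epsilon> T' (f (inclusion u)) (f (inclusion v)) (f (inclusion w))"
    using u v w by (simp add: labelled_form_inclusion[symmetric] homogeneous_carrier pulls_back[symmetric])
  also have "\<dots> = sym3 \<epsilon> T' (induced u) (induced v) (induced w)"
    using pairing_induced_eq_0[OF u v distinct(1)] pairing_induced_eq_0[OF v w distinct(2)]
      pairing_induced_eq_0[OF w u distinct(3)]
    by (simp add: labelled_form_expand induced_def)
  finally show ?thesis .
qed

end

section \<open>The reduction on forms\<close>

text \<open>
  The seven summands occupy blocks of width \<open>n + 1\<close>, so that there is room for a scalar even if \<open>n = 0\<close>: the
  \<open>i\<close>-th copy of \<open>F^n\<close> is the start of block \<open>i < 3\<close>, the dual copy that of block 3, and the scalars are the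
  first coordinates of blocks 4, 5, 6. The other coordinates do not occur in the form.
\<close>

definition width :: "nat \<Rightarrow> nat" where "width n = n + 1"
definition base_dim :: "nat \<Rightarrow> nat" where "base_dim n = 7 * width n"

global_interpretation blocks: labelling "base_dim n" 7 "\<lambda>x. x div width n" for n
  defines out_dim = "blocks.total_dim"
  by unfold_locales (simp_all add: base_dim_def width_def less_mult_imp_div_less)

lemma width_pos[simp]: "0 < width n" and less_width_iff[simp]: "a < width n \<longleftrightarrow> a \<le> n"
  by (auto simp: width_def)

lemma block_index_less: "i < 7 \<Longrightarrow> a \<le> n \<Longrightarrow> i * width n + a < base_dim n"
  unfolding base_dim_def by (rule mult_add_less) simp_all

definition block :: "nat \<Rightarrow> nat \<Rightarrow> 'a::field vec \<Rightarrow> 'a vec" where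
  "block n i v = vec n (\<lambda>a. v $ (i * width n + a))"

definition scalar :: "nat \<Rightarrow> nat \<Rightarrow> 'a::field vec \<Rightarrow> 'a" where
  "scalar n i v = v $ (i * width n)"

definition base_form :: "nat \<Rightarrow> 'a::field form3 \<Rightarrow> 'a form3" where
  "base_form n \<phi> u v w = \<phi> (block n 0 u) (block n 1 v) (block n 2 w)
    + (\<Sum>i<3. (block n i u \<bullet> block n 3 v) * scalar n (4 + i) w)
    + scalar n 4 u * scalar n 5 v * scalar n 6 w"

definition out_form :: "nat \<Rightarrow> 'a::field \<Rightarrow> 'a form3 \<Rightarrow> 'a form3" where
  "out_form n \<epsilon> \<phi> = blocks.labelled_form n \<epsilon> (base_form n \<phi>)"

lemma block_carrier[simp]: "block n i v \<in> carrier_vec n"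
  and dim_block[simp]: "dim_vec (block n i v) = n"
  by (simp_all add: block_def)

lemma linear_map_block: "i < 7 \<Longrightarrow> linear_map (base_dim n) n (block n i :: 'a::field vec \<Rightarrow> 'a vec)"
  using block_index_less[of i _ n] by (auto simp: linear_map_def block_def)

lemma linear_form_scalar: "i < 7 \<Longrightarrow> linear_form (base_dim n) (scalar n i :: 'a::field vec \<Rightarrow> 'a)"
  using block_index_less[of i 0 n] by (auto simp: linear_form_def scalar_def)

lemma trilinear_form_base_form:
  assumes "trilinear_form n \<phi>"
  shows "trilinear_form (base_dim n) (base_form n \<phi>)"
proof -
  have "trilinear_form (base_dim n) (\<lambda>u v w. \<phi> (block n 0 u) (block n 1 v) (block n 2 w))"
    by (intro trilinear_form_pullback[OF assms] linear_map_block) simp_all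
  moreover have "trilinear_form (base_dim n) (\<lambda>u v w. \<Sum>i<3. (block n i u \<bullet> block n 3 v) * scalar n (4 + i) w)"
    by (intro trilinear_form_sum trilinear_form_scalar_prod[of _ n] linear_map_block linear_form_scalar) simp_all
  moreover have "trilinear_form (base_dim n) (\<lambda>u v w. scalar n 4 u * scalar n 5 v * scalar n 6 w)"
    by (intro trilinear_form_mult linear_form_scalar) simp_all
  ultimately show ?thesis
    unfolding base_form_def[abs_def] by (intro trilinear_form_add)
qed

lemma trilinear_form_out_form: "trilinear_form n \<phi> \<Longrightarrow> trilinear_form (out_dim n) (out_form n \<epsilon> \<phi>)"
  unfolding out_form_def by (intro blocks.trilinear_form_labelled_form trilinear_form_base_form)

subsection \<open>Recovering an isomorphism of the original forms\<close>

lemma block_homogeneous: "u \<in> blocks.homogeneous n j \<Longrightarrow> i \<noteq> j \<Longrightarrow> i < 7 \<Longrightarrow> block n i u = 0\<^sub>v n"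
  using block_index_less[of i _ n]
  by (intro eq_vecI) (auto simp: block_def blocks.homogeneous_def)

lemma scalar_homogeneous: "u \<in> blocks.homogeneous n j \<Longrightarrow> i \<noteq> j \<Longrightarrow> i < 7 \<Longrightarrow> scalar n i u = 0"
  using block_index_less[of i 0 n]
  by (simp add: scalar_def blocks.homogeneous_def)

definition base_triples :: "(nat \<times> nat \<times> nat) set" where
  "base_triples = {(0, 1, 2), (0, 3, 4), (1, 3, 5), (2, 3, 6), (4, 5, 6)}"

lemma base_form_homogeneous:
  assumes \<phi>: "trilinear_form n \<phi>" and u: "u \<in> blocks.homogeneous n i" and v: "v \<in> blocks.homogeneous n j"
    and w: "w \<in> blocks.homogeneous n k"
  shows "base_form n \<phi> u v w =
    (if (i, j, k) = (0, 1, 2) then \<phi> (block n 0 u) (block n 1 v) (block n 2 w) else 0)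
    + (\<Sum>l<3. if (i, j, k) = (l, 3, 4 + l) then (block n l u \<bullet> block n 3 v) * scalar n (4 + l) w else 0)
    + (if (i, j, k) = (4, 5, 6) then scalar n 4 u * scalar n 5 v * scalar n 6 w else 0)"
proof -
  have "\<phi> (block n 0 u) (block n 1 v) (block n 2 w) = 0" if "(i, j, k) \<noteq> (0, 1, 2)"
    using that block_homogeneous[OF u, of 0] block_homogeneous[OF v, of 1] block_homogeneous[OF w, of 2]
    by (fastforce simp: trilinear_form_zero[OF \<phi>])
  moreover have "(block n l u \<bullet> block n 3 v) * scalar n (4 + l) w = 0"
    if "(i, j, k) \<noteq> (l, 3, 4 + l)" "l < 3" for l
    using that block_homogeneous[OF u, of l] block_homogeneous[OF v, of 3] scalar_homogeneous[OF w, of "4 + l"]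
    by fastforce
  moreover have "scalar n 4 u * scalar n 5 v * scalar n 6 w = 0" if "(i, j, k) \<noteq> (4, 5, 6)"
    using that scalar_homogeneous[OF u, of 4] scalar_homogeneous[OF v, of 5] scalar_homogeneous[OF w, of 6]
    by fastforce
  ultimately show ?thesis
    unfolding base_form_def by (intro arg_cong2[of _ _ _ _ "(+)"] sum.cong refl) auto
qed

lemma sym3_base_form_homogeneous:
  assumes \<phi>: "trilinear_form n \<phi>" and u: "u \<in> blocks.homogeneous n i" and v: "v \<in> blocks.homogeneous n j"
    and w: "w \<in> blocks.homogeneous n k" and ijk: "(i, j, k) \<in> base_triples"
  shows "sym3 \<epsilon> (base_form n \<phi>) u v w = base_form n \<phi> u v w"
proof -
  have base_form_eq_0: "base_form n \<phi> u' v' w' = 0"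
    if "u' \<in> blocks.homogeneous n i'" "v' \<in> blocks.homogeneous n j'" "w' \<in> blocks.homogeneous n k'"
      and "(i', j', k') \<notin> base_triples" for u' v' w' i' j' k'
    using that(4) unfolding base_form_homogeneous[OF \<phi> that(1-3)]
    by (auto simp: base_triples_def lessThan_nat_numeral lessThan_Suc)
  have "base_form n \<phi> v w u = 0" "base_form n \<phi> w u v = 0" "base_form n \<phi> v u w = 0"
    "base_form n \<phi> u w v = 0" "base_form n \<phi> w v u = 0"
    using ijk base_form_eq_0[OF v w u] base_form_eq_0[OF w u v] base_form_eq_0[OF v u w]
      base_form_eq_0[OF u w v] base_form_eq_0[OF w v u]
    by (auto simp: base_triples_def)
  then show ?thesis by (simp add: sym3_def)
qed

definition block_inclusion :: "nat \<Rightarrow> nat \<Rightarrow> 'a::field vec \<Rightarrow> 'a vec" where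
  "block_inclusion n i v =
     vec (base_dim n) (\<lambda>x. if x div width n = i \<and> x mod width n < n then v $ (x mod width n) else 0)"

lemma linear_map_block_inclusion: "linear_map n (base_dim n) (block_inclusion n i :: 'a::field vec \<Rightarrow> 'a vec)"
  by (auto simp: linear_map_def block_inclusion_def)

lemma block_inclusion_homogeneous: "block_inclusion n i u \<in> blocks.homogeneous n i"
  by (simp add: blocks.homogeneous_def block_inclusion_def)

lemma block_block_inclusion: "i < 7 \<Longrightarrow> u \<in> carrier_vec n \<Longrightarrow> block n i (block_inclusion n i u) = u"
  using block_index_less[of i _ n]
  by (intro eq_vecI) (auto simp: block_def block_inclusion_def)

definition scalar_unit :: "nat \<Rightarrow> nat \<Rightarrow> 'a::field vec" where
  "scalar_unit n i = unit_vec (base_dim n) (i * width n)"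

lemma scalar_unit_homogeneous: "i < 7 \<Longrightarrow> scalar_unit n i \<in> blocks.homogeneous n i"
  using block_index_less[of i 0 n]
  by (auto simp: blocks.homogeneous_def scalar_unit_def)

lemma scalar_scalar_unit: "i < 7 \<Longrightarrow> scalar n i (scalar_unit n i) = 1"
  using block_index_less[of i 0 n] by (simp add: scalar_def scalar_unit_def)

lemma equivalent_forms_of_dual_triple:
  fixes \<phi> \<psi> :: "'a::field form3" and F :: "nat \<Rightarrow> 'a vec \<Rightarrow> 'a vec" and \<zeta> :: "nat \<Rightarrow> 'a"
  assumes \<psi>: "trilinear_form n \<psi>" and F: "\<And>i. i < 3 \<Longrightarrow> linear_map n n (F i)" and h: "linear_map n n h"
    and dual: "\<And>i u v. i < 3 \<Longrightarrow> u \<in> carrier_vec n \<Longrightarrow> v \<in> carrier_vec n \<Longrightarrow> (F i u \<bullet> h v) * \<zeta> i = u \<bullet> v"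
    and \<zeta>: "\<zeta> 0 * \<zeta> 1 * \<zeta> 2 = 1"
    and pulls_back: "\<And>u v w. u \<in> carrier_vec n \<Longrightarrow> v \<in> carrier_vec n \<Longrightarrow> w \<in> carrier_vec n \<Longrightarrow>
      \<phi> u v w = \<psi> (F 0 u) (F 1 v) (F 2 w)"
  shows "equivalent_forms n \<phi> \<psi>"
proof -
  define G where "G i u = \<zeta> i \<cdot>\<^sub>v F i u" for i u
  have G: "linear_map n n (G i)" if "i < 3" for i
    unfolding G_def by (rule linear_map_scale[OF F[OF that]])
  have G_dual: "G i u \<bullet> h v = u \<bullet> v" if "i < 3" "u \<in> carrier_vec n" "v \<in> carrier_vec n" for i u v
    using dual[OF that] linear_map_carrier[OF F[OF that(1)] that(2)] linear_map_carrier[OF h that(3)]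
    by (simp add: G_def mult.commute)
  have "\<exists>g. linear_iso n (G 0) g" by (rule dual_linear_map(1)[OF G h G_dual]) simp_all
  moreover have "\<phi> u v w = \<psi> (G 0 u) (G 0 v) (G 0 w)"
    if uvw: "u \<in> carrier_vec n" "v \<in> carrier_vec n" "w \<in> carrier_vec n" for u v w
  proof -
    have G_eq: "G i x = G 0 x" if "i < 3" "x \<in> carrier_vec n" for i x
      by (rule dual_linear_map(2)[OF G h G_dual G G_dual]) (use that in simp_all)
    have "\<psi> (G 0 u) (G 1 v) (G 2 w) = \<zeta> 0 * \<zeta> 1 * \<zeta> 2 * \<psi> (F 0 u) (F 1 v) (F 2 w)"
      unfolding G_def using uvw by (intro trilinear_form_smult[OF \<psi>]) (auto intro: linear_map_carrier[OF F])
    then show ?thesis using uvw \<zeta> G_eq[of 1 v] G_eq[of 2 w] by (simp add: pulls_back)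
  qed
  ultimately show ?thesis unfolding equivalent_forms_iff by blast
qed

lemma equivalent_forms_of_homogeneous_map:
  fixes \<phi> \<psi> :: "'a::field form3"
  assumes \<phi>: "trilinear_form n \<phi>" and \<psi>: "trilinear_form n \<psi>"
    and h: "linear_map (base_dim n) (base_dim n) h"
    and h_homogeneous: "\<And>i u. i < 7 \<Longrightarrow> u \<in> blocks.homogeneous n i \<Longrightarrow> h u \<in> blocks.homogeneous n i"
    and pulls_back: "\<And>i j k u v w. (i, j, k) \<in> base_triples \<Longrightarrow> u \<in> blocks.homogeneous n i \<Longrightarrow>
      v \<in> blocks.homogeneous n j \<Longrightarrow> w \<in> blocks.homogeneous n k \<Longrightarrow>
      base_form n \<phi> u v w = base_form n \<psi> (h u) (h v) (h w)"
  shows "equivalent_forms n \<phi> \<psi>"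
proof -
  define F where "F i u = block n i (h (block_inclusion n i u))" for i u
  define \<zeta> where "\<zeta> i = scalar n (4 + i) (h (scalar_unit n (4 + i)))" for i
  have F: "linear_map n n (F i)" if "i < 7" for i
    unfolding F_def
    by (rule linear_map_comp[OF linear_map_comp[OF linear_map_block_inclusion h] linear_map_block[OF that]])
  note homogeneous = block_inclusion_homogeneous scalar_unit_homogeneous h_homogeneous
  show ?thesis
  proof (rule equivalent_forms_of_dual_triple[OF \<psi> F F])
    show "\<phi> u v w = \<psi> (F 0 u) (F 1 v) (F 2 w)"
      if "u \<in> carrier_vec n" "v \<in> carrier_vec n" "w \<in> carrier_vec n" for u v w
      using that pulls_back[of 0 1 2 "block_inclusion n 0 u" "block_inclusion n 1 v" "block_inclusion n 2 w"]
      by (simp add: base_form_homogeneous[OF \<phi>, of _ 0 _ 1 _ 2] base_form_homogeneous[OF \<psi>, of _ 0 _ 1 _ 2]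
          homogeneous block_block_inclusion base_triples_def F_def)
    show "(F i u \<bullet> F 3 v) * \<zeta> i = u \<bullet> v" if "i < 3" "u \<in> carrier_vec n" "v \<in> carrier_vec n" for i u v
    proof -
      have "i = 0 \<or> i = 1 \<or> i = 2" using that(1) by linarith
      then have "(i, 3, 4 + i) \<in> base_triples" by (auto simp: base_triples_def)
      then have "base_form n \<phi> (block_inclusion n i u) (block_inclusion n 3 v) (scalar_unit n (4 + i)) =
          base_form n \<psi> (h (block_inclusion n i u)) (h (block_inclusion n 3 v)) (h (scalar_unit n (4 + i)))"
        using that by (intro pulls_back[of i 3 "4 + i"]) (simp_all add: homogeneous)
      then show ?thesis
        using that
        by (simp add: base_form_homogeneous[OF \<phi>, of _ i _ 3 _ "4 + i"]
            base_form_homogeneous[OF \<psi>, of _ i _ 3 _ "4 + i"] homogeneous block_block_inclusion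
            scalar_scalar_unit F_def \<zeta>_def sum.delta)
    qed
    show "\<zeta> 0 * \<zeta> 1 * \<zeta> 2 = 1"
      using pulls_back[of 4 5 6 "scalar_unit n 4" "scalar_unit n 5" "scalar_unit n 6"]
      by (simp add: base_form_homogeneous[OF \<phi>, of _ 4 _ 5 _ 6] base_form_homogeneous[OF \<psi>, of _ 4 _ 5 _ 6]
          homogeneous scalar_scalar_unit base_triples_def \<zeta>_def)
  qed simp_all
qed

lemma equivalent_forms_if_out_forms:
  fixes \<phi> \<psi> :: "'a::field form3"
  assumes \<phi>: "trilinear_form n \<phi>" and \<psi>: "trilinear_form n \<psi>" and eps: "\<epsilon> \<noteq> 0"
    and equiv: "equivalent_forms (out_dim n) (out_form n \<epsilon> \<phi>) (out_form n \<epsilon> \<psi>)"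
  shows "equivalent_forms n \<phi> \<psi>"
proof -
  obtain f g where "linear_iso (out_dim n) f g"
    "\<forall>u\<in>carrier_vec (out_dim n). \<forall>v\<in>carrier_vec (out_dim n). \<forall>w\<in>carrier_vec (out_dim n).
      out_form n \<epsilon> \<phi> u v w = out_form n \<epsilon> \<psi> (f u) (f v) (f w)"
    using equiv unfolding equivalent_forms_iff by blast
  then interpret labelled_isomorphism "base_dim n" 7 "\<lambda>x. x div width n" \<epsilon> "base_form n \<phi>" "base_form n \<psi>" f g
    by unfold_locales (simp_all add: eps \<phi> \<psi> trilinear_form_base_form out_form_def out_dim_def)
  show ?thesis
  proof (rule equivalent_forms_of_homogeneous_map[OF \<phi> \<psi> linear_map_induced induced_homogeneous])
    fix i j k and u v w :: "'a vec"
    assume ijk: "(i, j, k) \<in> base_triples" and uvw: "u \<in> blocks.homogeneous n i"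
      "v \<in> blocks.homogeneous n j" "w \<in> blocks.homogeneous n k"
    have "i < 7" "j < 7" "k < 7" "i \<noteq> j" "j \<noteq> k" "k \<noteq> i" using ijk by (auto simp: base_triples_def)
    then show "base_form n \<phi> u v w = base_form n \<psi> (induced u) (induced v) (induced w)"
      using uvw sym3_induced[of u i v j w k] induced_homogeneous
      by (simp add: sym3_base_form_homogeneous[OF \<phi> _ _ _ ijk] sym3_base_form_homogeneous[OF \<psi> _ _ _ ijk])
  qed
qed

subsection \<open>Extending an isomorphism of the original forms\<close>

definition block_map ::
    "nat \<Rightarrow> ('a::field vec \<Rightarrow> 'a vec) \<Rightarrow> ('a vec \<Rightarrow> 'a vec) \<Rightarrow> 'a vec \<Rightarrow> 'a vec" where
  "block_map n f h v = vec (base_dim n) (\<lambda>x.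
     let i = x div width n; a = x mod width n
     in if a < n \<and> i < 3 then f (block n i v) $ a else if a < n \<and> i = 3 then h (block n 3 v) $ a else v $ x)"

lemma block_vec_eqI:
  assumes "u \<in> carrier_vec (base_dim n)" "v \<in> carrier_vec (base_dim n)"
    and block: "\<And>i. i < 7 \<Longrightarrow> block n i u = block n i v"
    and last: "\<And>i. i < 7 \<Longrightarrow> u $ (i * width n + n) = v $ (i * width n + n)"
  shows "u = v"
proof (rule eq_vecI)
  fix x assume "x < dim_vec v"
  then have i: "x div width n < 7" using assms(2) by (simp add: base_dim_def less_mult_imp_div_less)
  have x: "x = x div width n * width n + x mod width n" by simp
  show "u $ x = v $ x"
  proof (cases "x mod width n < n")
    case True
    then have "u $ (x div width n * width n + x mod width n) = v $ (x div width n * width n + x mod width n)"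
      using arg_cong[OF block[OF i], of "\<lambda>u. u $ (x mod width n)"] by (simp add: block_def)
    then show ?thesis by simp
  next
    case False
    moreover have "x mod width n \<le> n" using mod_less_divisor[OF width_pos, of x n] unfolding less_width_iff .
    ultimately have "x mod width n = n" by simp
    then show ?thesis using last[OF i] x by metis
  qed
qed (use assms in simp)

lemma block_map_carrier[simp]: "block_map n f h v \<in> carrier_vec (base_dim n)"
  and dim_block_map[simp]: "dim_vec (block_map n f h v) = base_dim n"
  by (simp_all add: block_map_def)

lemma block_block_map:
  assumes f: "linear_map n n f" and h: "linear_map n n h" and i: "i < 7"
  shows "block n i (block_map n f h v) =
    (if i < 3 then f (block n i v) else if i = 3 then h (block n i v) else block n i v)"
  using i block_index_less[of i _ n] linear_map_carrier[OF f, of "block n i v"]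
    linear_map_carrier[OF h, of "block n i v"]
  by (intro eq_vecI) (auto simp: block_def block_map_def)

lemma block_map_last: "i < 7 \<Longrightarrow> block_map n f h v $ (i * width n + n) = v $ (i * width n + n)"
  using block_index_less[of i n n] by (simp add: block_map_def)

lemma scalar_block_map: "4 \<le> i \<Longrightarrow> i < 7 \<Longrightarrow> scalar n i (block_map n f h v) = scalar n i v"
  using block_index_less[of i 0 n] by (simp add: scalar_def block_map_def)

lemma linear_map_block_map:
  assumes f: "linear_map n n f" and h: "linear_map n n h"
  shows "linear_map (base_dim n) (base_dim n) (block_map n f h)"
  unfolding linear_map_def
proof (intro conjI ballI allI)
  fix u :: "'a vec" and c :: 'a assume u: "u \<in> carrier_vec (base_dim n)"
  show "block_map n f h (c \<cdot>\<^sub>v u) = c \<cdot>\<^sub>v block_map n f h u"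
    by (rule block_vec_eqI[where n = n])
      (use u in \<open>simp_all add: linear_map_smult[OF linear_map_block] block_block_map[OF f h] block_map_last
        linear_map_smult[OF f] linear_map_smult[OF h] block_index_less\<close>)
  fix v :: "'a vec" assume v: "v \<in> carrier_vec (base_dim n)"
  show "block_map n f h (u + v) = block_map n f h u + block_map n f h v"
    by (rule block_vec_eqI[where n = n])
      (use u v in \<open>simp_all add: linear_map_add[OF linear_map_block] block_block_map[OF f h] block_map_last
        linear_map_add[OF f] linear_map_add[OF h] block_index_less\<close>)
qed simp

lemma block_map_inverse:
  assumes fg: "linear_iso n f g" and hk: "linear_iso n h k" and v: "v \<in> carrier_vec (base_dim n)"
  shows "block_map n g k (block_map n f h v) = v"
proof -
  note linear = linear_isoD(1)[OF fg] linear_isoD(1)[OF hk] linear_isoD(1)[OF linear_iso_sym[OF fg]]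
    linear_isoD(1)[OF linear_iso_sym[OF hk]]
  show ?thesis
    by (rule block_vec_eqI[where n = n])
      (use v in \<open>simp_all add: block_block_map linear linear_isoD(3)[OF fg] linear_isoD(3)[OF hk] block_map_last\<close>)
qed

lemma linear_iso_block_map:
  assumes fg: "linear_iso n f g" and hk: "linear_iso n h k"
  shows "linear_iso (base_dim n) (block_map n f h) (block_map n g k)"
proof -
  note gf = linear_iso_sym[OF fg] and kh = linear_iso_sym[OF hk]
  show ?thesis
    unfolding linear_iso_def
    using linear_map_block_map[OF linear_isoD(1)[OF fg] linear_isoD(1)[OF hk]]
      linear_map_block_map[OF linear_isoD(1)[OF gf] linear_isoD(1)[OF kh]]
      block_map_inverse[OF fg hk] block_map_inverse[OF gf kh] by blast
qed

lemma block_component: "l < 7 \<Longrightarrow> block n l (blocks.component n i v) = (if l = i then block n l v else 0\<^sub>v n)"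
  using block_index_less[of l _ n] by (auto simp: block_def blocks.component_def)

lemma component_block_map:
  assumes f: "linear_map n n f" and h: "linear_map n n h"
  shows "blocks.component n i (block_map n f h v) = block_map n f h (blocks.component n i v)"
proof (rule block_vec_eqI[where n = n])
  show "block n l (blocks.component n i (block_map n f h v)) = block n l (block_map n f h (blocks.component n i v))"
    if "l < 7" for l
    using that by (simp add: block_component block_block_map[OF f h] linear_map_zero[OF f] linear_map_zero[OF h])
  show "blocks.component n i (block_map n f h v) $ (l * width n + n) =
      block_map n f h (blocks.component n i v) $ (l * width n + n)" if "l < 7" for l
    using that block_index_less[of l n n] by (simp add: block_map_last blocks.component_def)
qed simp_all

lemma equivalent_out_forms_if:
  fixes \<phi> \<psi> :: "'a::field form3"
  assumes "equivalent_forms n \<phi> \<psi>"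
  shows "equivalent_forms (out_dim n) (out_form n \<epsilon> \<phi>) (out_form n \<epsilon> \<psi>)"
proof -
  obtain f g where fg: "linear_iso n f g"
    and pulls_back: "\<forall>u\<in>carrier_vec n. \<forall>v\<in>carrier_vec n. \<forall>w\<in>carrier_vec n. \<phi> u v w = \<psi> (f u) (f v) (f w)"
    using assms unfolding equivalent_forms_iff by blast
  obtain A B where AB: "A \<in> carrier_mat n n" "B \<in> carrier_mat n n" "A * B = 1\<^sub>m n" "B * A = 1\<^sub>m n"
    and f: "\<forall>v\<in>carrier_vec n. f v = A *\<^sub>v v"
    by (rule linear_iso_matrices[OF fg])
  define h where "h = (*\<^sub>v) (transpose_mat B)"
  have dual: "f u \<bullet> h v = u \<bullet> v" if "u \<in> carrier_vec n" "v \<in> carrier_vec n" for u v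
    using that f by (simp add: h_def scalar_prod_transpose_inverse[OF AB(1,2,4)])
  have hk: "linear_iso n h ((*\<^sub>v) (transpose_mat A))"
    unfolding h_def using AB
    by (intro linear_iso_mult_mat_vec) (simp_all add: transpose_mult_eq_one[of _ n])
  note linear = linear_isoD(1)[OF fg] linear_isoD(1)[OF hk]
  have "base_form n \<phi> u v w = base_form n \<psi> (block_map n f h u) (block_map n f h v) (block_map n f h w)" for u v w
    using pulls_back
    by (simp add: base_form_def block_block_map[OF linear] scalar_block_map dual)
  then show ?thesis
    unfolding out_form_def
    by (intro blocks.equivalent_labelled_forms[OF linear_iso_block_map[OF fg hk]] component_block_map[OF linear])
qed

theorem equivalent_out_forms_iff:
  assumes "trilinear_form n \<phi>" "trilinear_form n \<psi>" "\<epsilon> \<noteq> 0"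
  shows "equivalent_forms (out_dim n) (out_form n \<epsilon> \<phi>) (out_form n \<epsilon> \<psi>) \<longleftrightarrow> equivalent_forms n \<phi> \<psi>"
  using equivalent_forms_if_out_forms[OF assms] equivalent_out_forms_if by blast

section \<open>Arrays of forms\<close>

lemma form_array_product:
  "form_array n \<phi> = map (\<lambda>(i, j, k). \<phi> (unit_vec n i) (unit_vec n j) (unit_vec n k))
     (List.product [0..<n] (List.product [0..<n] [0..<n]))"
  by (simp add: form_array_def product_concat_map map_concat comp_def)

lemma le_cube: "(n::nat) \<le> n ^ 3"
  by (cases n) (simp_all add: self_le_power)

lemma length_form_array: "length (form_array n \<phi>) = n ^ 3"
  by (simp add: form_array_product power3_eq_cube)

lemma nth_form_array:
  assumes "a < n" "b < n" "c < n"
  shows "form_array n \<phi> ! ((a * n + b) * n + c) = \<phi> (unit_vec n a) (unit_vec n b) (unit_vec n c)"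
proof -
  have bc: "b * n + c < n * n" by (rule mult_add_less[OF assms(2,3)])
  have index: "(a * n + b) * n + c = a * (n * n) + (b * n + c)" by (simp add: algebra_simps)
  have "a * (n * n) + (b * n + c) < n * (n * n)" by (rule mult_add_less[OF assms(1) bc])
  then show ?thesis
    unfolding index form_array_product using assms bc by (simp add: product_nth)
qed

lemma nth_form_array_append:
  assumes "f < 2" "a < m" "b < m" "c < m"
  shows "f * m ^ 3 + ((a * m + b) * m + c) < 2 * m ^ 3"
    and "(form_array m \<phi> @ form_array m \<psi>) ! (f * m ^ 3 + ((a * m + b) * m + c)) =
      (if f = 0 then \<phi> else \<psi>) (unit_vec m a) (unit_vec m b) (unit_vec m c)"
proof -
  have less: "(a * m + b) * m + c < m ^ 3"
    unfolding power3_eq_cube using assms by (intro mult_add_less)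
  then show "f * m ^ 3 + ((a * m + b) * m + c) < 2 * m ^ 3" by (rule mult_add_less[OF assms(1)])
  show "(form_array m \<phi> @ form_array m \<psi>) ! (f * m ^ 3 + ((a * m + b) * m + c)) =
      (if f = 0 then \<phi> else \<psi>) (unit_vec m a) (unit_vec m b) (unit_vec m c)"
    using less assms by (cases "f = 0") (auto simp: nth_append length_form_array nth_form_array less_2_cases_iff)
qed

lemma form_array_eq_iff:
  assumes "trilinear_form n \<phi>" "trilinear_form n \<psi>"
  shows "form_array n \<phi> = form_array n \<psi> \<longleftrightarrow>
    (\<forall>u\<in>carrier_vec n. \<forall>v\<in>carrier_vec n. \<forall>w\<in>carrier_vec n. \<phi> u v w = \<psi> u v w)"
proof
  assume eq: "form_array n \<phi> = form_array n \<psi>"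
  have "\<phi> (unit_vec n a) (unit_vec n b) (unit_vec n c) = \<psi> (unit_vec n a) (unit_vec n b) (unit_vec n c)"
    if "a < n" "b < n" "c < n" for a b c
    using nth_form_array[OF that, of \<phi>] nth_form_array[OF that, of \<psi>] eq by simp
  then show "\<forall>u\<in>carrier_vec n. \<forall>v\<in>carrier_vec n. \<forall>w\<in>carrier_vec n. \<phi> u v w = \<psi> u v w"
    using trilinear_form_eqI[OF assms] by blast
qed (auto simp: form_array_product)

lemma equivalent_forms_cong:
  assumes "\<forall>u\<in>carrier_vec n. \<forall>v\<in>carrier_vec n. \<forall>w\<in>carrier_vec n. \<phi> u v w = \<phi>' u v w"
    and "\<forall>u\<in>carrier_vec n. \<forall>v\<in>carrier_vec n. \<forall>w\<in>carrier_vec n. \<psi> u v w = \<psi>' u v w"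
  shows "equivalent_forms n \<phi> \<psi> \<longleftrightarrow> equivalent_forms n \<phi>' \<psi>'"
  using assms unfolding equivalent_forms_iff by (simp add: linear_isoD(2) cong: conj_cong)

lemma form_array_append_in_yes_instances_iff:
  assumes \<phi>: "trilinear_form n \<phi>" "P n \<phi>" and \<psi>: "trilinear_form n \<psi>" "P n \<psi>"
  shows "form_array n \<phi> @ form_array n \<psi> \<in> snd (form_equivalence_problem P) \<longleftrightarrow> equivalent_forms n \<phi> \<psi>"
proof
  assume "equivalent_forms n \<phi> \<psi>"
  then show "form_array n \<phi> @ form_array n \<psi> \<in> snd (form_equivalence_problem P)"
    using assms by (auto simp: form_equivalence_problem_def)
next
  assume "form_array n \<phi> @ form_array n \<psi> \<in> snd (form_equivalence_problem P)"
  then obtain m \<phi>' \<psi>' where eq: "form_array n \<phi> @ form_array n \<psi> = form_array m \<phi>' @ form_array m \<psi>'"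
    and m: "trilinear_form m \<phi>'" "trilinear_form m \<psi>'" "equivalent_forms m \<phi>' \<psi>'"
    unfolding form_equivalence_problem_def snd_conv mem_Collect_eq by blast
  have "n ^ 3 = m ^ 3" using arg_cong[OF eq, of length] by (simp add: length_form_array)
  then have "m = n" using power_eq_iff_eq_base[of 3 n m] by simp
  with eq have "form_array n \<phi> = form_array n \<phi>'" "form_array n \<psi> = form_array n \<psi>'"
    by (simp_all add: length_form_array)
  then show "equivalent_forms n \<phi> \<psi>"
    using m \<open>m = n\<close> \<phi> \<psi> equivalent_forms_cong[of n \<phi> \<phi>' \<psi> \<psi>'] by (simp add: form_array_eq_iff)
qed

section \<open>Entries of the constructed array\<close>

lemma (in labelling) gadget_unit_vecs:
  assumes "x < total_dim" "y < total_dim" "z < total_dim"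
  shows "gadget (top_part (unit_vec total_dim x)) (unit_vec total_dim y) (unit_vec total_dim z) =
    (\<Sum>i<L. if x < K \<and> label x = i \<and> p_index i 0 \<le> z \<and> z < p_index i (weight i)
        \<and> y = q_index x (z - p_index i 0) then 1 else (0 :: 'a::field))"
  unfolding gadget_def
proof (rule sum.cong[OF refl])
  let ?e = "unit_vec total_dim :: nat \<Rightarrow> 'a vec"
  fix i assume "i \<in> {..<L}"
  then have i: "i < L" by simp
  have "(component i (top_part (?e x)) \<bullet> q_slice r (?e y)) * ?e z $ p_index i r =
      (if r = z - p_index i 0 then if x < K \<and> label x = i \<and> p_index i 0 \<le> z \<and> y = q_index x r then 1 else 0 else 0)"
    if r: "r < weight i" for r
  proof -
    have "component i (top_part (?e x)) = (if x < K \<and> label x = i then unit_vec K x else 0\<^sub>v K)"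
      using assms by (intro eq_vecI) (auto simp: component_def top_part_unit)
    moreover have "q_slice r (?e y) $ x = (if y = q_index x r then 1 else 0)" if "x < K"
      using that assms q_index_less_dim[OF that weight_less[OF i r]] by (auto simp: q_slice_index)
    moreover have "?e z $ p_index i r = (if p_index i 0 \<le> z \<and> r = z - p_index i 0 then 1 else 0)"
      using assms p_index_less_dim[OF i weight_less[OF i r]] by (auto simp: p_index_def)
    ultimately show ?thesis by (cases "x < K") auto
  qed
  then have "(\<Sum>r<weight i. (component i (top_part (?e x)) \<bullet> q_slice r (?e y)) * ?e z $ p_index i r) =
      (\<Sum>r<weight i. if r = z - p_index i 0
        then if x < K \<and> label x = i \<and> p_index i 0 \<le> z \<and> y = q_index x r then 1 else 0 else 0)"
    by (intro sum.cong refl) simp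
  also have "\<dots> = (if x < K \<and> label x = i \<and> p_index i 0 \<le> z \<and> z < p_index i (weight i)
      \<and> y = q_index x (z - p_index i 0) then 1 else 0)"
    by (auto simp: sum.delta p_index_def)
  finally show "(\<Sum>r<weight i. (component i (top_part (?e x)) \<bullet> q_slice r (?e y)) * ?e z $ p_index i r) = \<dots>" .
qed

definition form_entry :: "nat \<Rightarrow> 'a::field form3 \<Rightarrow> nat \<Rightarrow> nat \<Rightarrow> nat \<Rightarrow> 'a" where
  "form_entry n \<phi> x y z =
    (if x < n \<and> width n \<le> y \<and> y < width n + n \<and> 2 * width n \<le> z \<and> z < 2 * width n + n
      then \<phi> (unit_vec n x) (unit_vec n (y - width n)) (unit_vec n (z - 2 * width n)) else 0)
    + (\<Sum>i<3. if i * width n \<le> x \<and> x < i * width n + n \<and> y = x + (3 - i) * width n \<and> z = (4 + i) * width n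
        then 1 else 0)
    + (if x = 4 * width n \<and> y = 5 * width n \<and> z = 6 * width n then 1 else 0)
    + (\<Sum>i<7. if i * width n \<le> x \<and> x < i * width n + width n
        \<and> blocks.p_index n i 0 \<le> z \<and> z < blocks.p_index n i (blocks.weight n i)
        \<and> y = blocks.q_index n x (z - blocks.p_index n i 0) then 1 else 0)"

lemma block_index_less_out_dim: "i < 7 \<Longrightarrow> a \<le> n \<Longrightarrow> i * width n + a < out_dim n"
  using block_index_less[of i a n] blocks.K_le_dim[of n] by linarith

lemma block_top_part_unit:
  assumes "i < 7" "x < out_dim n"
  shows "block n i (blocks.top_part n (unit_vec (out_dim n) x)) =
    (if i * width n \<le> x \<and> x < i * width n + n then unit_vec n (x - i * width n) else 0\<^sub>v n)"
  using assms block_index_less[of i _ n] block_index_less_out_dim[of i _ n]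
  by (intro eq_vecI) (auto simp: block_def vec_first_def)

lemma scalar_top_part_unit:
  assumes "i < 7" "x < out_dim n"
  shows "scalar n i (blocks.top_part n (unit_vec (out_dim n) x)) = (if x = i * width n then 1 else 0)"
  using assms block_index_less[of i 0 n] block_index_less_out_dim[of i 0 n]
  by (auto simp: scalar_def vec_first_def)

lemma div_width_eq_iff: "x div width n = i \<longleftrightarrow> i * width n \<le> x \<and> x < i * width n + width n"
proof -
  have "x div width n = i \<longleftrightarrow> i \<le> x div width n \<and> x div width n < Suc i" by auto
  also have "\<dots> \<longleftrightarrow> i * width n \<le> x \<and> x < Suc i * width n"
    by (simp only: less_eq_div_iff_mult_less_eq[OF width_pos] div_less_iff_less_mult[OF width_pos])
  finally show ?thesis by (simp add: add.commute)
qed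

lemma form_entry_eq:
  fixes \<phi> :: "'a::field form3"
  assumes \<phi>: "trilinear_form n \<phi>" and xyz: "x < out_dim n" "y < out_dim n" "z < out_dim n"
  defines "e \<equiv> unit_vec (out_dim n) :: nat \<Rightarrow> 'a vec"
    and "\<tau> \<equiv> blocks.top_part n :: 'a vec \<Rightarrow> 'a vec"
  shows "base_form n \<phi> (\<tau> (e x)) (\<tau> (e y)) (\<tau> (e z))
    + blocks.gadget n (\<tau> (e x)) (e y) (e z) = form_entry n \<phi> x y z"
proof -
  have "\<phi> (block n 0 (\<tau> (e x))) (block n 1 (\<tau> (e y))) (block n 2 (\<tau> (e z))) =
    (if x < n \<and> width n \<le> y \<and> y < width n + n \<and> 2 * width n \<le> z \<and> z < 2 * width n + n
      then \<phi> (unit_vec n x) (unit_vec n (y - width n)) (unit_vec n (z - 2 * width n)) else 0)"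
    unfolding e_def \<tau>_def using xyz by (auto simp: block_top_part_unit trilinear_form_zero[OF \<phi>])
  moreover have "(block n i (\<tau> (e x)) \<bullet> block n 3 (\<tau> (e y))) * scalar n (4 + i) (\<tau> (e z)) =
      (if i * width n \<le> x \<and> x < i * width n + n \<and> y = x + (3 - i) * width n \<and> z = (4 + i) * width n
        then 1 else 0)" if i: "i < 3" for i
  proof -
    have eq: "3 * width n = i * width n + (3 - i) * width n"
      using i by (simp add: add_mult_distrib[symmetric] del: distrib_right_numeral)
    show ?thesis
      unfolding e_def \<tau>_def using i xyz
      by (simp add: block_top_part_unit scalar_top_part_unit) (auto simp: eq)
  qed
  moreover have "scalar n 4 (\<tau> (e x)) * scalar n 5 (\<tau> (e y)) * scalar n 6 (\<tau> (e z)) =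
      (if x = 4 * width n \<and> y = 5 * width n \<and> z = 6 * width n then 1 else 0)"
    unfolding e_def \<tau>_def using xyz by (simp add: scalar_top_part_unit)
  moreover have "blocks.gadget n (\<tau> (e x)) (e y) (e z) = (\<Sum>i<7. if i * width n \<le> x \<and> x < i * width n + width n
        \<and> blocks.p_index n i 0 \<le> z \<and> z < blocks.p_index n i (blocks.weight n i)
        \<and> y = blocks.q_index n x (z - blocks.p_index n i 0) then 1 else 0)"
  proof -
    have "x < base_dim n \<and> x div width n = i \<longleftrightarrow> i * width n \<le> x \<and> x < i * width n + width n" if "i < 7" for i
      using that div_less_iff_less_mult[OF width_pos, of x n 7]
      by (auto simp: div_width_eq_iff[symmetric] base_dim_def)
    then show ?thesis
      unfolding e_def \<tau>_def blocks.gadget_unit_vecs[OF xyz] by (intro sum.cong refl) auto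
  qed
  ultimately show ?thesis
    unfolding base_form_def form_entry_def by (simp only: cong: sum.cong) simp
qed

definition cyclic_sum :: "('b \<Rightarrow> 'b \<Rightarrow> 'b \<Rightarrow> 'a::ab_group_add) \<Rightarrow> 'b \<Rightarrow> 'b \<Rightarrow> 'b \<Rightarrow> 'a" where
  "cyclic_sum F x y z = F x y z + F y z x + F z x y"

lemma out_form_unit:
  fixes \<phi> :: "'a::field form3"
  assumes "trilinear_form n \<phi>" "x < out_dim n" "y < out_dim n" "z < out_dim n"
  shows "out_form n \<epsilon> \<phi> (unit_vec (out_dim n) x) (unit_vec (out_dim n) y) (unit_vec (out_dim n) z) =
    cyclic_sum (form_entry n \<phi>) x y z + \<epsilon> * cyclic_sum (form_entry n \<phi>) y x z"
  using assms by (simp add: out_form_def blocks.labelled_form_def sym3_def form_entry_eq cyclic_sum_def)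

section \<open>Time-bounded execution\<close>

definition runs :: "('a::field \<Rightarrow> nat) \<Rightarrow> 'a com \<Rightarrow> 'a state \<Rightarrow> nat \<Rightarrow> ('a state \<Rightarrow> bool) \<Rightarrow> bool" where
  "runs sz c s k Q \<longleftrightarrow> (\<exists>t s'. exec sz c s t s' \<and> t \<le> k \<and> Q s')"

lemma runsI: "exec sz c s t s' \<Longrightarrow> t \<le> k \<Longrightarrow> Q s' \<Longrightarrow> runs sz c s k Q"
  unfolding runs_def by blast

lemma runsE:
  assumes "runs sz c s k Q"
  obtains t s' where "exec sz c s t s'" "t \<le> k" "Q s'"
  using assms unfolding runs_def by blast

lemma runs_mono: "runs sz c s k P \<Longrightarrow> k \<le> k' \<Longrightarrow> (\<And>s'. P s' \<Longrightarrow> Q s') \<Longrightarrow> runs sz c s k' Q"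
  unfolding runs_def by (meson order_trans)

lemma runs_Skip: "Q s \<Longrightarrow> runs sz Skip s 1 Q"
  by (rule runsI[OF exec.Skip]) simp_all

lemma runs_IndexConst: "Q (I(r := k), M) \<Longrightarrow> runs sz (IndexConst r k) (I, M) 1 Q"
  by (rule runsI[OF exec.IndexConst]) simp_all

lemma runs_IndexAdd: "Q (I(r := I p + I q), M) \<Longrightarrow> runs sz (IndexAdd r p q) (I, M) 1 Q"
  by (rule runsI[OF exec.IndexAdd]) simp_all

lemma runs_IndexSub: "Q (I(r := I p - I q), M) \<Longrightarrow> runs sz (IndexSub r p q) (I, M) 1 Q"
  by (rule runsI[OF exec.IndexSub]) simp_all

lemma runs_FieldConst: "Q (I, M(I r := a)) \<Longrightarrow> sz a \<le> Z \<Longrightarrow> runs sz (FieldConst r a) (I, M) (1 + Z) Q"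
  by (rule runsI[OF exec.FieldConst]) simp_all

lemma runs_FieldCopy:
  "Q (I, M(I r := M (I p))) \<Longrightarrow> sz (M (I p)) \<le> Z \<Longrightarrow> runs sz (FieldCopy r p) (I, M) (1 + Z) Q"
  by (rule runsI[OF exec.FieldCopy]) simp_all

lemma runs_FieldOp:
  "Q (I, M(I r := eval_op f (M (I p)) (M (I q)))) \<Longrightarrow> sz (M (I p)) \<le> Z \<Longrightarrow> sz (M (I q)) \<le> Z \<Longrightarrow>
    sz (eval_op f (M (I p)) (M (I q))) \<le> Z \<Longrightarrow> runs sz (FieldOp f r p q) (I, M) (1 + 3 * Z) Q"
  by (rule runsI[OF exec.FieldOp[OF refl refl refl]]) simp_all

lemma runs_Seq: "runs sz c s k (\<lambda>s'. runs sz c' s' k' Q) \<Longrightarrow> runs sz (Seq c c') s (k + k') Q"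
  unfolding runs_def by (meson exec.Seq add_mono)

lemma runs_Cond_IndexLess:
  assumes "I r < I s \<Longrightarrow> runs sz c (I, M) k Q" "\<not> I r < I s \<Longrightarrow> runs sz c' (I, M) k Q"
  shows "runs sz (Cond (IndexLess r s) c c') (I, M) (1 + k) Q"
proof (cases "I r < I s")
  case True
  from assms(1)[OF this] obtain t s' where run: "exec sz c (I, M) t s'" "t \<le> k" "Q s'" by (rule runsE)
  show ?thesis by (rule runsI[OF exec.CondTrue[OF _ run(1)]]) (use True run in simp_all)
next
  case False
  from assms(2)[OF this] obtain t s' where run: "exec sz c' (I, M) t s'" "t \<le> k" "Q s'" by (rule runsE)
  show ?thesis by (rule runsI[OF exec.CondFalse[OF _ run(1)]]) (use False run in simp_all)
qed

lemma runs_While_IndexLess: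
  assumes step: "\<And>i I M. P (Suc i) (I, M) \<Longrightarrow> I r < I s \<and> runs sz c (I, M) k (P i)"
    and exit: "\<And>I M. P 0 (I, M) \<Longrightarrow> \<not> I r < I s \<and> Q (I, M)"
    and start: "P n (I, M)"
  shows "runs sz (While (IndexLess r s) c) (I, M) (n * (k + 1) + 1) Q"
  using start
proof (induction n arbitrary: I M)
  case 0
  then show ?case using exit by (intro runsI[OF exec.WhileFalse]) auto
next
  case (Suc n)
  obtain t J M' where body: "exec sz c (I, M) t (J, M')" "t \<le> k" "P n (J, M')"
    using step[OF Suc.prems] by (auto elim: runsE)
  from Suc.IH[OF body(3)] obtain t' s' where loop: "exec sz (While (IndexLess r s) c) (J, M') t' s'"
    "t' \<le> n * (k + 1) + 1" "Q s'" by (rule runsE)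
  show ?case
    by (rule runsI[OF exec.WhileTrue[OF _ body(1) loop(1)]]) (use step[OF Suc.prems] body loop in simp_all)
qed

section \<open>Index expressions\<close>

datatype index_op = AddOp | SubOp | MulOp

primrec index_op_val :: "index_op \<Rightarrow> nat \<Rightarrow> nat \<Rightarrow> nat" where
  "index_op_val AddOp a b = a + b"
| "index_op_val SubOp a b = a - b"
| "index_op_val MulOp a b = a * b"

primrec index_op_bound :: "index_op \<Rightarrow> nat \<Rightarrow> nat \<Rightarrow> nat" where
  "index_op_bound AddOp a b = a + b"
| "index_op_bound SubOp a b = a"
| "index_op_bound MulOp a b = a * b"

text \<open>The machine has no multiplication of indices, so a product is an iterated sum.\<close>

primrec index_op_compile :: "index_op \<Rightarrow> nat \<Rightarrow> 'a com" where
  "index_op_compile AddOp d = IndexAdd d d (d + 1)"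
| "index_op_compile SubOp d = IndexSub d d (d + 1)"
| "index_op_compile MulOp d = Seq (IndexConst (d + 2) 0) (Seq (IndexConst (d + 3) 1) (Seq (IndexConst (d + 4) 0)
     (Seq (While (IndexLess (d + 4) (d + 1))
             (Seq (IndexAdd (d + 2) (d + 2) d) (IndexSub (d + 1) (d + 1) (d + 3))))
       (IndexAdd d (d + 2) (d + 4)))))"

primrec index_op_time :: "index_op \<Rightarrow> nat \<Rightarrow> nat" where
  "index_op_time AddOp b = 1"
| "index_op_time SubOp b = 1"
| "index_op_time MulOp b = 3 * b + 5"

datatype index_exp = IConst nat | IReg nat | IBinary index_op index_exp index_exp

abbreviation "IPlus \<equiv> IBinary AddOp"
abbreviation "IMinus \<equiv> IBinary SubOp"
abbreviation "ITimes \<equiv> IBinary MulOp"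

primrec index_val :: "index_exp \<Rightarrow> (nat \<Rightarrow> nat) \<Rightarrow> nat" where
  "index_val (IConst k) I = k"
| "index_val (IReg r) I = I r"
| "index_val (IBinary f a b) I = index_op_val f (index_val a I) (index_val b I)"

primrec index_scoped :: "nat \<Rightarrow> index_exp \<Rightarrow> bool" where
  "index_scoped d (IConst k) \<longleftrightarrow> True"
| "index_scoped d (IReg r) \<longleftrightarrow> r < d"
| "index_scoped d (IBinary f a b) \<longleftrightarrow> index_scoped d a \<and> index_scoped d b"

primrec index_bound :: "index_exp \<Rightarrow> nat \<Rightarrow> nat" where
  "index_bound (IConst k) B = k"
| "index_bound (IReg r) B = B"
| "index_bound (IBinary f a b) B = index_op_bound f (index_bound a B) (index_bound b B)"

text \<open>The value goes to register \<open>d\<close>; the registers above \<open>d\<close> serve as workspace.\<close>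

primrec index_compile :: "index_exp \<Rightarrow> nat \<Rightarrow> 'a com" where
  "index_compile (IConst k) d = IndexConst d k"
| "index_compile (IReg r) d = Seq (IndexConst d 0) (IndexAdd d r d)"
| "index_compile (IBinary f a b) d =
     Seq (index_compile a d) (Seq (index_compile b (d + 1)) (index_op_compile f d))"

primrec index_time :: "index_exp \<Rightarrow> nat \<Rightarrow> nat" where
  "index_time (IConst k) B = 1"
| "index_time (IReg r) B = 2"
| "index_time (IBinary f a b) B = index_time a B + (index_time b B + index_op_time f (index_bound b B))"

lemma index_val_cong:
  "index_scoped d e \<Longrightarrow> (\<And>r. r < d \<Longrightarrow> I r = J r) \<Longrightarrow> index_val e I = index_val e J"
  by (induction e) auto

lemma index_op_val_le_bound: "a \<le> a' \<Longrightarrow> b \<le> b' \<Longrightarrow> index_op_val f a b \<le> index_op_bound f a' b'"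
  by (cases f) (auto intro: add_mono mult_mono)

lemma index_val_le_bound:
  "index_scoped d e \<Longrightarrow> (\<And>r. r < d \<Longrightarrow> I r \<le> B) \<Longrightarrow> index_val e I \<le> index_bound e B"
  by (induction e) (auto intro: index_op_val_le_bound)

lemma runs_multiply:
  fixes sz :: "'a::field \<Rightarrow> nat"
  assumes "\<And>J. J d = I d * I (d + 1) \<Longrightarrow> (\<And>r. r < d \<Longrightarrow> J r = I r) \<Longrightarrow> Q (J, M)"
  shows "runs sz (index_op_compile MulOp d) (I, M) (3 * I (d + 1) + 5) Q"
proof -
  let ?loop = "While (IndexLess (d + 4) (d + 1))
    (Seq (IndexAdd (d + 2) (d + 2) d) (IndexSub (d + 1) (d + 1) (d + 3)))"
  define P :: "nat \<Rightarrow> 'a state \<Rightarrow> bool" where "P i = (\<lambda>(J, M'). M' = M \<and> J (d + 1) = i \<and>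
    J (d + 2) + J d * i = I d * I (d + 1) \<and> J (d + 3) = 1 \<and> J (d + 4) = 0 \<and> (\<forall>r\<le>d. J r = I r))" for i
  have loop: "runs sz ?loop (J, M) (I (d + 1) * (1 + 1 + 1) + 1) (P 0)" if "P (I (d + 1)) (J, M)" for J
  proof (rule runs_While_IndexLess[of P, OF _ _ that])
    fix i J M' assume P: "P (Suc i) (J, M')"
    show "J (d + 4) < J (d + 1) \<and>
        runs sz (Seq (IndexAdd (d + 2) (d + 2) d) (IndexSub (d + 1) (d + 1) (d + 3))) (J, M') (1 + 1) (P i)"
      by (intro conjI runs_Seq runs_IndexAdd runs_IndexSub) (use P in \<open>auto simp: P_def\<close>)
  qed (simp add: P_def)
  have "runs sz (IndexAdd d (d + 2) (d + 4)) (J, M') 1 Q" if "P 0 (J, M')" for J M'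
    using that by (intro runs_IndexAdd) (simp add: P_def assms)
  then have loop_add: "runs sz (Seq ?loop (IndexAdd d (d + 2) (d + 4))) (J, M) (I (d + 1) * (1 + 1 + 1) + 1 + 1) Q"
    if "P (I (d + 1)) (J, M)" for J
    by (intro runs_Seq runs_mono[OF loop[OF that]]) auto
  have "runs sz (index_op_compile MulOp d) (I, M) (1 + (1 + (1 + (I (d + 1) * (1 + 1 + 1) + 1 + 1)))) Q"
    unfolding index_op_compile.simps by ((rule runs_Seq, rule runs_IndexConst)+, rule loop_add) (simp add: P_def)
  then show ?thesis by (rule runs_mono) simp_all
qed

lemma runs_index_op_compile:
  assumes "I (d + 1) \<le> b"
    and Q: "\<And>J. J d = index_op_val f (I d) (I (d + 1)) \<Longrightarrow> (\<And>r. r < d \<Longrightarrow> J r = I r) \<Longrightarrow> Q (J, M)"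
  shows "runs sz (index_op_compile f d) (I, M) (index_op_time f b) Q"
proof (cases f)
  case MulOp
  have "runs sz (index_op_compile MulOp d) (I, M) (3 * I (d + 1) + 5) Q"
    by (rule runs_multiply, rule Q) (simp_all add: MulOp)
  then show ?thesis unfolding MulOp by (rule runs_mono) (use assms(1) in auto)
qed (use Q in \<open>auto intro!: runs_IndexAdd[simplified] runs_IndexSub[simplified]\<close>)

lemma runs_index_compile:
  assumes "index_scoped s e" "s \<le> d" "\<And>r. r < s \<Longrightarrow> I r \<le> B"
    and "\<And>J. J d = index_val e I \<Longrightarrow> (\<And>r. r < d \<Longrightarrow> J r = I r) \<Longrightarrow> Q (J, M)"
  shows "runs sz (index_compile e d) (I, M) (index_time e B) Q"
  using assms
proof (induction e arbitrary: d I Q)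
  case (IConst k)
  show ?case unfolding index_compile.simps index_time.simps by (rule runs_IndexConst) (simp add: IConst.prems)
next
  case (IReg r)
  have "runs sz (index_compile (IReg r) d) (I, M) (1 + 1) Q"
    unfolding index_compile.simps using IReg by (intro runs_Seq runs_IndexConst runs_IndexAdd) auto
  then show ?case by (rule runs_mono) simp_all
next
  case (IBinary f a b)
  show ?case
    unfolding index_compile.simps index_time.simps
  proof (intro runs_Seq IBinary.IH runs_index_op_compile)
    fix J L K
    assume J: "J d = index_val a I" "\<And>r. r < d \<Longrightarrow> J r = I r"
      and L: "L (d + 1) = index_val b J" "\<And>r. r < d + 1 \<Longrightarrow> L r = J r"
    have b: "index_val b J = index_val b I" using IBinary.prems J by (intro index_val_cong[of s]) auto
    show "L (d + 1) \<le> index_bound b B"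
      unfolding L(1) b using IBinary.prems by (intro index_val_le_bound[of s]) auto
    assume "K d = index_op_val f (L d) (L (d + 1))" "\<And>r. r < d \<Longrightarrow> K r = L r"
    then show "Q (K, M)" using IBinary.prems J L b by simp
  qed (use IBinary.prems in auto)
qed

section \<open>A structured programming language\<close>

datatype 'a prog =
    PSkip
  | PSeq "'a prog" "'a prog"
  | PFor index_exp "'a prog"
  | PIf index_exp index_exp "'a prog"
  | PConst index_exp 'a
  | PCopy index_exp index_exp
  | POp field_op index_exp index_exp index_exp

text \<open>Registers are allocated in stack discipline: a loop entered at level \<open>d\<close> keeps its counter in
  register \<open>d\<close> and its bound in register \<open>d + 1\<close>, and its body lives at level \<open>d + 2\<close>.\<close>

definition counting_loop :: "nat \<Rightarrow> 'a com \<Rightarrow> 'a com" where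
  "counting_loop d c = Seq (IndexConst d 0) (While (IndexLess d (d + 1))
     (Seq c (Seq (IndexConst (d + 2) 1) (IndexAdd d d (d + 2)))))"

primrec prog_compile :: "'a prog \<Rightarrow> nat \<Rightarrow> 'a com" where
  "prog_compile PSkip d = Skip"
| "prog_compile (PSeq g h) d = Seq (prog_compile g d) (prog_compile h d)"
| "prog_compile (PFor e h) d = Seq (index_compile e (d + 1)) (counting_loop d (prog_compile h (d + 2)))"
| "prog_compile (PIf a b h) d = Seq (index_compile a d) (Seq (index_compile b (d + 1))
     (Cond (IndexLess d (d + 1)) (prog_compile h d) Skip))"
| "prog_compile (PConst a c) d = Seq (index_compile a d) (FieldConst d c)"
| "prog_compile (PCopy a b) d = Seq (index_compile a d) (Seq (index_compile b (d + 1)) (FieldCopy d (d + 1)))"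
| "prog_compile (POp f a b c) d = Seq (index_compile a d) (Seq (index_compile b (d + 1))
     (Seq (index_compile c (d + 2)) (FieldOp f d (d + 1) (d + 2))))"

primrec prog_scoped :: "nat \<Rightarrow> 'a prog \<Rightarrow> bool" where
  "prog_scoped d PSkip \<longleftrightarrow> True"
| "prog_scoped d (PSeq g h) \<longleftrightarrow> prog_scoped d g \<and> prog_scoped d h"
| "prog_scoped d (PFor e h) \<longleftrightarrow> index_scoped d e \<and> prog_scoped (d + 2) h"
| "prog_scoped d (PIf a b h) \<longleftrightarrow> index_scoped d a \<and> index_scoped d b \<and> prog_scoped d h"
| "prog_scoped d (PConst a c) \<longleftrightarrow> index_scoped d a"
| "prog_scoped d (PCopy a b) \<longleftrightarrow> index_scoped d a \<and> index_scoped d b"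
| "prog_scoped d (POp f a b c) \<longleftrightarrow> index_scoped d a \<and> index_scoped d b \<and> index_scoped d c"

primrec prog_time :: "'a prog \<Rightarrow> nat \<Rightarrow> nat \<Rightarrow> nat" where
  "prog_time PSkip B Z = 1"
| "prog_time (PSeq g h) B Z = prog_time g B Z + prog_time h B Z"
| "prog_time (PFor e h) B Z =
     index_time e B + (index_bound e B * (prog_time h (B + index_bound e B) Z + 3) + 2)"
| "prog_time (PIf a b h) B Z = index_time a B + (index_time b B + (1 + (prog_time h B Z + 1)))"
| "prog_time (PConst a c) B Z = index_time a B + (1 + Z)"
| "prog_time (PCopy a b) B Z = index_time a B + (index_time b B + (1 + Z))"
| "prog_time (POp f a b c) B Z = index_time a B + (index_time b B + (index_time c B + (1 + 3 * Z)))"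

text \<open>The bound \<open>Z\<close> on the sizes of all field elements read or written is part of the precondition, because
  it bounds the cost of the field instructions.\<close>

primrec wp :: "('a::field \<Rightarrow> nat) \<Rightarrow> nat \<Rightarrow> 'a prog \<Rightarrow> nat \<Rightarrow> (nat \<Rightarrow> nat) \<Rightarrow>
    ((nat \<Rightarrow> 'a) \<Rightarrow> bool) \<Rightarrow> (nat \<Rightarrow> 'a) \<Rightarrow> bool" where
  "wp sz Z PSkip d I Q M \<longleftrightarrow> Q M"
| "wp sz Z (PSeq g h) d I Q M \<longleftrightarrow> wp sz Z g d I (wp sz Z h d I Q) M"
| "wp sz Z (PFor e h) d I Q M \<longleftrightarrow>
     foldr (\<lambda>i. wp sz Z h (d + 2) (I(d := i, d + 1 := index_val e I))) [0..<index_val e I] Q M"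
| "wp sz Z (PIf a b h) d I Q M \<longleftrightarrow> (if index_val a I < index_val b I then wp sz Z h d I Q M else Q M)"
| "wp sz Z (PConst a c) d I Q M \<longleftrightarrow> sz c \<le> Z \<and> Q (M(index_val a I := c))"
| "wp sz Z (PCopy a b) d I Q M \<longleftrightarrow>
     sz (M (index_val b I)) \<le> Z \<and> Q (M(index_val a I := M (index_val b I)))"
| "wp sz Z (POp f a b c) d I Q M \<longleftrightarrow> sz (M (index_val b I)) \<le> Z \<and> sz (M (index_val c I)) \<le> Z \<and>
     sz (eval_op f (M (index_val b I)) (M (index_val c I))) \<le> Z \<and>
     Q (M(index_val a I := eval_op f (M (index_val b I)) (M (index_val c I))))"

lemma wp_cong:
  "prog_scoped d h \<Longrightarrow> (\<And>r. r < d \<Longrightarrow> I r = J r) \<Longrightarrow> wp sz Z h d I Q M \<longleftrightarrow> wp sz Z h d J Q M"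
proof (induction h arbitrary: d I J Q M)
  case (PSeq g h)
  have "wp sz Z h d I Q = wp sz Z h d J Q" by (rule ext, rule PSeq.IH(2)) (use PSeq.prems in auto)
  moreover have "wp sz Z g d I P M = wp sz Z g d J P M" for P by (rule PSeq.IH(1)) (use PSeq.prems in auto)
  ultimately show ?case by simp
next
  case (PFor e h)
  have "index_val e I = index_val e J" using PFor.prems by (intro index_val_cong[of d]) auto
  moreover have "wp sz Z h (d + 2) (I(d := i, d + 1 := k)) = wp sz Z h (d + 2) (J(d := i, d + 1 := k))" for i k
    using PFor.prems by (intro ext PFor.IH) auto
  ultimately show ?case by simp
next
  case (PIf a b h)
  have "index_val a I = index_val a J" "index_val b I = index_val b J"
    using PIf.prems by (auto intro: index_val_cong[of d])
  moreover have "wp sz Z h d I Q M = wp sz Z h d J Q M" by (rule PIf.IH) (use PIf.prems in auto)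
  ultimately show ?case by simp
next
  case (PConst a c)
  then have "index_val a I = index_val a J" by (auto intro: index_val_cong[of d])
  then show ?case by simp
next
  case (PCopy a b)
  then have "index_val a I = index_val a J" "index_val b I = index_val b J" by (auto intro: index_val_cong[of d])
  then show ?case by simp
next
  case (POp f a b c)
  then have "index_val a I = index_val a J" "index_val b I = index_val b J" "index_val c I = index_val c J"
    by (auto intro: index_val_cong[of d])
  then show ?case by simp
qed simp

lemma wp_transfer:
  "wp sz Z h d I Q M \<Longrightarrow> prog_scoped d h \<Longrightarrow> (\<And>r. r < d \<Longrightarrow> J r = I r) \<Longrightarrow> wp sz Z h d J Q M"
  using wp_cong[of d h J I sz Z Q M] by blast

lemma wp_mono: "wp sz Z h d I P M \<Longrightarrow> (\<And>M. P M \<Longrightarrow> Q M) \<Longrightarrow> wp sz Z h d I Q M"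
proof (induction h arbitrary: d I P Q M)
  case (PSeq g h)
  have "wp sz Z g d I (wp sz Z h d I P) M" using PSeq.prems(1) by simp
  then have "wp sz Z g d I (wp sz Z h d I Q) M"
    by (rule PSeq.IH(1)) (rule PSeq.IH(2)[OF _ PSeq.prems(2)])
  then show ?case by simp
next
  case (PFor e h)
  have "foldr (\<lambda>i. wp sz Z h (d + 2) (J i)) xs P M \<Longrightarrow> foldr (\<lambda>i. wp sz Z h (d + 2) (J i)) xs Q M" for xs J M
    by (induction xs arbitrary: M) (auto intro: PFor.prems(2) PFor.IH)
  then show ?case using PFor.prems(1) by simp
qed (auto split: if_splits)

lemma wp_PFor:
  assumes start: "P 0 M"
    and step: "\<And>i M. i < index_val e I \<Longrightarrow> P i M \<Longrightarrow>
      wp sz Z h (d + 2) (I(d := i, d + 1 := index_val e I)) (P (Suc i)) M"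
    and exit: "\<And>M. P (index_val e I) M \<Longrightarrow> Q M"
  shows "wp sz Z (PFor e h) d I Q M"
proof -
  let ?n = "index_val e I"
  let ?W = "\<lambda>i. wp sz Z h (d + 2) (I(d := i, d + 1 := ?n))"
  have "foldr ?W [k..<?n] Q M" if "k \<le> ?n" "P k M" for k M
    using that
  proof (induction k arbitrary: M rule: inc_induct)
    case base
    then show ?case using exit by simp
  next
    case (step k)
    show ?case
      unfolding upt_conv_Cons[OF step.hyps(2)] foldr.simps o_apply
      by (rule wp_mono[OF assms(2)[OF step.hyps(2) step.prems] step.IH])
  qed
  from this[of 0 M] show ?thesis using start by simp
qed

lemma runs_counting_loop:
  fixes c :: "'a::field com"
  assumes body: "\<And>i J M R. i < n \<Longrightarrow> J d = i \<Longrightarrow> J (d + 1) = n \<Longrightarrow> (\<And>r. r < d \<Longrightarrow> J r = I r) \<Longrightarrow> P i M \<Longrightarrow>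
      (\<And>J' M'. P (Suc i) M' \<Longrightarrow> (\<And>r. r < d + 2 \<Longrightarrow> J' r = J r) \<Longrightarrow> R (J', M')) \<Longrightarrow> runs sz c (J, M) k R"
    and start: "I (d + 1) = n" "P 0 M"
    and exit: "\<And>J M. P n M \<Longrightarrow> (\<And>r. r < d \<Longrightarrow> J r = I r) \<Longrightarrow> R (J, M)"
  shows "runs sz (counting_loop d c) (I, M) (n * (k + 3) + 2) R"
proof -
  let ?body = "Seq c (Seq (IndexConst (d + 2) 1) (IndexAdd d d (d + 2)))"
  define remaining :: "nat \<Rightarrow> 'a state \<Rightarrow> bool" where "remaining m = (\<lambda>(J, M). m \<le> n \<and>
    J d = n - m \<and> J (d + 1) = n \<and> (\<forall>r<d. J r = I r) \<and> P (n - m) M)" for m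
  have "runs sz (While (IndexLess d (d + 1)) ?body) (I(d := 0), M) (n * (k + 2 + 1) + 1) R"
  proof (rule runs_While_IndexLess[of remaining])
    fix m J M assume "remaining (Suc m) (J, M)"
    then have J: "m < n" "J d = n - Suc m" "J (d + 1) = n" "\<And>r. r < d \<Longrightarrow> J r = I r" "P (n - Suc m) M"
      by (auto simp: remaining_def)
    have "runs sz ?body (J, M) (k + (1 + 1)) (remaining m)"
    proof (intro runs_Seq body[OF _ J(2-5)] runs_IndexConst runs_IndexAdd)
      fix J' M' assume "P (Suc (n - Suc m)) M'" "\<And>r. r < d + 2 \<Longrightarrow> J' r = J r"
      then show "remaining m ((J'(d + 2 := 1))(d := (J'(d + 2 := 1)) d + (J'(d + 2 := 1)) (d + 2)), M')"
        using J by (auto simp: remaining_def Suc_diff_Suc)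
    qed (use J in auto)
    then show "J d < J (d + 1) \<and> runs sz ?body (J, M) (k + 2) (remaining m)" using J by simp
  qed (use start exit in \<open>auto simp: remaining_def\<close>)
  then have "runs sz (counting_loop d c) (I, M) (1 + (n * (k + 2 + 1) + 1)) R"
    unfolding counting_loop_def by (intro runs_Seq runs_IndexConst)
  then show ?thesis by (rule runs_mono) (simp_all add: algebra_simps)
qed

definition correctly_compiled :: "('a::field \<Rightarrow> nat) \<Rightarrow> nat \<Rightarrow> 'a prog \<Rightarrow> bool" where
  "correctly_compiled sz Z h \<longleftrightarrow> (\<forall>d I M B Q R. wp sz Z h d I Q M \<longrightarrow> prog_scoped d h \<longrightarrow>
     (\<forall>r<d. I r \<le> B) \<longrightarrow> (\<forall>J M'. Q M' \<longrightarrow> (\<forall>r<d. J r = I r) \<longrightarrow> R (J, M')) \<longrightarrow>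
     runs sz (prog_compile h d) (I, M) (prog_time h B Z) R)"

lemma correctly_compiledI:
  assumes "\<And>d I M B Q R. wp sz Z h d I Q M \<Longrightarrow> prog_scoped d h \<Longrightarrow> (\<And>r. r < d \<Longrightarrow> I r \<le> B) \<Longrightarrow>
    (\<And>J M'. Q M' \<Longrightarrow> (\<And>r. r < d \<Longrightarrow> J r = I r) \<Longrightarrow> R (J, M')) \<Longrightarrow>
    runs sz (prog_compile h d) (I, M) (prog_time h B Z) R"
  shows "correctly_compiled sz Z h"
  using assms unfolding correctly_compiled_def by blast

lemma correctly_compiledD:
  assumes "correctly_compiled sz Z h" "wp sz Z h d I Q M" "prog_scoped d h" "\<And>r. r < d \<Longrightarrow> I r \<le> B"
    and "\<And>J M'. Q M' \<Longrightarrow> (\<And>r. r < d \<Longrightarrow> J r = I r) \<Longrightarrow> R (J, M')"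
  shows "runs sz (prog_compile h d) (I, M) (prog_time h B Z) R"
  using assms unfolding correctly_compiled_def by blast

lemma correctly_compiled_PSkip: "correctly_compiled sz Z PSkip"
  by (rule correctly_compiledI) (simp add: runs_Skip[simplified])

lemma correctly_compiled_PSeq:
  assumes g: "correctly_compiled sz Z g" and h: "correctly_compiled sz Z h"
  shows "correctly_compiled sz Z (PSeq g h)"
proof (rule correctly_compiledI)
  fix d I M B Q R
  assume wp: "wp sz Z (PSeq g h) d I Q M" and scoped: "prog_scoped d (PSeq g h)"
    and B: "\<And>r. r < d \<Longrightarrow> I r \<le> B" and R: "\<And>J M'. Q M' \<Longrightarrow> (\<And>r. r < d \<Longrightarrow> J r = I r) \<Longrightarrow> R (J, M')"
  show "runs sz (prog_compile (PSeq g h) d) (I, M) (prog_time (PSeq g h) B Z) R"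
    unfolding prog_compile.simps prog_time.simps
  proof (rule runs_Seq, rule correctly_compiledD[OF g])
    show "wp sz Z g d I (wp sz Z h d I Q) M" using wp by simp
    fix J M' assume wp': "wp sz Z h d I Q M'" and J: "\<And>r. r < d \<Longrightarrow> J r = I r"
    have "wp sz Z h d J Q M'" by (rule wp_transfer[OF wp']) (use scoped J in auto)
    then show "runs sz (prog_compile h d) (J, M') (prog_time h B Z) R"
      by (rule correctly_compiledD[OF h]) (use scoped B R J in auto)
  qed (use scoped B in auto)
qed

lemma correctly_compiled_PFor:
  assumes h: "correctly_compiled sz Z h"
  shows "correctly_compiled sz Z (PFor e h)"
proof (rule correctly_compiledI)
  fix d I M B Q R
  assume wp: "wp sz Z (PFor e h) d I Q M" and scoped: "prog_scoped d (PFor e h)"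
    and B: "\<And>r. r < d \<Longrightarrow> I r \<le> B" and R: "\<And>J M'. Q M' \<Longrightarrow> (\<And>r. r < d \<Longrightarrow> J r = I r) \<Longrightarrow> R (J, M')"
  let ?n = "index_val e I" and ?E = "index_bound e B"
  let ?k = "prog_time h (B + ?E) Z"
  define W where "W i = wp sz Z h (d + 2) (I(d := i, d + 1 := ?n))" for i
  have n: "?n \<le> ?E" using scoped B by (intro index_val_le_bound[of d]) auto
  have loop: "runs sz (counting_loop d (prog_compile h (d + 2))) (J, M) (?n * (?k + 3) + 2) R"
    if J: "J (d + 1) = ?n" "\<And>r. r < d + 1 \<Longrightarrow> J r = I r" for J
  proof (rule runs_counting_loop[where P = "\<lambda>i. foldr W [i..<?n] Q"])
    show "foldr W [0..<?n] Q M" using wp by (simp add: W_def[abs_def])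
    show "R (L, M')" if "foldr W [?n..<?n] Q M'" "\<And>r. r < d \<Longrightarrow> L r = J r" for L M'
      using that J by (intro R) auto
    fix i L M' R'
    assume i: "i < ?n" and L: "L d = i" "L (d + 1) = ?n" "\<And>r. r < d \<Longrightarrow> L r = J r" and "foldr W [i..<?n] Q M'"
      and R': "\<And>L' M''. foldr W [Suc i..<?n] Q M'' \<Longrightarrow> (\<And>r. r < d + 2 \<Longrightarrow> L' r = L r) \<Longrightarrow> R' (L', M'')"
    then have "W i (foldr W [Suc i..<?n] Q) M'" by (simp only: upt_conv_Cons foldr.simps o_apply)
    then have "wp sz Z h (d + 2) L (foldr W [Suc i..<?n] Q) M'"
      unfolding W_def[of i] by (rule wp_transfer) (use scoped L J in \<open>auto simp: less_Suc_eq\<close>)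
    then show "runs sz (prog_compile h (d + 2)) (L, M') ?k R'"
      by (rule correctly_compiledD[OF h])
        (use scoped B i n L J R' in \<open>auto simp: less_Suc_eq intro: trans_le_add1\<close>)
  qed (use J in simp)
  show "runs sz (prog_compile (PFor e h) d) (I, M) (prog_time (PFor e h) B Z) R"
    unfolding prog_compile.simps prog_time.simps
  proof (rule runs_Seq, rule runs_index_compile[of d])
    fix J assume "J (d + 1) = ?n" "\<And>r. r < d + 1 \<Longrightarrow> J r = I r"
    from loop[OF this] show "runs sz (counting_loop d (prog_compile h (d + 2))) (J, M) (?E * (?k + 3) + 2) R"
      by (rule runs_mono) (use n in \<open>auto intro: mult_le_mono1\<close>)
  qed (use scoped B in auto)
qed

lemma runs_index_compile2:
  assumes "index_scoped d a" "index_scoped d b" and B: "\<And>r. r < d \<Longrightarrow> I r \<le> B"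
    and c: "\<And>J. J d = index_val a I \<Longrightarrow> J (d + 1) = index_val b I \<Longrightarrow> (\<And>r. r < d \<Longrightarrow> J r = I r) \<Longrightarrow>
      runs sz c (J, M) k R"
  shows "runs sz (Seq (index_compile a d) (Seq (index_compile b (d + 1)) c)) (I, M)
    (index_time a B + (index_time b B + k)) R"
proof (intro runs_Seq runs_index_compile[of d])
  fix J L
  assume J: "J d = index_val a I" "\<And>r. r < d \<Longrightarrow> J r = I r"
    and L: "L (d + 1) = index_val b J" "\<And>r. r < d + 1 \<Longrightarrow> L r = J r"
  have "index_val b J = index_val b I" using assms(2) J by (intro index_val_cong[of d]) auto
  then show "runs sz c (L, M) k R" using J L by (intro c) auto
qed (use assms in auto)

lemma correctly_compiled_PIf:
  assumes h: "correctly_compiled sz Z h"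
  shows "correctly_compiled sz Z (PIf a b h)"
proof (rule correctly_compiledI)
  fix d I M B Q R
  assume wp: "wp sz Z (PIf a b h) d I Q M" and scoped: "prog_scoped d (PIf a b h)"
    and B: "\<And>r. r < d \<Longrightarrow> I r \<le> B" and R: "\<And>J M'. Q M' \<Longrightarrow> (\<And>r. r < d \<Longrightarrow> J r = I r) \<Longrightarrow> R (J, M')"
  show "runs sz (prog_compile (PIf a b h) d) (I, M) (prog_time (PIf a b h) B Z) R"
    unfolding prog_compile.simps prog_time.simps
  proof (intro runs_index_compile2 runs_Cond_IndexLess)
    fix J assume J: "J d = index_val a I" "J (d + 1) = index_val b I" "\<And>r. r < d \<Longrightarrow> J r = I r"
    show "runs sz (prog_compile h d) (J, M) (prog_time h B Z + 1) R" if "J d < J (d + 1)"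
    proof -
      have "wp sz Z h d I Q M" using that wp J by simp
      then have "wp sz Z h d J Q M" by (rule wp_transfer) (use scoped J in auto)
      then have "runs sz (prog_compile h d) (J, M) (prog_time h B Z) R"
        by (rule correctly_compiledD[OF h]) (use scoped B R J in auto)
      then show ?thesis by (rule runs_mono) auto
    qed
    show "runs sz Skip (J, M) (prog_time h B Z + 1) R" if "\<not> J d < J (d + 1)"
      using that wp J R by (intro runs_mono[OF runs_Skip[where Q = R]]) auto
  qed (use scoped B in auto)
qed

lemma correctly_compiled_PConst: "correctly_compiled sz Z (PConst a c)"
proof (rule correctly_compiledI, unfold prog_compile.simps prog_time.simps)
  fix d I M B Q R
  assume "wp sz Z (PConst a c) d I Q M" "prog_scoped d (PConst a c)" "\<And>r. r < d \<Longrightarrow> I r \<le> B"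
    "\<And>J M'. Q M' \<Longrightarrow> (\<And>r. r < d \<Longrightarrow> J r = I r) \<Longrightarrow> R (J, M')"
  then show "runs sz (Seq (index_compile a d) (FieldConst d c)) (I, M) (index_time a B + (1 + Z)) R"
    by (intro runs_Seq runs_index_compile[of d] runs_FieldConst) auto
qed

lemma correctly_compiled_PCopy: "correctly_compiled sz Z (PCopy a b)"
proof (rule correctly_compiledI, unfold prog_compile.simps prog_time.simps)
  fix d I M B Q R
  assume "wp sz Z (PCopy a b) d I Q M" "prog_scoped d (PCopy a b)" "\<And>r. r < d \<Longrightarrow> I r \<le> B"
    "\<And>J M'. Q M' \<Longrightarrow> (\<And>r. r < d \<Longrightarrow> J r = I r) \<Longrightarrow> R (J, M')"
  then show "runs sz (Seq (index_compile a d) (Seq (index_compile b (d + 1)) (FieldCopy d (d + 1)))) (I, M)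
      (index_time a B + (index_time b B + (1 + Z))) R"
    by (intro runs_index_compile2 runs_FieldCopy) auto
qed

lemma correctly_compiled_POp: "correctly_compiled sz Z (POp f a b c)"
proof (rule correctly_compiledI, unfold prog_compile.simps prog_time.simps)
  fix d I M B Q R
  assume wp: "wp sz Z (POp f a b c) d I Q M" and scoped: "prog_scoped d (POp f a b c)"
    and B: "\<And>r. r < d \<Longrightarrow> I r \<le> B" and R: "\<And>J M'. Q M' \<Longrightarrow> (\<And>r. r < d \<Longrightarrow> J r = I r) \<Longrightarrow> R (J, M')"
  show "runs sz (Seq (index_compile a d) (Seq (index_compile b (d + 1)) (Seq (index_compile c (d + 2))
      (FieldOp f d (d + 1) (d + 2))))) (I, M)
    (index_time a B + (index_time b B + (index_time c B + (1 + 3 * Z)))) R"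
  proof (intro runs_index_compile2 runs_Seq runs_index_compile[of d c])
    fix J L assume J: "J d = index_val a I" "J (d + 1) = index_val b I" "\<And>r. r < d \<Longrightarrow> J r = I r"
      and L: "L (d + 2) = index_val c J" "\<And>r. r < d + 2 \<Longrightarrow> L r = J r"
    have "index_val c J = index_val c I" using scoped J by (intro index_val_cong[of d]) auto
    then show "runs sz (FieldOp f d (d + 1) (d + 2)) (L, M) (1 + 3 * Z) R"
      using wp R J L by (intro runs_FieldOp) auto
  qed (use scoped B in auto)
qed

theorem correctly_compiled_prog: "correctly_compiled sz Z h"
  by (induction h) (simp_all add: correctly_compiled_PSkip correctly_compiled_PSeq correctly_compiled_PFor
      correctly_compiled_PIf correctly_compiled_PConst correctly_compiled_PCopy correctly_compiled_POp)

section \<open>Polynomial bounds\<close>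

definition poly_bounded :: "(nat \<Rightarrow> nat) \<Rightarrow> bool" where
  "poly_bounded f \<longleftrightarrow> (\<exists>p :: nat poly. \<forall>x. f x \<le> poly p x)"

lemma poly_nat_mono: "x \<le> y \<Longrightarrow> poly (p :: nat poly) x \<le> poly p y"
  by (induction p) (auto intro: add_mono mult_mono)

lemma poly_bounded_const: "poly_bounded (\<lambda>_. c)"
  unfolding poly_bounded_def by (rule exI[of _ "[:c:]"]) simp

lemma poly_bounded_id: "poly_bounded (\<lambda>x. x)"
  unfolding poly_bounded_def by (rule exI[of _ "[:0, 1:]"]) simp

lemma poly_bounded_add: "poly_bounded f \<Longrightarrow> poly_bounded g \<Longrightarrow> poly_bounded (\<lambda>x. f x + g x)"
  unfolding poly_bounded_def by (metis poly_add add_mono)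

lemma poly_bounded_mult: "poly_bounded f \<Longrightarrow> poly_bounded g \<Longrightarrow> poly_bounded (\<lambda>x. f x * g x)"
  unfolding poly_bounded_def by (metis poly_mult mult_le_mono)

lemma poly_bounded_poly:
  assumes "poly_bounded f"
  shows "poly_bounded (\<lambda>x. poly p (f x))"
proof -
  obtain q where "\<And>x. f x \<le> poly q x" using assms unfolding poly_bounded_def by blast
  then have "poly p (f x) \<le> poly (pcompose p q) x" for x by (simp add: poly_pcompose poly_nat_mono)
  then show ?thesis unfolding poly_bounded_def by blast
qed

lemmas poly_bounded_intros =
  poly_bounded_const poly_bounded_id poly_bounded_add poly_bounded_mult poly_bounded_poly

lemma poly_bounded_index_bound: "poly_bounded \<beta> \<Longrightarrow> poly_bounded (\<lambda>x. index_bound e (\<beta> x))"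
proof (induction e)
  case (IBinary f a b)
  then show ?case by (cases f) (simp_all add: poly_bounded_intros)
qed (simp_all add: poly_bounded_intros)

lemma poly_bounded_index_time: "poly_bounded \<beta> \<Longrightarrow> poly_bounded (\<lambda>x. index_time e (\<beta> x))"
proof (induction e)
  case (IBinary f a b)
  then have "poly_bounded (\<lambda>x. index_op_time f (index_bound b (\<beta> x)))"
    by (cases f) (simp_all only: index_op_time.simps poly_bounded_intros poly_bounded_index_bound)
  then show ?case unfolding index_time.simps by (intro poly_bounded_add IBinary)
qed (simp_all only: index_time.simps poly_bounded_const)

lemma poly_bounded_prog_time:
  assumes "poly_bounded \<zeta>"
  shows "poly_bounded \<beta> \<Longrightarrow> poly_bounded (\<lambda>x. prog_time h (\<beta> x) (\<zeta> x))"
proof (induction h arbitrary: \<beta>)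
  case (PFor e h)
  have "poly_bounded (\<lambda>x. prog_time h (\<beta> x + index_bound e (\<beta> x)) (\<zeta> x))"
    by (intro PFor.IH poly_bounded_add poly_bounded_index_bound PFor.prems)
  then show ?case
    unfolding prog_time.simps
    by (intro poly_bounded_add poly_bounded_mult poly_bounded_const poly_bounded_index_time
        poly_bounded_index_bound PFor.prems)
qed (simp_all only: prog_time.simps poly_bounded_add poly_bounded_mult poly_bounded_const
    poly_bounded_index_time assms)

section \<open>Accumulating guarded terms\<close>

type_synonym guard = "(index_exp \<times> index_exp) list"

definition holds :: "guard \<Rightarrow> (nat \<Rightarrow> nat) \<Rightarrow> bool" where
  "holds g I \<longleftrightarrow> (\<forall>(a, b)\<in>set g. index_val a I < index_val b I)"

definition guard_scoped :: "nat \<Rightarrow> guard \<Rightarrow> bool" where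
  "guard_scoped d g \<longleftrightarrow> (\<forall>(a, b)\<in>set g. index_scoped d a \<and> index_scoped d b)"

definition less_guard :: "index_exp \<Rightarrow> index_exp \<Rightarrow> guard" where
  "less_guard a b = [(a, b)]"

definition le_guard :: "index_exp \<Rightarrow> index_exp \<Rightarrow> guard" where
  "le_guard a b = [(a, IPlus b (IConst 1))]"

definition eq_guard :: "index_exp \<Rightarrow> index_exp \<Rightarrow> guard" where
  "eq_guard a b = le_guard a b @ le_guard b a"

lemma holds_simps[simp]:
  "holds (g @ h) I \<longleftrightarrow> holds g I \<and> holds h I"
  "holds (less_guard a b) I \<longleftrightarrow> index_val a I < index_val b I"
  "holds (le_guard a b) I \<longleftrightarrow> index_val a I \<le> index_val b I"
  "holds (eq_guard a b) I \<longleftrightarrow> index_val a I = index_val b I"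
  by (auto simp: holds_def le_guard_def less_guard_def eq_guard_def)

lemma guard_scoped_simps[simp]:
  "guard_scoped d (g @ h) \<longleftrightarrow> guard_scoped d g \<and> guard_scoped d h"
  "guard_scoped d (less_guard a b) \<longleftrightarrow> index_scoped d a \<and> index_scoped d b"
  "guard_scoped d (le_guard a b) \<longleftrightarrow> index_scoped d a \<and> index_scoped d b"
  "guard_scoped d (eq_guard a b) \<longleftrightarrow> index_scoped d a \<and> index_scoped d b"
  by (auto simp: guard_scoped_def le_guard_def less_guard_def eq_guard_def)

primrec guarded :: "guard \<Rightarrow> 'a prog \<Rightarrow> 'a prog" where
  "guarded [] h = h"
| "guarded (ab # g) h = PIf (fst ab) (snd ab) (guarded g h)"

lemma wp_guarded: "wp sz Z (guarded g h) d I Q M \<longleftrightarrow> (if holds g I then wp sz Z h d I Q M else Q M)"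
  by (induction g) (auto simp: holds_def)

lemma prog_scoped_guarded: "prog_scoped d (guarded g h) \<longleftrightarrow> guard_scoped d g \<and> prog_scoped d h"
  by (induction g) (auto simp: guard_scoped_def)

primrec accumulate :: "index_exp \<Rightarrow> (guard \<times> index_exp) list \<Rightarrow> 'a prog" where
  "accumulate acc [] = PSkip"
| "accumulate acc (t # ts) = PSeq (guarded (fst t) (POp FPlus acc acc (snd t))) (accumulate acc ts)"

definition term_val :: "(nat \<Rightarrow> nat) \<Rightarrow> (nat \<Rightarrow> 'a) \<Rightarrow> guard \<times> index_exp \<Rightarrow> 'a::zero" where
  "term_val I M t = (if holds (fst t) I then M (index_val (snd t) I) else 0)"

lemma prog_scoped_accumulate:
  "index_scoped d acc \<Longrightarrow> (\<And>t. t \<in> set ts \<Longrightarrow> guard_scoped d (fst t) \<and> index_scoped d (snd t)) \<Longrightarrow>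
    prog_scoped d (accumulate acc ts)"
  by (induction ts) (auto simp: prog_scoped_guarded)

primrec size_bound :: "nat poly \<Rightarrow> nat \<Rightarrow> nat \<Rightarrow> nat" where
  "size_bound p 0 X = X"
| "size_bound p (Suc k) X = size_bound p k X + poly p (size_bound p k X + size_bound p k X)"

lemma size_bound_mono: "k \<le> l \<Longrightarrow> size_bound p k X \<le> size_bound p l X"
  by (induction rule: dec_induct) auto

lemma poly_bounded_size_bound: "poly_bounded \<beta> \<Longrightarrow> poly_bounded (\<lambda>x. size_bound p k (\<beta> x))"
  by (induction k) (simp_all add: poly_bounded_intros)

lemma size_eval_op_le_size_bound:
  assumes "\<And>f x y. sz (eval_op f x y) \<le> poly p (sz x + sz y)"
    and "sz x \<le> size_bound p k X" "sz y \<le> size_bound p k X"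
  shows "sz (eval_op f x y) \<le> size_bound p (Suc k) X"
proof -
  have "sz (eval_op f x y) \<le> poly p (sz x + sz y)" by (rule assms(1))
  also have "\<dots> \<le> poly p (size_bound p k X + size_bound p k X)" using assms by (intro poly_nat_mono add_mono)
  finally show ?thesis by simp
qed

lemma wp_accumulate:
  fixes sz :: "'a::field \<Rightarrow> nat"
  assumes adm: "\<And>f x y. sz (eval_op f x y) \<le> poly p (sz x + sz y)"
    and "\<And>t. t \<in> set ts \<Longrightarrow> holds (fst t) I \<Longrightarrow>
      index_val (snd t) I \<noteq> index_val acc I \<and> sz (M (index_val (snd t) I)) \<le> X"
    and "sz (M (index_val acc I)) \<le> size_bound p k X" "size_bound p (k + length ts) X \<le> Z"
    and "\<And>v. v = M (index_val acc I) + (\<Sum>t\<leftarrow>ts. term_val I M t) \<Longrightarrow>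
      sz v \<le> size_bound p (k + length ts) X \<Longrightarrow> Q (M(index_val acc I := v))"
  shows "wp sz Z (accumulate acc ts) d I Q M"
  using assms(2-)
proof (induction ts arbitrary: k M)
  case Nil
  then show ?case by simp
next
  case (Cons t ts)
  let ?a = "index_val acc I"
  define M' where "M' = M(?a := M ?a + term_val I M t)"
  have X: "X \<le> size_bound p k X" using size_bound_mono[of 0 k p X] by simp
  have kZ: "size_bound p k X \<le> Z" "size_bound p (Suc k) X \<le> Z"
    by (rule le_trans[OF size_bound_mono Cons.prems(3)], simp)+
  have size_sum: "sz (M ?a + M (index_val (snd t) I)) \<le> size_bound p (Suc k) X" if "holds (fst t) I"
    using Cons.prems(1)[of t] Cons.prems(2) X that
      size_eval_op_le_size_bound[OF adm, of "M ?a" k X "M (index_val (snd t) I)" FPlus] by auto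
  have size_M': "sz (M' ?a) \<le> size_bound p (Suc k) X"
    using size_sum Cons.prems(2) by (simp add: M'_def term_val_def)
  have M'_eq: "M' (index_val (snd u) I) = M (index_val (snd u) I)" if "u \<in> set ts" "holds (fst u) I" for u
    using Cons.prems(1)[of u] that by (simp add: M'_def)
  have "wp sz Z (accumulate acc ts) d I Q M'"
  proof (rule Cons.IH[where k = "Suc k" and M = M', OF _ size_M'])
    show "index_val (snd u) I \<noteq> ?a \<and> sz (M' (index_val (snd u) I)) \<le> X" if "u \<in> set ts" "holds (fst u) I" for u
      using Cons.prems(1)[of u] M'_eq that by auto
    fix v assume v: "v = M' ?a + (\<Sum>t\<leftarrow>ts. term_val I M' t)" "sz v \<le> size_bound p (Suc k + length ts) X"
    have "(\<Sum>t\<leftarrow>ts. term_val I M' t) = (\<Sum>t\<leftarrow>ts. term_val I M t)"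
      by (intro arg_cong[of _ _ sum_list] map_cong) (auto simp: term_val_def M'_eq)
    then have "Q (M(?a := v))" using v by (intro Cons.prems(4)) (simp_all add: M'_def add.assoc)
    then show "Q (M'(?a := v))" by (simp only: M'_def fun_upd_upd)
  qed (use Cons.prems(3) in simp)
  then show ?case
    using Cons.prems(1)[of t] Cons.prems(2) kZ X size_sum
    by (cases "holds (fst t) I") (auto simp: wp_guarded M'_def term_val_def)
qed

section \<open>The reduction as a program\<close>

text \<open>
  Register 0 holds the length of the input and register 1 the dimension \<open>n\<close>. The input is first copied
  behind the \<open>out_size n\<close> cells of the output and is followed there by the constants \<open>1\<close> and \<open>\<epsilon>\<close>. The loop
  counters 2, 4, 6, 8 are the number of the form (0 or 1) and the index triple of the entry being computed;
  the entry is accumulated in its output cell.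
\<close>

definition width_exp :: index_exp where "width_exp = IPlus (IReg 1) (IConst 1)"
definition base_dim_exp :: index_exp where "base_dim_exp = ITimes (IConst 7) width_exp"
definition stride_exp :: index_exp where "stride_exp = IPlus base_dim_exp (IConst 8)"
definition p_start_exp :: "nat \<Rightarrow> index_exp" where
  "p_start_exp i = IPlus base_dim_exp (ITimes (IConst i) stride_exp)"
definition out_dim_exp :: index_exp where
  "out_dim_exp = IPlus (p_start_exp 7) (ITimes base_dim_exp stride_exp)"
definition out_size_exp :: index_exp where
  "out_size_exp = ITimes (ITimes (ITimes (IConst 2) out_dim_exp) out_dim_exp) out_dim_exp"
definition one_cell :: index_exp where "one_cell = IPlus out_size_exp (IReg 0)"
definition eps_cell :: index_exp where "eps_cell = IPlus one_cell (IConst 1)"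
definition out_cell :: index_exp where
  "out_cell = IPlus (ITimes (IPlus (ITimes (IPlus (ITimes (IReg 2) out_dim_exp) (IReg 4)) out_dim_exp)
     (IReg 6)) out_dim_exp) (IReg 8)"

definition out_size :: "nat \<Rightarrow> nat" where "out_size n = 2 * out_dim n ^ 3"

lemma index_val_layout:
  "index_val width_exp I = width (I 1)" "index_val base_dim_exp I = base_dim (I 1)"
  "index_val stride_exp I = blocks.stride (I 1)" "index_val (p_start_exp i) I = blocks.p_index (I 1) i 0"
  "index_val out_dim_exp I = out_dim (I 1)" "index_val out_size_exp I = out_size (I 1)"
  "index_val one_cell I = out_size (I 1) + I 0" "index_val eps_cell I = out_size (I 1) + I 0 + 1"
  "index_val out_cell I = ((I 2 * out_dim (I 1) + I 4) * out_dim (I 1) + I 6) * out_dim (I 1) + I 8"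
proof -
  show width: "index_val width_exp I = width (I 1)" by (simp add: width_exp_def width_def)
  show base_dim: "index_val base_dim_exp I = base_dim (I 1)" by (simp add: base_dim_exp_def base_dim_def width)
  show stride: "index_val stride_exp I = blocks.stride (I 1)"
    by (simp add: stride_exp_def blocks.stride_def base_dim)
  show p_start: "index_val (p_start_exp i) I = blocks.p_index (I 1) i 0" for i
    by (simp add: p_start_exp_def blocks.p_index_def base_dim stride)
  show out_dim: "index_val out_dim_exp I = out_dim (I 1)"
    by (simp add: out_dim_exp_def blocks.total_dim_def blocks.p_index_def base_dim stride p_start)
  show out_size: "index_val out_size_exp I = out_size (I 1)"
    by (simp add: out_size_exp_def out_size_def power3_eq_cube out_dim)
  show one_cell: "index_val one_cell I = out_size (I 1) + I 0" by (simp add: one_cell_def out_size)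
  show "index_val eps_cell I = out_size (I 1) + I 0 + 1" by (simp add: eps_cell_def one_cell)
  show "index_val out_cell I = ((I 2 * out_dim (I 1) + I 4) * out_dim (I 1) + I 6) * out_dim (I 1) + I 8"
    by (simp add: out_cell_def out_dim)
qed

lemma index_scoped_layout[simp]:
  assumes "1 < d"
  shows "index_scoped d width_exp" "index_scoped d base_dim_exp" "index_scoped d stride_exp"
    "index_scoped d (p_start_exp i)" "index_scoped d out_dim_exp" "index_scoped d out_size_exp"
    "index_scoped d one_cell" "index_scoped d eps_cell"
  using assms by (simp_all add: width_exp_def base_dim_exp_def stride_exp_def p_start_exp_def out_dim_exp_def
      out_size_exp_def one_cell_def eps_cell_def)

definition copy_guard :: "index_exp \<Rightarrow> index_exp \<Rightarrow> index_exp \<Rightarrow> guard" where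
  "copy_guard x y z = less_guard x (IReg 1)
     @ le_guard width_exp y @ less_guard y (IPlus width_exp (IReg 1))
     @ le_guard (ITimes (IConst 2) width_exp) z @ less_guard z (IPlus (ITimes (IConst 2) width_exp) (IReg 1))"

definition copy_source :: "index_exp \<Rightarrow> index_exp \<Rightarrow> index_exp \<Rightarrow> index_exp" where
  "copy_source x y z = IPlus out_size_exp (IPlus (ITimes (IReg 2) (ITimes (ITimes (IReg 1) (IReg 1)) (IReg 1)))
     (IPlus (ITimes (IPlus (ITimes x (IReg 1)) (IMinus y width_exp)) (IReg 1))
       (IMinus z (ITimes (IConst 2) width_exp))))"

definition dual_guard :: "index_exp \<Rightarrow> index_exp \<Rightarrow> index_exp \<Rightarrow> nat \<Rightarrow> guard" where
  "dual_guard x y z i =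
     le_guard (ITimes (IConst i) width_exp) x @ less_guard x (IPlus (ITimes (IConst i) width_exp) (IReg 1))
     @ eq_guard y (IPlus x (ITimes (IConst (3 - i)) width_exp)) @ eq_guard z (ITimes (IConst (4 + i)) width_exp)"

definition scalar_guard :: "index_exp \<Rightarrow> index_exp \<Rightarrow> index_exp \<Rightarrow> guard" where
  "scalar_guard x y z = eq_guard x (ITimes (IConst 4) width_exp) @ eq_guard y (ITimes (IConst 5) width_exp)
     @ eq_guard z (ITimes (IConst 6) width_exp)"

definition gadget_guard :: "index_exp \<Rightarrow> index_exp \<Rightarrow> index_exp \<Rightarrow> nat \<Rightarrow> guard" where
  "gadget_guard x y z i =
     le_guard (ITimes (IConst i) width_exp) x @ less_guard x (IPlus (ITimes (IConst i) width_exp) width_exp)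
     @ le_guard (p_start_exp i) z @ less_guard z (IPlus (p_start_exp i) (IPlus base_dim_exp (IConst (1 + i))))
     @ eq_guard y (IPlus (IPlus (p_start_exp 7) (ITimes x stride_exp)) (IMinus z (p_start_exp i)))"

definition entry_terms :: "index_exp \<Rightarrow> index_exp \<Rightarrow> index_exp \<Rightarrow> (guard \<times> index_exp) list" where
  "entry_terms x y z = (copy_guard x y z, copy_source x y z)
     # map (\<lambda>i. (dual_guard x y z i, one_cell)) [0..<3]
     @ (scalar_guard x y z, one_cell) # map (\<lambda>i. (gadget_guard x y z i, one_cell)) [0..<7]"

definition cyclic_terms :: "index_exp \<Rightarrow> index_exp \<Rightarrow> index_exp \<Rightarrow> (guard \<times> index_exp) list" where
  "cyclic_terms x y z = entry_terms x y z @ entry_terms y z x @ entry_terms z x y"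

lemma length_cyclic_terms: "length (cyclic_terms x y z) = 36"
  by (simp add: cyclic_terms_def entry_terms_def)

lemma cyclic_terms_scoped:
  assumes "2 < d" "index_scoped d x" "index_scoped d y" "index_scoped d z" "t \<in> set (cyclic_terms x y z)"
  shows "guard_scoped d (fst t) \<and> index_scoped d (snd t)"
  using assms
  by (auto simp: cyclic_terms_def entry_terms_def copy_guard_def copy_source_def dual_guard_def scalar_guard_def
      gadget_guard_def)

lemma holds_entry_guards:
  "holds (copy_guard x y z) I \<longleftrightarrow> index_val x I < I 1 \<and> width (I 1) \<le> index_val y I \<and>
    index_val y I < width (I 1) + I 1 \<and> 2 * width (I 1) \<le> index_val z I \<and> index_val z I < 2 * width (I 1) + I 1"
  "holds (dual_guard x y z i) I \<longleftrightarrow> i * width (I 1) \<le> index_val x I \<and> index_val x I < i * width (I 1) + I 1 \<and>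
    index_val y I = index_val x I + (3 - i) * width (I 1) \<and> index_val z I = (4 + i) * width (I 1)"
  "holds (scalar_guard x y z) I \<longleftrightarrow>
    index_val x I = 4 * width (I 1) \<and> index_val y I = 5 * width (I 1) \<and> index_val z I = 6 * width (I 1)"
  "holds (gadget_guard x y z i) I \<longleftrightarrow> i * width (I 1) \<le> index_val x I \<and>
    index_val x I < i * width (I 1) + width (I 1) \<and> blocks.p_index (I 1) i 0 \<le> index_val z I \<and>
    index_val z I < blocks.p_index (I 1) i (blocks.weight (I 1) i) \<and>
    index_val y I = blocks.q_index (I 1) (index_val x I) (index_val z I - blocks.p_index (I 1) i 0)"
  by (simp_all add: copy_guard_def dual_guard_def scalar_guard_def gadget_guard_def index_val_layout
      blocks.p_index_def blocks.q_index_def blocks.weight_def add.assoc)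

lemma index_val_copy_source:
  "index_val (copy_source x y z) I = out_size (I 1) + (I 2 * I 1 ^ 3
     + ((index_val x I * I 1 + (index_val y I - width (I 1))) * I 1 + (index_val z I - 2 * width (I 1))))"
  by (simp add: copy_source_def index_val_layout power3_eq_cube)

lemma sum_entry_terms:
  assumes n: "I 1 = n" and one: "M (out_size n + I 0) = 1"
    and source: "\<And>a b c. a < n \<Longrightarrow> b < n \<Longrightarrow> c < n \<Longrightarrow>
      M (out_size n + (I 2 * n ^ 3 + ((a * n + b) * n + c))) = \<phi> (unit_vec n a) (unit_vec n b) (unit_vec n c)"
  shows "(\<Sum>t\<leftarrow>entry_terms x y z. term_val I M t) = form_entry n \<phi> (index_val x I) (index_val y I) (index_val z I)"
proof -
  let ?x = "index_val x I" and ?y = "index_val y I" and ?z = "index_val z I"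
  have sum_upt: "(\<Sum>i\<leftarrow>[0..<k]. h i) = (\<Sum>i<k. h i)" for h :: "nat \<Rightarrow> 'a" and k
    by (simp add: interv_sum_list_conv_sum_set_nat atLeast0LessThan)
  have copy: "term_val I M (copy_guard x y z, copy_source x y z) =
      (if ?x < n \<and> width n \<le> ?y \<and> ?y < width n + n \<and> 2 * width n \<le> ?z \<and> ?z < 2 * width n + n
       then \<phi> (unit_vec n ?x) (unit_vec n (?y - width n)) (unit_vec n (?z - 2 * width n)) else 0)"
    unfolding term_val_def fst_conv snd_conv holds_entry_guards index_val_copy_source n
    using source[of ?x "?y - width n" "?z - 2 * width n"] by auto
  have "(\<Sum>t\<leftarrow>entry_terms x y z. term_val I M t) = term_val I M (copy_guard x y z, copy_source x y z)
      + (\<Sum>i<3. term_val I M (dual_guard x y z i, one_cell)) + term_val I M (scalar_guard x y z, one_cell)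
      + (\<Sum>i<7. term_val I M (gadget_guard x y z i, one_cell))"
    unfolding sum_upt[symmetric] by (simp add: entry_terms_def comp_def add.assoc del: upt_rec_numeral)
  then show ?thesis
    unfolding form_entry_def copy
    by (simp only: term_val_def fst_conv snd_conv holds_entry_guards index_val_layout n one)
qed

definition entry_prog :: "'a::field prog" where
  "entry_prog = PSeq (PConst out_cell 0) (PSeq (accumulate out_cell (cyclic_terms (IReg 6) (IReg 4) (IReg 8)))
     (PSeq (POp FTimes out_cell eps_cell out_cell)
       (accumulate out_cell (cyclic_terms (IReg 4) (IReg 6) (IReg 8)))))"

definition main_prog :: "'a::field \<Rightarrow> 'a prog" where
  "main_prog \<epsilon> = PSeq (PFor (IReg 0) (PCopy (IPlus out_size_exp (IReg 2)) (IReg 2)))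
     (PSeq (PConst one_cell 1) (PSeq (PConst eps_cell \<epsilon>)
       (PFor (IConst 2) (PFor out_dim_exp (PFor out_dim_exp (PFor out_dim_exp entry_prog))))))"

lemma prog_scoped_main_prog: "prog_scoped 2 (main_prog (\<epsilon> :: 'a::field))"
proof -
  have "index_scoped 10 out_cell" by (simp add: out_cell_def)
  moreover from this have "prog_scoped 10 (accumulate out_cell (cyclic_terms x y z) :: 'a prog)"
    if "index_scoped 10 x" "index_scoped 10 y" "index_scoped 10 z" for x y z
    using that by (intro prog_scoped_accumulate cyclic_terms_scoped) simp_all
  ultimately show ?thesis by (simp add: main_prog_def entry_prog_def)
qed

text \<open>An entry takes 73 field operations: 36 additions, a multiplication by \<open>\<epsilon>\<close>, and 36 additions.\<close>

locale reduction_program =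
  fixes sz :: "'a::field \<Rightarrow> nat" and p :: "nat poly" and \<epsilon> :: 'a and n :: nat and \<phi> \<psi> :: "'a form3"
    and X Z :: nat
  assumes adm: "\<And>f x y. sz (eval_op f x y) \<le> poly p (sz x + sz y)"
    and \<phi>: "trilinear_form n \<phi>" and \<psi>: "trilinear_form n \<psi>"
    and X: "sz 0 \<le> X" "sz 1 \<le> X" "sz \<epsilon> \<le> X" "\<And>x. x \<in> set (form_array n \<phi> @ form_array n \<psi>) \<Longrightarrow> sz x \<le> X"
    and Z: "size_bound p 73 X \<le> Z"
begin

definition in_form :: "nat \<Rightarrow> 'a form3" where "in_form f = (if f = 0 then \<phi> else \<psi>)"
definition in_word :: "'a list" where "in_word = form_array n \<phi> @ form_array n \<psi>"
definition out_word :: "'a list" where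
  "out_word = form_array (out_dim n) (out_form n \<epsilon> \<phi>) @ form_array (out_dim n) (out_form n \<epsilon> \<psi>)"

lemma length_in_word: "length in_word = 2 * n ^ 3"
  by (simp add: in_word_def length_form_array)

lemma length_out_word: "length out_word = out_size n"
  by (simp add: out_word_def length_form_array out_size_def)

lemma size_bound_le_Z: "k \<le> 73 \<Longrightarrow> size_bound p k X \<le> Z"
  using size_bound_mono[of k 73 p X] Z by linarith

lemma X_le_size_bound: "X \<le> size_bound p k X"
  using size_bound_mono[of 0 k p X] by simp

lemma X_le_Z: "X \<le> Z"
  using X_le_size_bound[of 73] Z by linarith

lemma in_word_nth:
  assumes "f < 2" "a < n" "b < n" "c < n"
  shows "f * n ^ 3 + ((a * n + b) * n + c) < length in_word"
    and "in_word ! (f * n ^ 3 + ((a * n + b) * n + c)) = in_form f (unit_vec n a) (unit_vec n b) (unit_vec n c)"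
  unfolding length_in_word by (rule nth_form_array_append(1)[OF assms])
    (unfold in_word_def in_form_def, rule nth_form_array_append(2)[OF assms])

lemma out_word_nth:
  assumes "f < 2" "x < out_dim n" "y < out_dim n" "z < out_dim n"
  defines "j \<equiv> ((f * out_dim n + x) * out_dim n + y) * out_dim n + z"
  shows "j < out_size n"
    and "out_word ! j = cyclic_sum (form_entry n (in_form f)) x y z + \<epsilon> * cyclic_sum (form_entry n (in_form f)) y x z"
proof -
  have j: "j = f * out_dim n ^ 3 + ((x * out_dim n + y) * out_dim n + z)"
    by (simp add: j_def power3_eq_cube algebra_simps)
  show "j < out_size n" unfolding j out_size_def by (rule nth_form_array_append(1)[OF assms(1-4)])
  have "trilinear_form n (in_form f)" using \<phi> \<psi> by (simp add: in_form_def)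
  from out_form_unit[OF this assms(2-4)]
  show "out_word ! j = cyclic_sum (form_entry n (in_form f)) x y z + \<epsilon> * cyclic_sum (form_entry n (in_form f)) y x z"
    unfolding out_word_def j nth_form_array_append(2)[OF assms(1-4)] in_form_def by (cases "f = 0") simp_all
qed

definition input_intact :: "(nat \<Rightarrow> 'a) \<Rightarrow> bool" where
  "input_intact M \<longleftrightarrow> (\<forall>j<length in_word. M (out_size n + j) = in_word ! j) \<and>
     M (out_size n + length in_word) = 1 \<and> M (out_size n + length in_word + 1) = \<epsilon>"

definition progress :: "nat \<Rightarrow> (nat \<Rightarrow> 'a) \<Rightarrow> bool" where
  "progress k M \<longleftrightarrow> (\<forall>j<k. M j = out_word ! j \<and> sz (out_word ! j) \<le> Z) \<and> input_intact M"

lemma input_intact_upd: "c < out_size n \<Longrightarrow> input_intact (M(c := v)) \<longleftrightarrow> input_intact M"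
  by (simp add: input_intact_def)

lemma size_in_word: "j < length in_word \<Longrightarrow> sz (in_word ! j) \<le> X"
  using X(4)[of "in_word ! j"] nth_mem[of j in_word] by (simp only: in_word_def)

lemma entry_terms_source:
  assumes I: "I 0 = length in_word" "I 1 = n" "I 2 < 2" and M: "input_intact M"
    and t: "t \<in> set (entry_terms x y z)" "holds (fst t) I"
  shows "out_size n \<le> index_val (snd t) I" "sz (M (index_val (snd t) I)) \<le> X"
proof -
  have "\<exists>j\<le>length in_word. index_val (snd t) I = out_size n + j"
  proof (cases "t = (copy_guard x y z, copy_source x y z)")
    case True
    then have "holds (copy_guard x y z) I" using t(2) by simp
    then have "index_val x I < n" "index_val y I - width n < n" "index_val z I - 2 * width n < n"
      unfolding holds_entry_guards I(2) by linarith+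
    from in_word_nth(1)[OF I(3) this] show ?thesis
      unfolding True snd_conv index_val_copy_source I(2) using less_imp_le by blast
  next
    case False
    then have "snd t = one_cell" using t(1) by (auto simp: entry_terms_def)
    then show ?thesis using I by (simp add: index_val_layout)
  qed
  then obtain j where j: "j \<le> length in_word" "index_val (snd t) I = out_size n + j" by blast
  then show "out_size n \<le> index_val (snd t) I" by simp
  show "sz (M (index_val (snd t) I)) \<le> X"
    using j M X(2) size_in_word by (cases "j = length in_word") (auto simp: input_intact_def)
qed

lemma sum_cyclic_terms:
  assumes I: "I 0 = length in_word" "I 1 = n" "I 2 < 2" and M: "input_intact M"
  shows "(\<Sum>t\<leftarrow>cyclic_terms x y z. term_val I M t) =
    cyclic_sum (form_entry n (in_form (I 2))) (index_val x I) (index_val y I) (index_val z I)"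
proof -
  have one: "M (out_size n + I 0) = 1" using M I by (simp add: input_intact_def)
  have "M (out_size n + (I 2 * n ^ 3 + ((a * n + b) * n + c))) =
      in_form (I 2) (unit_vec n a) (unit_vec n b) (unit_vec n c)"
    if "a < n" "b < n" "c < n" for a b c
    using in_word_nth[OF I(3) that] M by (simp add: input_intact_def)
  from sum_entry_terms[of I n M "in_form (I 2)", OF I(2) one this] show ?thesis
    by (simp add: cyclic_terms_def cyclic_sum_def add.assoc)
qed

lemma wp_accumulate_cyclic_terms:
  assumes I: "I 0 = length in_word" "I 1 = n" "I 2 < 2" and M: "input_intact M"
    and c: "c = index_val out_cell I" "c < out_size n" and k: "sz (M c) \<le> size_bound p k X" "k + 36 \<le> 73"
    and Q: "\<And>v. v = M c + cyclic_sum (form_entry n (in_form (I 2))) (index_val x I) (index_val y I) (index_val z I) \<Longrightarrow>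
      sz v \<le> size_bound p (k + 36) X \<Longrightarrow> Q (M(c := v))"
  shows "wp sz Z (accumulate out_cell (cyclic_terms x y z)) d I Q M"
proof (rule wp_accumulate[OF adm])
  fix t assume "t \<in> set (cyclic_terms x y z)" "holds (fst t) I"
  then obtain x' y' z' where "t \<in> set (entry_terms x' y' z')" by (auto simp: cyclic_terms_def)
  from entry_terms_source[OF I M this \<open>holds (fst t) I\<close>]
  show "index_val (snd t) I \<noteq> index_val out_cell I \<and> sz (M (index_val (snd t) I)) \<le> X"
    using c by simp
qed (use k Q c size_bound_le_Z[OF k(2)] in \<open>simp_all add: length_cyclic_terms sum_cyclic_terms[OF I M]\<close>)

lemma wp_entry_prog:
  assumes I: "I 0 = length in_word" "I 1 = n" "I 2 < 2" "I 4 < out_dim n" "I 6 < out_dim n" "I 8 < out_dim n"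
    and progress: "progress (index_val out_cell I) M"
  shows "wp sz Z entry_prog d I (progress (Suc (index_val out_cell I))) M"
proof -
  define c where "c = index_val out_cell I"
  let ?sum = "cyclic_sum (form_entry n (in_form (I 2)))"
  have c: "c < out_size n" "out_word ! c = ?sum (I 4) (I 6) (I 8) + \<epsilon> * ?sum (I 6) (I 4) (I 8)"
    using out_word_nth[OF I(3-6)] by (simp_all only: c_def index_val_layout I(2))
  have intact: "input_intact (M(c := v))" for v
    using progress c(1) by (simp add: progress_def input_intact_upd)
  have eps: "M (index_val eps_cell I) = \<epsilon>" "index_val eps_cell I \<noteq> c"
    using progress c(1) I by (simp_all add: progress_def input_intact_def index_val_layout)
  have finish: "progress (Suc c) (M(c := v))"
    if "v = ?sum (I 4) (I 6) (I 8) + \<epsilon> * ?sum (I 6) (I 4) (I 8)" "sz v \<le> Z" for v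
    using that progress c intact[of v] by (auto simp: progress_def c_def less_Suc_eq)
  have scale: "wp sz Z (PSeq (POp FTimes out_cell eps_cell out_cell)
      (accumulate out_cell (cyclic_terms (IReg 4) (IReg 6) (IReg 8)))) d I (progress (Suc c)) (M(c := v))"
    if v: "v = ?sum (I 6) (I 4) (I 8)" "sz v \<le> size_bound p 36 X" for v
  proof -
    have "sz \<epsilon> \<le> size_bound p 36 X" using X(3) X_le_size_bound[of 36] by linarith
    then have "sz (eval_op FTimes \<epsilon> v) \<le> size_bound p (Suc 36) X"
      by (rule size_eval_op_le_size_bound[OF adm _ v(2)])
    then have size: "sz (\<epsilon> * v) \<le> size_bound p 37 X" by simp
    then have "wp sz Z (accumulate out_cell (cyclic_terms (IReg 4) (IReg 6) (IReg 8))) d I (progress (Suc c))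
        (M(c := \<epsilon> * v))"
      using size_bound_le_Z[of 73]
      by (intro wp_accumulate_cyclic_terms[OF I(1-3) intact c_def c(1), where k = 37])
        (auto simp: v(1) add.commute intro!: finish)
    moreover have "sz v \<le> Z" "sz (\<epsilon> * v) \<le> Z" "sz \<epsilon> \<le> Z"
      using v(2) size X(3) X_le_Z size_bound_le_Z[of 36] size_bound_le_Z[of 37] by linarith+
    ultimately show ?thesis using eps by (simp add: c_def[symmetric])
  qed
  have "wp sz Z (accumulate out_cell (cyclic_terms (IReg 6) (IReg 4) (IReg 8))) d I
      (wp sz Z (PSeq (POp FTimes out_cell eps_cell out_cell)
        (accumulate out_cell (cyclic_terms (IReg 4) (IReg 6) (IReg 8)))) d I (progress (Suc c))) (M(c := 0))"
    using X(1) by (intro wp_accumulate_cyclic_terms[OF I(1-3) intact c_def c(1), where k = 0])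
      (auto simp del: wp.simps intro!: scale)
  then show ?thesis using X(1) X_le_Z by (simp add: entry_prog_def c_def)
qed

lemma wp_row_loop:
  assumes J: "J 0 = length in_word" "J 1 = n" "J 2 < 2" "J 4 < out_dim n" "J 6 < out_dim n"
    and start: "progress (((J 2 * out_dim n + J 4) * out_dim n + J 6) * out_dim n) M"
  shows "wp sz Z (PFor out_dim_exp entry_prog) 8 J
    (progress (((J 2 * out_dim n + J 4) * out_dim n + Suc (J 6)) * out_dim n)) M"
proof (rule wp_PFor[where P = "\<lambda>i. progress (((J 2 * out_dim n + J 4) * out_dim n + J 6) * out_dim n + i)"])
  fix i M' assume "i < index_val out_dim_exp J"
    "progress (((J 2 * out_dim n + J 4) * out_dim n + J 6) * out_dim n + i) M'"
  then show "wp sz Z entry_prog (8 + 2) (J(8 := i, 8 + 1 := index_val out_dim_exp J))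
      (progress (((J 2 * out_dim n + J 4) * out_dim n + J 6) * out_dim n + Suc i)) M'"
    using J wp_entry_prog[of "J(8 := i, 8 + 1 := index_val out_dim_exp J)" M' "8 + 2"]
    by (simp add: index_val_layout)
qed (use J start in \<open>simp_all add: index_val_layout algebra_simps\<close>)

lemma wp_slice_loop:
  assumes J: "J 0 = length in_word" "J 1 = n" "J 2 < 2" "J 4 < out_dim n"
    and start: "progress ((J 2 * out_dim n + J 4) * out_dim n * out_dim n) M"
  shows "wp sz Z (PFor out_dim_exp (PFor out_dim_exp entry_prog)) 6 J
    (progress ((J 2 * out_dim n + Suc (J 4)) * out_dim n * out_dim n)) M"
proof (rule wp_PFor[where P = "\<lambda>i. progress (((J 2 * out_dim n + J 4) * out_dim n + i) * out_dim n)"])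
  fix i M' assume "i < index_val out_dim_exp J" "progress (((J 2 * out_dim n + J 4) * out_dim n + i) * out_dim n) M'"
  then show "wp sz Z (PFor out_dim_exp entry_prog) (6 + 2) (J(6 := i, 6 + 1 := index_val out_dim_exp J))
      (progress (((J 2 * out_dim n + J 4) * out_dim n + Suc i) * out_dim n)) M'"
    using J wp_row_loop[of "J(6 := i, 6 + 1 := index_val out_dim_exp J)" M']
    by (simp add: index_val_layout del: wp.simps)
qed (use J start in \<open>simp_all add: index_val_layout algebra_simps\<close>)

lemma wp_array_loop:
  assumes J: "J 0 = length in_word" "J 1 = n" "J 2 < 2"
    and start: "progress (J 2 * out_dim n * out_dim n * out_dim n) M"
  shows "wp sz Z (PFor out_dim_exp (PFor out_dim_exp (PFor out_dim_exp entry_prog))) 4 J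
    (progress (Suc (J 2) * out_dim n * out_dim n * out_dim n)) M"
proof (rule wp_PFor[where P = "\<lambda>i. progress ((J 2 * out_dim n + i) * out_dim n * out_dim n)"])
  fix i M' assume "i < index_val out_dim_exp J" "progress ((J 2 * out_dim n + i) * out_dim n * out_dim n) M'"
  then show "wp sz Z (PFor out_dim_exp (PFor out_dim_exp entry_prog)) (4 + 2)
      (J(4 := i, 4 + 1 := index_val out_dim_exp J)) (progress ((J 2 * out_dim n + Suc i) * out_dim n * out_dim n)) M'"
    using J wp_slice_loop[of "J(4 := i, 4 + 1 := index_val out_dim_exp J)" M']
    by (simp add: index_val_layout del: wp.simps)
qed (use J start in \<open>simp_all add: index_val_layout algebra_simps\<close>)

lemma wp_entry_loops:
  assumes I: "I 0 = length in_word" "I 1 = n" and start: "progress 0 M"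
  shows "wp sz Z (PFor (IConst 2) (PFor out_dim_exp (PFor out_dim_exp (PFor out_dim_exp entry_prog)))) 2 I
    (progress (out_size n)) M"
proof (rule wp_PFor[where P = "\<lambda>i. progress (i * out_dim n * out_dim n * out_dim n)"])
  fix i M' assume "i < index_val (IConst 2) I" "progress (i * out_dim n * out_dim n * out_dim n) M'"
  then show "wp sz Z (PFor out_dim_exp (PFor out_dim_exp (PFor out_dim_exp entry_prog))) (2 + 2)
      (I(2 := i, 2 + 1 := index_val (IConst 2) I)) (progress (Suc i * out_dim n * out_dim n * out_dim n)) M'"
    using I wp_array_loop[of "I(2 := i, 2 + 1 := index_val (IConst 2) I)" M'] by (simp del: wp.simps)
qed (use start in \<open>simp_all add: out_size_def power3_eq_cube mult.assoc\<close>)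

lemma length_in_word_le: "length in_word \<le> out_size n"
proof -
  have "n \<le> out_dim n" by (simp add: blocks.total_dim_def base_dim_def width_def)
  then show ?thesis by (simp add: length_in_word out_size_def power_mono)
qed

lemma wp_copy_loop:
  assumes I: "I 0 = length in_word" "I 1 = n" and M: "\<And>j. j < length in_word \<Longrightarrow> M j = in_word ! j"
    and Q: "\<And>M. \<forall>j<length in_word. M (out_size n + j) = in_word ! j \<Longrightarrow> Q M"
  shows "wp sz Z (PFor (IReg 0) (PCopy (IPlus out_size_exp (IReg 2)) (IReg 2))) 2 I Q M"
proof (rule wp_PFor[where P = "\<lambda>i M. (\<forall>j<length in_word. M j = in_word ! j) \<and>
    (\<forall>j<i. M (out_size n + j) = in_word ! j)"])
  fix i M' assume "i < index_val (IReg 0) I"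
    and M': "(\<forall>j<length in_word. M' j = in_word ! j) \<and> (\<forall>j<i. M' (out_size n + j) = in_word ! j)"
  then have i: "i < length in_word" using I by simp
  then have "sz (M' i) \<le> Z" using M' size_in_word[of i] X_le_Z by simp
  then show "wp sz Z (PCopy (IPlus out_size_exp (IReg 2)) (IReg 2)) (2 + 2) (I(2 := i, 2 + 1 := index_val (IReg 0) I))
      (\<lambda>M. (\<forall>j<length in_word. M j = in_word ! j) \<and> (\<forall>j<Suc i. M (out_size n + j) = in_word ! j)) M'"
    using M' i I length_in_word_le by (auto simp: index_val_layout less_Suc_eq)
qed (use M Q I in auto)

lemma wp_main_prog:
  assumes I: "I 0 = length in_word" "I 1 = n" and M: "\<And>j. j < length in_word \<Longrightarrow> M j = in_word ! j"
  shows "wp sz Z (main_prog \<epsilon>) 2 I (progress (out_size n)) M"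
  unfolding main_prog_def wp.simps(2)
proof (rule wp_copy_loop[OF I M])
  fix M' assume "\<forall>j<length in_word. M' (out_size n + j) = in_word ! j"
  then have "progress 0 (M'(out_size n + length in_word := 1, out_size n + length in_word + 1 := \<epsilon>))"
    by (simp add: progress_def input_intact_def)
  from wp_entry_loops[OF I this] show "wp sz Z (PConst one_cell 1) 2 I (wp sz Z (PConst eps_cell \<epsilon>) 2 I
      (wp sz Z (PFor (IConst 2) (PFor out_dim_exp (PFor out_dim_exp (PFor out_dim_exp entry_prog)))) 2 I
        (progress (out_size n)))) M'"
    using X X_le_Z I by (simp add: index_val_layout del: wp.simps(3))
qed

end

definition cube_exp :: index_exp where "cube_exp = ITimes (ITimes (ITimes (IConst 2) (IReg 1)) (IReg 1)) (IReg 1)"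

lemma index_val_cube_exp: "index_val cube_exp I = 2 * I 1 ^ 3"
  by (simp add: cube_exp_def power3_eq_cube)

lemma index_scoped_cube_exp: "index_scoped 2 cube_exp"
  by (simp add: cube_exp_def)

text \<open>Register 1 is increased until \<open>2 * n ^ 3\<close> reaches the length of the input.\<close>

definition dimension_com :: "'a com" where
  "dimension_com = Seq (index_compile cube_exp 2) (While (IndexLess 2 0)
     (Seq (IndexConst 3 1) (Seq (IndexAdd 1 1 3) (index_compile cube_exp 2))))"

definition dimension_time :: "nat \<Rightarrow> nat" where
  "dimension_time B = index_time cube_exp B + (B * (1 + (1 + index_time cube_exp B) + 1) + 1)"

lemma runs_dimension_com:
  fixes sz :: "'a::field \<Rightarrow> nat"
  assumes I: "I 0 = 2 * n ^ 3" "I 1 = 0" "I 0 \<le> B"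
    and Q: "\<And>J. J 0 = 2 * n ^ 3 \<Longrightarrow> J 1 = n \<Longrightarrow> Q (J, M)"
  shows "runs sz dimension_com (I, M) (dimension_time B) Q"
proof -
  have nB: "n \<le> B" using I le_cube[of n] by linarith
  define P :: "nat \<Rightarrow> 'a state \<Rightarrow> bool" where
    "P m = (\<lambda>(J, M'). M' = M \<and> m \<le> n \<and> J 0 = 2 * n ^ 3 \<and> J 1 = n - m \<and> J 2 = 2 * (n - m) ^ 3)" for m
  have loop: "runs sz (While (IndexLess 2 0) (Seq (IndexConst 3 1) (Seq (IndexAdd 1 1 3) (index_compile cube_exp 2))))
      (J, M) (n * (1 + (1 + index_time cube_exp B) + 1) + 1) Q" if "P n (J, M)" for J
  proof (rule runs_While_IndexLess[of P, OF _ _ that])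
    fix m J M' assume "P (Suc m) (J, M')"
    then have J: "M' = M" "m < n" "J 0 = 2 * n ^ 3" "J 1 = n - Suc m" "J 2 = 2 * (n - Suc m) ^ 3"
      by (auto simp: P_def)
    have "runs sz (Seq (IndexConst 3 1) (Seq (IndexAdd 1 1 3) (index_compile cube_exp 2))) (J, M')
        (1 + (1 + index_time cube_exp B)) (P m)"
      by (intro runs_Seq runs_IndexConst runs_IndexAdd runs_index_compile[OF index_scoped_cube_exp])
        (use J I nB in \<open>auto simp: P_def index_val_cube_exp less_2_cases_iff Suc_diff_Suc\<close>)
    moreover have "J 2 < J 0" using J by (simp add: power_strict_mono)
    ultimately show "J 2 < J 0 \<and> runs sz (Seq (IndexConst 3 1) (Seq (IndexAdd 1 1 3) (index_compile cube_exp 2)))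
        (J, M') (1 + (1 + index_time cube_exp B)) (P m)" by blast
  qed (auto simp: P_def intro: Q)
  have "runs sz dimension_com (I, M) (index_time cube_exp B + (n * (1 + (1 + index_time cube_exp B) + 1) + 1)) Q"
    unfolding dimension_com_def
    by (intro runs_Seq runs_index_compile[OF index_scoped_cube_exp] loop)
      (use I in \<open>auto simp: P_def index_val_cube_exp less_2_cases_iff\<close>)
  then show ?thesis
    by (rule runs_mono) (use mult_le_mono1[OF nB] in \<open>simp_all only: dimension_time_def add_le_mono le_refl\<close>)
qed

definition set_length_com :: "'a com" where
  "set_length_com = Seq (index_compile out_size_exp 2) (Seq (IndexConst 3 0) (IndexAdd 0 2 3))"

lemma runs_set_length_com:
  assumes "I 1 = n" "I 0 \<le> B" "n \<le> B" and Q: "\<And>J. J 0 = out_size n \<Longrightarrow> Q (J, M)"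
  shows "runs sz set_length_com (I, M) (index_time out_size_exp B + (1 + 1)) Q"
  unfolding set_length_com_def
proof (intro runs_Seq runs_index_compile[of 2] runs_IndexConst runs_IndexAdd)
  fix J :: "nat \<Rightarrow> nat" assume "J 2 = index_val out_size_exp I"
  then show "Q ((J(3 := 0))(0 := (J(3 := 0)) 2 + (J(3 := 0)) 3), M)"
    using assms(1) by (intro Q) (simp add: index_val_layout)
qed (use assms in \<open>auto simp: less_2_cases_iff\<close>)

definition reduction_com :: "'a::field \<Rightarrow> 'a com" where
  "reduction_com \<epsilon> = Seq dimension_com (Seq (prog_compile (main_prog \<epsilon>) 2) set_length_com)"

definition reduction_time :: "'a::field \<Rightarrow> nat \<Rightarrow> nat \<Rightarrow> nat" where
  "reduction_time \<epsilon> B Z = dimension_time B + (prog_time (main_prog \<epsilon>) B Z + (index_time out_size_exp B + (1 + 1)))"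

lemma (in reduction_program) runs_reduction_com:
  assumes B: "length in_word \<le> B"
  shows "runs sz (reduction_com \<epsilon>) (input_state in_word) (reduction_time \<epsilon> B Z)
    (\<lambda>s. output_word s = out_word \<and> (\<forall>x\<in>set out_word. sz x \<le> Z))"
  unfolding reduction_com_def reduction_time_def input_state_def
proof (intro runs_Seq runs_dimension_com)
  let ?M = "\<lambda>i. if i < length in_word then in_word ! i else 0"
  have nB: "n \<le> B" using B length_in_word le_cube[of n] by linarith
  fix J :: "nat \<Rightarrow> nat" assume "J 0 = 2 * n ^ 3" and n: "J 1 = n"
  then have J: "J 0 = length in_word" by (simp add: length_in_word)
  show "runs sz (prog_compile (main_prog \<epsilon>) 2) (J, ?M) (prog_time (main_prog \<epsilon>) B Z)
      (\<lambda>s'. runs sz set_length_com s' (index_time out_size_exp B + (1 + 1))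
        (\<lambda>s. output_word s = out_word \<and> (\<forall>x\<in>set out_word. sz x \<le> Z)))"
  proof (rule correctly_compiledD[OF correctly_compiled_prog wp_main_prog[OF J n] prog_scoped_main_prog])
    show "J r \<le> B" if "r < 2" for r using that J n B nB by (auto simp: less_2_cases_iff)
    fix L M' assume M': "progress (out_size n) M'" and "\<And>r. r < 2 \<Longrightarrow> L r = J r"
    then have L: "L 0 = length in_word" "L 1 = n" using J n by simp_all
    show "runs sz set_length_com (L, M') (index_time out_size_exp B + (1 + 1))
        (\<lambda>s. output_word s = out_word \<and> (\<forall>x\<in>set out_word. sz x \<le> Z))"
    proof (rule runs_set_length_com[where I = L, OF L(2)])
      show "output_word (K, M') = out_word \<and> (\<forall>x\<in>set out_word. sz x \<le> Z)" if "K 0 = out_size n" for K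
        using that M'
        by (auto simp: output_word_def progress_def length_out_word list_eq_iff_nth_eq in_set_conv_nth)
    qed (use L B nB in simp_all)
  qed simp
qed (use B in \<open>simp_all add: length_in_word\<close>)

section \<open>Polynomial-time equivalence\<close>

lemma poly_bounded_reduction_time: "poly_bounded \<zeta> \<Longrightarrow> poly_bounded (\<lambda>x. reduction_time \<epsilon> x (\<zeta> x))"
  unfolding reduction_time_def dimension_time_def
  by (intro poly_bounded_add poly_bounded_mult poly_bounded_const poly_bounded_id poly_bounded_index_time
      poly_bounded_prog_time)

lemma word_size_le: "(\<And>x. x \<in> set w \<Longrightarrow> sz x \<le> X) \<Longrightarrow> word_size sz w \<le> length w * (1 + X)"
  unfolding word_size_def using sum_list_mono[of w "\<lambda>x. 1 + sz x" "\<lambda>_. 1 + X"] by (simp add: sum_list_triv)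

lemma length_le_word_size: "length w \<le> word_size sz w"
  by (induction w) (auto simp: word_size_def)

lemma size_le_word_size: "x \<in> set w \<Longrightarrow> sz x \<le> word_size sz w"
  by (induction w) (auto simp: word_size_def)

lemma (in reduction_program) exec_reduction_com:
  assumes B: "length in_word \<le> B"
  obtains t s where "exec sz (reduction_com \<epsilon>) (input_state in_word) t s" "output_word s = out_word"
    "t + word_size sz out_word \<le> reduction_time \<epsilon> B Z + index_bound out_size_exp B * (1 + Z)"
proof -
  obtain t s where run: "exec sz (reduction_com \<epsilon>) (input_state in_word) t s" "t \<le> reduction_time \<epsilon> B Z"
    "output_word s = out_word" "\<forall>x\<in>set out_word. sz x \<le> Z"
    using runs_reduction_com[OF B] by (auto elim: runsE)
  have "n \<le> B" using B length_in_word le_cube[of n] by linarith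
  then have "length out_word \<le> index_bound out_size_exp B"
    using index_val_le_bound[of 2 out_size_exp "(\<lambda>_. 0)(1 := n)" B]
    by (simp add: length_out_word index_val_layout)
  then have "word_size sz out_word \<le> index_bound out_size_exp B * (1 + Z)"
    using word_size_le[of out_word sz Z] run(4) mult_le_mono1 le_trans by blast
  with run that show ?thesis by (simp add: add_le_mono)
qed

lemma form_equivalence_problem_mem_fst:
  "w \<in> fst (form_equivalence_problem P) \<longleftrightarrow> (\<exists>n \<phi> \<psi>. w = form_array n \<phi> @ form_array n \<psi> \<and>
    trilinear_form n \<phi> \<and> trilinear_form n \<psi> \<and> P n \<phi> \<and> P n \<psi>)"
  by (auto simp: form_equivalence_problem_def)

lemma form_equivalence_problem_out_form:
  assumes tri: "trilinear_form n \<phi>" "trilinear_form n \<psi>" and P: "P n \<phi>" "P n \<psi>" and eps: "\<epsilon> \<noteq> 0"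
    and P': "\<And>N T. P' N (sym3 \<epsilon> T)"
  defines "w' \<equiv> form_array (out_dim n) (out_form n \<epsilon> \<phi>) @ form_array (out_dim n) (out_form n \<epsilon> \<psi>)"
  shows "w' \<in> fst (form_equivalence_problem P')"
    and "form_array n \<phi> @ form_array n \<psi> \<in> snd (form_equivalence_problem P) \<longleftrightarrow>
      w' \<in> snd (form_equivalence_problem P')"
proof -
  have out: "trilinear_form (out_dim n) (out_form n \<epsilon> T)" "P' (out_dim n) (out_form n \<epsilon> T)"
    if "trilinear_form n T" for T
    using trilinear_form_out_form[OF that] P' by (simp_all add: out_form_def blocks.labelled_form_def)
  show "w' \<in> fst (form_equivalence_problem P')"
    unfolding w'_def form_equivalence_problem_mem_fst using out tri by blast
  show "form_array n \<phi> @ form_array n \<psi> \<in> snd (form_equivalence_problem P) \<longleftrightarrow>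
      w' \<in> snd (form_equivalence_problem P')"
    unfolding w'_def using tri P out eps
    by (simp add: form_array_append_in_yes_instances_iff equivalent_out_forms_iff)
qed

lemma poly_time_reducible_form_equivalence:
  fixes sz :: "'a::field \<Rightarrow> nat"
  assumes sz: "admissible_size sz" and eps: "\<epsilon> \<noteq> 0" and P': "\<And>N T. P' N (sym3 \<epsilon> T)"
  shows "poly_time_reducible sz (form_equivalence_problem P) (form_equivalence_problem P')"
proof -
  obtain p where p: "\<And>f x y. sz (eval_op f x y) \<le> poly p (sz x + sz y)"
    using sz unfolding admissible_size_def by blast
  define \<zeta> where "\<zeta> x = size_bound p 73 (x + (sz 0 + sz 1 + sz \<epsilon>))" for x
  have \<zeta>: "poly_bounded \<zeta>"
    unfolding \<zeta>_def by (intro poly_bounded_size_bound poly_bounded_add poly_bounded_id poly_bounded_const)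
  have "poly_bounded (\<lambda>x. reduction_time \<epsilon> x (\<zeta> x) + index_bound out_size_exp x * (1 + \<zeta> x))"
    by (intro poly_bounded_add poly_bounded_mult poly_bounded_const poly_bounded_reduction_time \<zeta>
        poly_bounded_index_bound poly_bounded_id)
  then obtain b where b: "\<And>x. reduction_time \<epsilon> x (\<zeta> x) + index_bound out_size_exp x * (1 + \<zeta> x) \<le> poly b x"
    unfolding poly_bounded_def by blast
  show ?thesis
    unfolding poly_time_reducible_def
  proof (intro exI[of _ "reduction_com \<epsilon>"] exI[of _ b] ballI)
    fix w :: "'a list" assume "w \<in> fst (form_equivalence_problem P)"
    then obtain n \<phi> \<psi> where w: "w = form_array n \<phi> @ form_array n \<psi>"
      and tri: "trilinear_form n \<phi>" "trilinear_form n \<psi>" and P: "P n \<phi>" "P n \<psi>"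
      unfolding form_equivalence_problem_mem_fst by blast
    define x where "x = word_size sz w"
    interpret reduction_program sz p \<epsilon> n \<phi> \<psi> "x + (sz 0 + sz 1 + sz \<epsilon>)" "\<zeta> x"
    proof
      show "sz y \<le> x + (sz 0 + sz 1 + sz \<epsilon>)" if "y \<in> set (form_array n \<phi> @ form_array n \<psi>)" for y
        using size_le_word_size[of y w sz] that unfolding w x_def by simp
    qed (use p tri in \<open>auto simp: \<zeta>_def\<close>)
    have in_word: "in_word = w" by (simp add: in_word_def w)
    have "length in_word \<le> x" unfolding in_word x_def by (rule length_le_word_size)
    then obtain t s where run: "exec sz (reduction_com \<epsilon>) (input_state in_word) t s" "output_word s = out_word"
      "t + word_size sz out_word \<le> reduction_time \<epsilon> x (\<zeta> x) + index_bound out_size_exp x * (1 + \<zeta> x)"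
      by (rule exec_reduction_com)
    have time: "t + word_size sz out_word \<le> poly b (word_size sz w)"
      using run(3) b[of x] unfolding x_def by linarith
    show "\<exists>t s. exec sz (reduction_com \<epsilon>) (input_state w) t s \<and>
        t + word_size sz (output_word s) \<le> poly b (word_size sz w) \<and>
        output_word s \<in> fst (form_equivalence_problem P') \<and>
        (w \<in> snd (form_equivalence_problem P) \<longleftrightarrow> output_word s \<in> snd (form_equivalence_problem P'))"
      using run(1) time in_word form_equivalence_problem_out_form[where P = P and P' = P', OF tri P eps P']
      by (intro exI[of _ t] exI[of _ s]) (simp add: run(2) w out_word_def)
  qed
qed

theorem theorem1p2:
  fixes sz :: "'a::field \<Rightarrow> nat"
  assumes "admissible_size sz"
  shows "poly_time_equivalent sz
    (alternating_form_equivalence :: 'a problem) (symmetric_form_equivalence :: 'a problem)"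
  unfolding poly_time_equivalent_def alternating_form_equivalence_def symmetric_form_equivalence_def
  using poly_time_reducible_form_equivalence[OF assms, of 1 symmetric_form alternating_form]
    poly_time_reducible_form_equivalence[OF assms, of "-1" alternating_form symmetric_form]
  by (simp add: symmetric_form_sym3 alternating_form_sym3)

end
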